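(* For every integer $d\ge 1$, every cubical $d$-polytope is $\lfloor d/2\rfloor$-linked; that is, its graph is $\lfloor d/2\rfloor$-linked.
   Context: A $d$-polytope is a convex polytope of dimension $d$. A cube is any polytope combinatorially equivalent (isomorphic face lattice) to the convex hull of the vectors $(\pm1,\ldots,\pm1)$ in some $\mathbb{R}^n$. A cubical $d$-polytope is a $d$-polytope all of whose facets are ($(d-1)$-dimensional) cubes. The graph of a polytope is the undirected graph formed by its vertices and edges. A graph $G$ is $k$-linked if it has at least $2k$ vertices and, for every set of $2k$ distinct vertices of $G$ and every partition of this set into $k$ pairs $\{s_1,t_1\},\ldots,\{s_k,t_k\}$, there exist $k$ pairwise vertex-disjoint paths $L_1,\ldots,L_k$ in $G$ such that $L_i$ joins $s_i$ and $t_i$ for each $i$. *)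

theory Defs
  imports
    "HOL-Analysis.Analysis"
    "HOL-Library.Disjoint_Sets"
    "Graph_Theory.Graph_Theory"
begin

(* Face lattices include the empty face and the polytope itself, as face_of does. *)

definition combinatorially_equivalent ::
    "'a::euclidean_space set \<Rightarrow> 'b::euclidean_space set \<Rightarrow> bool" where
  "combinatorially_equivalent P Q \<longleftrightarrow>
     (\<exists>\<phi>. bij_betw \<phi> {F. F face_of P} {G. G face_of Q} \<and>
          (\<forall>F F'. F face_of P \<longrightarrow> F' face_of P \<longrightarrow> (F \<subseteq> F' \<longleftrightarrow> \<phi> F \<subseteq> \<phi> F')))"

(* The convex hull of the vectors (+-1, ..., +-1) of R^n, with R^n realised as the
   coordinate subspace spanned by a set B of n standard basis vectors of the ambient space.
   B = {} gives the point {0}, the cube of R^0. *)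

definition standard_cube :: "'a::euclidean_space set \<Rightarrow> 'a set" where
  "standard_cube B = convex hull {\<Sum>b\<in>B. \<epsilon> b *\<^sub>R b | \<epsilon>. \<forall>b\<in>B. \<epsilon> b \<in> {- 1, 1}}"

(* Choosing the standard cube inside the ambient space of C loses nothing: a polytope
   combinatorially equivalent to the n-cube has dimension n, so n basis vectors exist. *)

definition is_cube :: "'a::euclidean_space set \<Rightarrow> bool" where
  "is_cube C \<longleftrightarrow>
     polytope C \<and> (\<exists>B\<subseteq>(Basis :: 'a set). combinatorially_equivalent C (standard_cube B))"

lemma is_cube_standard_cube:
  fixes B :: "'a::euclidean_space set"
  assumes "B \<subseteq> Basis"
  shows "is_cube (standard_cube B)"
proof -
  have "finite B"
    using assms finite_Basis finite_subset by blast
  have "{\<Sum>b\<in>B. \<epsilon> b *\<^sub>R b | \<epsilon>. \<forall>b\<in>B. \<epsilon> b \<in> {- 1, 1}} \<subseteq>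
          (\<lambda>\<epsilon>. \<Sum>b\<in>B. \<epsilon> b *\<^sub>R b) ` (B \<rightarrow>\<^sub>E {- 1, 1})" (is "?S \<subseteq> ?T")
  proof
    fix x assume "x \<in> ?S"
    then obtain \<epsilon> where "\<forall>b\<in>B. \<epsilon> b \<in> {- 1, 1}" "x = (\<Sum>b\<in>B. \<epsilon> b *\<^sub>R b)"
      by blast
    then have "x = (\<Sum>b\<in>B. restrict \<epsilon> B b *\<^sub>R b)" "restrict \<epsilon> B \<in> B \<rightarrow>\<^sub>E {- 1, 1}"
      by auto
    then show "x \<in> ?T"
      by blast
  qed
  moreover have "finite ?T"
    using \<open>finite B\<close> by (intro finite_imageI finite_PiE) auto
  ultimately have "polytope (standard_cube B)"
    unfolding standard_cube_def polytope_def using finite_subset by blast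
  moreover have "combinatorially_equivalent (standard_cube B) (standard_cube B)"
    unfolding combinatorially_equivalent_def by (rule exI[of _ id]) auto
  ultimately show ?thesis
    using assms unfolding is_cube_def by blast
qed

definition cubical_polytope :: "nat \<Rightarrow> 'a::euclidean_space set \<Rightarrow> bool" where
  "cubical_polytope d P \<longleftrightarrow>
     polytope P \<and> aff_dim P = int d \<and> (\<forall>F. F facet_of P \<longrightarrow> is_cube F)"

(* Undirected graphs are rendered as symmetric loopfree pair digraphs (locale pair_graph). *)

definition polytope_graph :: "'a::euclidean_space set \<Rightarrow> 'a pair_pre_digraph" where
  "polytope_graph P =
     \<lparr> pverts = {v. v extreme_point_of P},
       parcs = {(u, v). closed_segment u v edge_of P} \<rparr>"

lemma pair_graph_polytope_graph:
  assumes "polytope P"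
  shows "pair_graph (polytope_graph P)"
proof -
  have fin: "finite {v. v extreme_point_of P}"
    using assms finite_polyhedron_extreme_points polytope_imp_polyhedron by blast
  have ends: "u extreme_point_of P" "v extreme_point_of P"
    if "closed_segment u v edge_of P" for u v
    using that unfolding edge_of_def
    by (meson extreme_point_of_face extreme_point_of_segment)+
  have "{(u, v). closed_segment u v edge_of P} \<subseteq>
          {v. v extreme_point_of P} \<times> {v. v extreme_point_of P}"
    using ends by auto
  then have "finite {(u, v). closed_segment u v edge_of P}"
    using fin finite_subset by blast
  moreover have "u \<noteq> v" if "closed_segment u v edge_of P" for u v
    using that by (auto simp: edge_of_def)
  ultimately show ?thesis
    using fin ends
    by unfold_locales
       (auto simp: polytope_graph_def symmetric_def sym_def closed_segment_commute)
qed

(* Meant for finite graphs, where card is the number of vertices. A partition of X into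
   2-element sets is a partition into pairs {s, t}; the path L e joins the two elements
   of the pair e. *)

definition k_linked :: "nat \<Rightarrow> 'a pair_pre_digraph \<Rightarrow> bool" where
  "k_linked k G \<longleftrightarrow>
     2 * k \<le> card (pverts G) \<and>
     (\<forall>X M. X \<subseteq> pverts G \<and> finite X \<and> card X = 2 * k \<and>
            partition_on X M \<and> card M = k \<and> (\<forall>e\<in>M. card e = 2) \<longrightarrow>
        (\<exists>L. (\<forall>e\<in>M. vpath (L e) (with_proj G) \<and> {hd (L e), last (L e)} = e) \<and>
             (\<forall>e\<in>M. \<forall>e'\<in>M. e \<noteq> e' \<longrightarrow> set (L e) \<inter> set (L e') = {})))"

end

theory Submission
  imports Defs
begin

text \<open>
  Write \<open>d = 2k\<close> or \<open>d = 2k + 1\<close>. A facet of a cubical \<open>d\<close>-polytope is a \<open>(d - 1)\<close>-cube, and for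
  \<open>d \<ge> 5\<close> the graph of this cube is already \<open>k\<close>-linked. By Balinski's theorem the graph of the
  polytope is \<open>d\<close>-connected, so Menger's theorem provides \<open>2k \<le> d\<close> disjoint paths from the given
  terminals to the facet, each meeting the facet only in its last vertex; linking these last vertices
  inside the facet completes the proof. The \<open>3\<close>-cube is planar and not \<open>2\<close>-linked, so \<open>d = 4\<close> needs
  another argument, and it works for every \<open>4\<close>-polytope: four vertices lie on a hyperplane, and a pair
  on either side of it is joined by monotone paths away from the hyperplane. For \<open>d \<le> 3\<close> only the
  connectedness of the graph is used.

  Linkedness of the \<open>n\<close>-cube for \<open>n \<ge> 4\<close> is proved by induction on \<open>n\<close> in a form that allows forbidden
  vertices: if \<open>n + 1\<close> distinct vertices are given, some of them paired and the others forbidden, then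
  the pairs can be joined by disjoint paths that avoid the forbidden vertices
  (\<open>cube_links_ge_4\<close>). A direction \<open>i\<close> of the cube splits it into two facets. Each
  pair is assigned to a facet that hosts it: ends of the pair in the other facet cross along
  direction \<open>i\<close>, and the vertices that they leave become forbidden. As long as each facet keeps
  one special vertex that does not cross, both facets have at most \<open>n\<close> special vertices and the
  induction applies to each of them. Crossing fails only when the special vertices contain an edge of
  direction \<open>i\<close>. If they contain an edge of every direction, then choosing one edge for each
  direction gives a spanning tree, and a leaf of this tree is alone in one of the two facets for the
  direction of its edge, which is an easy case. The induction cannot start before \<open>n = 4\<close>, where the facets
  are \<open>3\<close>-cubes; there the direction has to be chosen such that each facet hosts one of two pairs.

  Paths are handled as vertex sets in which two vertices are connected, so that disjointness
  and avoidance are statements about sets; lists of vertices appear only in Menger's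
  theorem and in the final translation.
\<close>

section \<open>Connection inside a vertex set and linkages\<close>

inductive joined :: "('a \<Rightarrow> 'a \<Rightarrow> bool) \<Rightarrow> 'a set \<Rightarrow> 'a \<Rightarrow> 'a \<Rightarrow> bool"
  for E C where
  joined_refl: "x \<in> C \<Longrightarrow> joined E C x x"
| joined_step: "joined E C x y \<Longrightarrow> E y z \<Longrightarrow> z \<in> C \<Longrightarrow> joined E C x z"

lemma joined_memD: "joined E C x y \<Longrightarrow> x \<in> C \<and> y \<in> C"
  by (induction rule: joined.induct) auto

lemma joined_mono: "joined E C x y \<Longrightarrow> C \<subseteq> D \<Longrightarrow> joined E D x y"
  by (induction rule: joined.induct) (auto intro: joined.intros)

lemma joined_trans: "joined E C y z \<Longrightarrow> joined E C x y \<Longrightarrow> joined E C x z"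
  by (induction rule: joined.induct) (auto intro: joined.intros)

lemma joined_edge: "E x y \<Longrightarrow> x \<in> C \<Longrightarrow> y \<in> C \<Longrightarrow> joined E C x y"
  by (auto intro: joined.intros)

lemma joined_sym:
  assumes "joined E C x y" "symp E"
  shows "joined E C y x"
  using assms
proof (induction rule: joined.induct)
  case (joined_step x y z)
  then have "joined E C z y"
    by (meson joined_edge joined_memD sympD)
  with joined_step show ?case
    using joined_trans by fast
qed (rule joined_refl)

lemma joined_image:
  assumes "joined E C x y" and "\<And>u v. u \<in> C \<Longrightarrow> v \<in> C \<Longrightarrow> E u v \<Longrightarrow> E' (f u) (f v)"
  shows "joined E' (f ` C) (f x) (f y)"
  using assms(1)
proof (induction rule: joined.induct)
  case (joined_step x y z)
  then show ?case
    using assms(2) joined_memD[of E C x y] by (metis imageI joined.joined_step)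
qed (simp add: joined_refl)

text \<open>
  \<open>C k\<close> carries the path of the pair \<open>k\<close>. Pairs are indexed so that terminals can be moved by
  composing \<open>s\<close> and \<open>t\<close> with a map.
\<close>

definition linkable ::
  "('a \<Rightarrow> 'a \<Rightarrow> bool) \<Rightarrow> 'a set \<Rightarrow> 'k set \<Rightarrow> ('k \<Rightarrow> 'a) \<Rightarrow> ('k \<Rightarrow> 'a) \<Rightarrow> 'a set \<Rightarrow> bool" where
  "linkable E V I s t Ob \<longleftrightarrow>
     (\<exists>C. (\<forall>k\<in>I. joined E (C k) (s k) (t k) \<and> C k \<subseteq> V - Ob) \<and> disjoint_family_on C I)"

definition terminals :: "'a set \<Rightarrow> 'k set \<Rightarrow> ('k \<Rightarrow> 'a) \<Rightarrow> ('k \<Rightarrow> 'a) \<Rightarrow> 'a set \<Rightarrow> bool" where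
  "terminals V I s t Ob \<longleftrightarrow> finite I \<and> finite Ob \<and> inj_on s I \<and> inj_on t I \<and>
     s ` I \<inter> t ` I = {} \<and> (s ` I \<union> t ` I) \<inter> Ob = {} \<and> s ` I \<union> t ` I \<union> Ob \<subseteq> V"

lemma card_terminals:
  assumes "terminals V I s t Ob"
  shows "card (s ` I \<union> t ` I \<union> Ob) = 2 * card I + card Ob"
  using assms unfolding terminals_def by (simp add: card_Un_disjoint card_image)

lemma linkable_swap:
  assumes "linkable E V I s t Ob" "symp E"
  shows "linkable E V I t s Ob"
  using assms joined_sym unfolding linkable_def by metis

lemma terminals_swap: "terminals V I s t Ob \<Longrightarrow> terminals V I t s Ob"
  unfolding terminals_def by auto

lemma linkable_empty: "linkable E V {} s t Ob"
  unfolding linkable_def by (simp add: disjoint_family_on_def)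

lemma linkable_single:
  assumes "joined E (V - Ob) (s k) (t k)"
  shows "linkable E V {k} s t Ob"
  unfolding linkable_def by (rule exI[of _ "\<lambda>_. V - Ob"]) (simp add: assms disjoint_family_on_def)

section \<open>The graph of a cube\<close>

definition flip :: "'i \<Rightarrow> ('i \<Rightarrow> bool) \<Rightarrow> 'i \<Rightarrow> bool" where
  "flip i v = v(i := \<not> v i)"

definition adj :: "('i \<Rightarrow> bool) \<Rightarrow> ('i \<Rightarrow> bool) \<Rightarrow> bool" where
  "adj u v \<longleftrightarrow> (\<exists>i. v = flip i u)"

text \<open>
  The cube spanned by the coordinates \<open>B\<close> through the base point \<open>a\<close>. Keeping the base point makes a
  facet of a cube a cube again, over \<open>B - {i}\<close>, without any change of coordinates.
\<close>

definition cube :: "'i set \<Rightarrow> ('i \<Rightarrow> bool) \<Rightarrow> ('i \<Rightarrow> bool) set" where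
  "cube B a = {v. \<forall>i. i \<notin> B \<longrightarrow> v i = a i}"

lemma flip_flip [simp]: "flip i (flip i v) = v"
  by (simp add: flip_def)

lemma flip_neq [simp]: "flip i v \<noteq> v" "v \<noteq> flip i v"
  by (auto simp: flip_def fun_eq_iff)

lemma flip_eq_swap: "flip i u = v \<longleftrightarrow> u = flip i v"
  by auto

lemma flip_apply: "flip i v j = (if i = j then \<not> v j else v j)"
  by (auto simp: flip_def)

lemma flip_inj: "flip i v = flip j v \<longleftrightarrow> i = j"
  by (auto simp: flip_def fun_eq_iff split: if_splits)

lemma symp_adj: "symp adj"
  unfolding symp_def adj_def by (metis flip_flip)

lemma adj_flip [simp]: "adj v (flip i v)" "adj (flip i v) v"
  unfolding adj_def by (metis flip_flip)+

lemma fun_upd_flip: "v(i := b) = (if v i = b then v else flip i v)"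
  by (auto simp: flip_def fun_eq_iff)

lemma cube_side: "i \<in> B \<Longrightarrow> cube (B - {i}) (a(i := b)) = {v \<in> cube B a. v i = b}"
  by (auto simp: cube_def)

lemma upd_in_side: "v \<in> cube B a \<Longrightarrow> i \<in> B \<Longrightarrow> v(i := b) \<in> cube (B - {i}) (a(i := b))"
  by (auto simp: cube_def)

lemma flip_in_cube: "v \<in> cube B a \<Longrightarrow> i \<in> B \<Longrightarrow> flip i v \<in> cube B a"
  by (auto simp: cube_def flip_def)

lemma joined_upd:
  assumes "u \<in> C" "u(i := b) \<in> C"
  shows "joined adj C u (u(i := b))"
proof (cases "u i = b")
  case True
  then have "u(i := b) = u" by auto
  then show ?thesis using assms by (simp add: joined_refl)
next
  case False
  then have "u(i := b) = flip i u" by (simp add: fun_upd_flip)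
  then show ?thesis using assms by (simp add: joined_edge)
qed

lemma cube_joined_upd:
  assumes "joined adj C (u(i := b)) (v(i := b))"
  shows "joined adj (C \<union> {u, v}) u v"
proof -
  have 1: "joined adj (C \<union> {u, v}) (u(i := b)) (v(i := b))"
    using assms by (rule joined_mono) blast
  note mem = joined_memD[OF 1]
  have "joined adj (C \<union> {u, v}) u (u(i := b))"
    using mem by (intro joined_upd) auto
  moreover have "joined adj (C \<union> {u, v}) (v(i := b)) v"
    using mem by (intro joined_sym[OF joined_upd symp_adj]) auto
  ultimately show ?thesis
    using 1 joined_trans by metis
qed

text \<open>
  The \<open>n\<close>-cube stays connected after the removal of fewer than \<open>n\<close> vertices. The two vertices are moved
  into a common facet that misses some removed vertex (or contains none at all) and joined there. If
  they agree in no coordinate, the facets are chosen in a direction in which the neighbour of \<open>u\<close> is not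
  removed.
\<close>

lemma cube_minus_few_joined:
  assumes "finite B" "finite Ob" "card Ob < card B \<or> Ob = {}"
    and "u \<in> cube B a - Ob" "v \<in> cube B a - Ob"
  shows "joined adj (cube B a - Ob) u v"
  using assms
proof (induction "card B" arbitrary: B a Ob u v)
  case 0
  then have "u = v" by (auto simp: cube_def)
  then show ?case using 0 by (auto intro: joined_refl)
next
  case (Suc n)
  show ?case
  proof (cases "u = v")
    case True
    then show ?thesis using Suc(6) by (auto intro: joined_refl)
  next
    case False
    let ?side = "\<lambda>i b. cube (B - {i}) (a(i := b))"
    \<comment> \<open>the induction hypothesis in the facet with coordinate \<open>b\<close>, entered from both ends\<close>
    have side: ?thesis
      if i: "i \<in> B" and Ob: "card {x \<in> Ob. x i = b} < n \<or> {x \<in> Ob. x i = b} = {}"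
        and "u(i := b) \<notin> Ob" "v(i := b) \<notin> Ob" for i b
    proof -
      let ?O = "{x \<in> Ob. x i = b}"
      have "joined adj (?side i b - ?O) (u(i := b)) (v(i := b))"
      proof (rule Suc(1))
        show n: "n = card (B - {i})" using Suc(2,3) i by simp
        show "card ?O < card (B - {i}) \<or> ?O = {}"
          unfolding n[symmetric] by (rule Ob)
        show "u(i := b) \<in> ?side i b - ?O" "v(i := b) \<in> ?side i b - ?O"
          using that Suc(6,7) by (auto simp: upd_in_side)
      qed (use Suc(3,4) in auto)
      then have "joined adj ((?side i b - ?O) \<union> {u, v}) u v"
        by (rule cube_joined_upd)
      then show ?thesis
        by (rule joined_mono) (use Suc(6,7) i in \<open>auto simp: cube_side\<close>)
    qed
    have card: "card {x \<in> Ob. x i = b} < n \<or> {x \<in> Ob. x i = b} = {}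
        \<or> (\<forall>x\<in>Ob. x i = b)" for i b
    proof (rule ccontr)
      assume "\<not> ?thesis"
      then have "n \<le> card {x \<in> Ob. x i = b}" and "{x \<in> Ob. x i = b} \<subset> Ob"
        by (auto simp: not_less)
      then have "n < card Ob"
        by (meson Suc.prems(2) le_less_trans psubset_card_mono)
      moreover have "Ob \<noteq> {}" using \<open>n < card Ob\<close> by auto
      ultimately show False using Suc(2,5) by simp
    qed
    have ins: "w(i := b) \<notin> Ob" if "\<forall>x\<in>Ob. x i = (\<not> b)" for w i b
    proof
      assume "w(i := b) \<in> Ob"
      with that have "(w(i := b)) i = (\<not> b)" by (rule bspec)
      then show False by simp
    qed
    show ?thesis
    proof (cases "\<exists>i\<in>B. u i = v i")
      case True
      then obtain i where i: "i \<in> B" "u i = v i" by blast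
      have eq: "u(i := u i) = u" "v(i := u i) = v"
        by (rule fun_upd_triv, rule fun_upd_idem) (simp add: i(2))
      have "u(i := u i) \<notin> Ob" "v(i := u i) \<notin> Ob"
        unfolding eq using Suc(6,7) by blast+
      note stay = this
      show ?thesis
      proof (cases "\<forall>x\<in>Ob. x i = u i")
        case True
        show ?thesis
        proof (rule side[OF i(1)])
          show "card {x \<in> Ob. x i = (\<not> u i)} < n \<or> {x \<in> Ob. x i = (\<not> u i)} = {}"
            using True by auto
        qed (rule ins, unfold not_not, rule True)+
      next
        case False
        show ?thesis
          by (rule side[OF i(1) _ stay]) (use card[of i "u i"] False in satx)
      qed
    next
      case False
      have "\<exists>i\<in>B. flip i u \<notin> Ob"
      proof (rule ccontr)
        assume "\<not> ?thesis"
        then have "(\<lambda>i. flip i u) ` B \<subseteq> Ob" by auto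
        moreover have "inj_on (\<lambda>i. flip i u) B" by (auto simp: inj_on_def flip_inj)
        ultimately have "card B \<le> card Ob"
          by (metis Suc.prems(2) card_image card_mono)
        moreover have "B \<noteq> {}" using Suc(2) by auto
        ultimately show False using Suc(4,5) \<open>(\<lambda>i. flip i u) ` B \<subseteq> Ob\<close> by auto
      qed
      then obtain i where i: "i \<in> B" "flip i u \<notin> Ob" by blast
      then have uv: "v i = (\<not> u i)" using False by auto
      have eq: "v(i := v i) = v" "u(i := u i) = u"
        by (rule fun_upd_triv)+
      have "u(i := v i) = flip i u"
        by (simp add: flip_def uv)
      then have 1: "u(i := v i) \<notin> Ob" "v(i := v i) \<notin> Ob" "u(i := u i) \<notin> Ob"
        unfolding eq using i Suc(6,7) by simp_all
      show ?thesis
      proof (cases "\<forall>x\<in>Ob. x i = v i")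
        case True
        show ?thesis
        proof (rule side[OF i(1) _ 1(3)])
          show "card {x \<in> Ob. x i = u i} < n \<or> {x \<in> Ob. x i = u i} = {}"
            using True uv by auto
          show "v(i := u i) \<notin> Ob"
            by (rule ins) (use True in \<open>unfold uv\<close>)
        qed
      next
        case False
        show ?thesis
          by (rule side[OF i(1) _ 1(1,2)]) (use card[of i "v i"] False in satx)
      qed
    qed
  qed
qed

lemma cube_joined:
  "finite B \<Longrightarrow> u \<in> cube B a \<Longrightarrow> v \<in> cube B a \<Longrightarrow> joined adj (cube B a) u v"
  using cube_minus_few_joined[of B "{}" u a v] by simp

section \<open>Directions of the edges spanned by a vertex set\<close>

definition edge_dirs :: "('i \<Rightarrow> bool) set \<Rightarrow> 'i set" where
  "edge_dirs X = {i. \<exists>x\<in>X. flip i x \<in> X}"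

text \<open>
  One edge for each direction never closes a cycle, because a cycle uses every direction an even number
  of times; hence the bound. In the extremal case these edges form a spanning tree of \<open>X\<close>. Then all of \<open>X\<close>
  agrees outside the directions of the tree, and a leaf of the tree is the only vertex on its side of the
  direction of its edge; a tree has a leaf other than \<open>z\<close>. The proof splits \<open>X\<close> in a direction \<open>i\<close> in which it
  is not constant: in the extremal case both sides are extremal, their directions are disjoint, and an
  edge of direction \<open>i\<close> connects them.
\<close>

lemma edge_dirs_tree:
  assumes "finite X" "X \<noteq> {}"
  shows "finite (edge_dirs X) \<and> card (edge_dirs X) < card X \<and>
    (Suc (card (edge_dirs X)) = card X \<longrightarrow>
      (\<forall>x\<in>X. \<forall>y\<in>X. \<forall>i. i \<notin> edge_dirs X \<longrightarrow> x i = y i) \<and>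
      (\<forall>z\<in>X. 2 \<le> card X \<longrightarrow> (\<exists>x\<in>X. x \<noteq> z \<and> (\<exists>j\<in>edge_dirs X. \<forall>y\<in>X - {x}. y j \<noteq> x j))))"
  using assms
proof (induction X rule: finite_psubset_induct)
  case (psubset X)
  show ?case
  proof (cases "card X \<ge> 2")
    case False
    then have "card X = 1"
      using psubset by (metis One_nat_def card_0_eq less_2_cases not_le)
    then obtain x where "X = {x}" by (auto simp: card_1_singleton_iff)
    then have "edge_dirs X = {}" by (auto simp: edge_dirs_def)
    then show ?thesis using \<open>X = {x}\<close> by auto
  next
    case True
    obtain p q where "p \<in> X" "q \<in> X" "p \<noteq> q"
      using True by (metis One_nat_def Suc_1 card_le_Suc0_iff_eq not_less_eq_eq psubset.hyps)
    moreover from \<open>p \<noteq> q\<close> obtain i where "p i \<noteq> q i" by blast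
    ultimately have i: "\<exists>x\<in>X. x i" "\<exists>x\<in>X. \<not> x i"
      by blast+
    define S where "S b = {x \<in> X. x i = b}" for b
    have SX: "S b \<subset> X" "S b \<noteq> {}" "finite (S b)" for b
      using i psubset(1) by (cases b; force simp: S_def)+
    have cS: "card X = card (S b) + card (S (\<not> b))" for b
    proof -
      have "X = S b \<union> S (\<not> b)" "S b \<inter> S (\<not> b) = {}" by (auto simp: S_def)
      then show ?thesis using SX by (metis card_Un_disjoint)
    qed
    note IH = psubset.IH[OF SX(1) SX(2)]
    have dirs: "edge_dirs X \<subseteq> insert i (edge_dirs (S b) \<union> edge_dirs (S (\<not> b)))" for b
    proof
      fix j assume "j \<in> edge_dirs X"
      then obtain x where "x \<in> X" "flip j x \<in> X" by (auto simp: edge_dirs_def)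
      then show "j \<in> insert i (edge_dirs (S b) \<union> edge_dirs (S (\<not> b)))"
        by (auto simp: edge_dirs_def S_def flip_apply)
    qed
    have fin: "finite (edge_dirs X)"
      using dirs[of True] IH finite_subset by (metis finite_Un finite_insert)
    have sub: "edge_dirs (S b) \<subseteq> edge_dirs X" "i \<notin> edge_dirs (S b)" for b
      by (auto simp: edge_dirs_def S_def flip_apply)
    have cU: "card (insert i (edge_dirs (S b) \<union> edge_dirs (S (\<not> b)))) \<le>
        Suc (card (edge_dirs (S b)) + card (edge_dirs (S (\<not> b))))" for b
      using card_Un_le[of "edge_dirs (S b)" "edge_dirs (S (\<not> b))"] IH[of b] IH[of "\<not> b"]
      by (simp add: card_insert_if)
    have card: "card (edge_dirs X) \<le> Suc (card (edge_dirs (S b)) + card (edge_dirs (S (\<not> b))))" for b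
      using card_mono[OF _ dirs[of b]] cU[of b] IH[of b] IH[of "\<not> b"] by simp
    have less: "card (edge_dirs X) < card X"
      using card[of True] IH[of True] IH[of False] cS[of True] by simp
    have tight: "(\<forall>x\<in>X. \<forall>y\<in>X. \<forall>j. j \<notin> edge_dirs X \<longrightarrow> x j = y j) \<and>
        (\<forall>z\<in>X. \<exists>x\<in>X. x \<noteq> z \<and> (\<exists>j\<in>edge_dirs X. \<forall>y\<in>X - {x}. y j \<noteq> x j))"
      if eq: "Suc (card (edge_dirs X)) = card X"
    proof -
      have tS: "Suc (card (edge_dirs (S b))) = card (S b)" for b
        using card[of b] IH[of b] IH[of "\<not> b"] cS[of b] eq by simp
      have disj: "edge_dirs (S b) \<inter> edge_dirs (S (\<not> b)) = {}" for b
      proof -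
        have "card (edge_dirs X) \<le> Suc (card (edge_dirs (S b) \<union> edge_dirs (S (\<not> b))))"
          using card_mono[OF _ dirs[of b]] IH[of b] IH[of "\<not> b"] sub[of b] sub[of "\<not> b"]
          by simp
        then have "card (edge_dirs (S b)) + card (edge_dirs (S (\<not> b)))
            \<le> card (edge_dirs (S b) \<union> edge_dirs (S (\<not> b)))"
          using tS[of b] tS[of "\<not> b"] eq cS[of b] by simp
        then have "card (edge_dirs (S b) \<inter> edge_dirs (S (\<not> b))) = 0"
          using card_Un_Int[of "edge_dirs (S b)" "edge_dirs (S (\<not> b))"] IH by simp
        then show ?thesis using IH by auto
      qed
      have idir: "i \<in> edge_dirs X"
      proof (rule ccontr)
        assume "i \<notin> edge_dirs X"
        then have "edge_dirs X \<subseteq> edge_dirs (S True) \<union> edge_dirs (S False)"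
          using dirs[of True] by auto
        then have "card (edge_dirs X) \<le> card (edge_dirs (S True)) + card (edge_dirs (S False))"
          using card_mono[of "edge_dirs (S True) \<union> edge_dirs (S False)" "edge_dirs X"]
            card_Un_le[of "edge_dirs (S True)" "edge_dirs (S False)"] IH[of True] IH[of False]
          by simp
        then show False
          using tS[of True] tS[of False] eq cS[of True] by simp
      qed
      obtain e where e: "e b \<in> S b" "flip i (e b) = e (\<not> b)" for b
      proof -
        obtain x where x: "x \<in> X" "flip i x \<in> X"
          using idir by (auto simp: edge_dirs_def)
        show thesis
          by (rule that[of "\<lambda>b. x(i := b)"])
             (use x in \<open>auto simp: S_def fun_upd_flip flip_apply\<close>)
      qed
      have const: "x j = e b j" if "x \<in> S b" "j \<notin> edge_dirs (S b)" for x j b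
        using IH[of b] tS[of b] e(1)[of b] that by blast
      have ee: "e b j = e b' j" if "j \<noteq> i" for b b' j
      proof -
        have "e (\<not> c) j = e c j" for c
          using that by (simp add: e(2)[symmetric] flip_apply)
        from this[of True] show ?thesis by (cases b; cases b') auto
      qed
      have leaf: "\<exists>x\<in>S b. x \<noteq> z \<and> (\<exists>j\<in>edge_dirs (S b). \<forall>y\<in>S b - {x}. y j \<noteq> x j)"
        if "2 \<le> card (S b)" "z \<in> S b" for b z
        using IH[of b] tS[of b] that by simp
      have "x j = y j" if "x \<in> X" "y \<in> X" "j \<notin> edge_dirs X" for x y j
      proof -
        have "x \<in> S (x i)" "y \<in> S (y i)" using that by (auto simp: S_def)
        moreover have "j \<notin> edge_dirs (S b)" for b
          using sub(1)[of b] that(3) by blast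
        ultimately have "x j = e (x i) j" "y j = e (y i) j"
          by (simp_all add: const)
        moreover have "j \<noteq> i" using that idir by blast
        ultimately show ?thesis using ee[of j "x i" "y i"] by simp
      qed
      moreover have "\<exists>x\<in>X. x \<noteq> z \<and> (\<exists>j\<in>edge_dirs X. \<forall>y\<in>X - {x}. y j \<noteq> x j)" if z: "z \<in> X" for z
      proof -
        define b where "b = (\<not> z i)"
        have zb: "z \<in> S (\<not> b)" using z by (auto simp: S_def b_def)
        show ?thesis
        proof (cases "card (S b) \<ge> 2")
          case False
          then have "card (S b) = 1"
            using SX by (metis One_nat_def card_0_eq less_2_cases not_le)
          then have Sb: "S b = {e b}" using e(1)[of b] by (auto simp: card_1_singleton_iff)
          have eb: "e b \<in> X" "e b i = b" using e(1)[of b] by (simp_all add: S_def)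
          have "y i \<noteq> e b i" if "y \<in> X - {e b}" for y
          proof
            assume "y i = e b i"
            then have "y \<in> S b" using that eb by (simp add: S_def)
            then show False using that Sb by simp
          qed
          moreover have "e b \<noteq> z" using eb by (auto simp: b_def)
          ultimately show ?thesis
            using idir eb(1) by (intro bexI[of _ "e b"] conjI bexI[of _ i] ballI)
        next
          case True
          obtain x j where x: "x \<in> S b" "x \<noteq> e b" "j \<in> edge_dirs (S b)"
              "\<forall>y\<in>S b - {x}. y j \<noteq> x j"
            using leaf[OF True e(1)] by metis
          have "y j \<noteq> x j" if y: "y \<in> X - {x}" for y
          proof (cases "y \<in> S b")
            case True
            then show ?thesis using x(4) y by simp
          next
            case False
            then have "y \<in> S (\<not> b)" using y by (auto simp: S_def)
            moreover have "j \<notin> edge_dirs (S (\<not> b))" "j \<noteq> i"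
              using x(3) disj[of b] sub(2)[of b] by (metis IntI empty_iff)+
            ultimately have "y j = e b j" using const[of y "\<not> b" j] ee[of j "\<not> b" b] by simp
            moreover have "e b j \<noteq> x j" using x(4) by (rule bspec) (use x(2) e(1)[of b] in simp)
            ultimately show ?thesis by simp
          qed
          moreover have "x \<in> X" "x \<noteq> z"
            using x(1) zb by (auto simp: S_def)
          moreover have "j \<in> edge_dirs X"
            using x(3) sub(1) by (rule subsetD[rotated])
          ultimately show ?thesis
            by (intro bexI[of _ x] conjI bexI[of _ j] ballI)
        qed
      qed
      ultimately show ?thesis by simp
    qed
    show ?thesis using fin less tight by simp
  qed
qed

section \<open>Linkages through two opposite facets of a cube\<close>

lemma terminalsD:
  assumes "terminals V I s t Ob" "k \<in> I" "l \<in> I"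
  shows "s k = s l \<longleftrightarrow> k = l" "t k = t l \<longleftrightarrow> k = l" "s k \<noteq> t l" "t l \<noteq> s k"
    and "s k \<notin> Ob" "t k \<notin> Ob" "s k \<in> V" "t k \<in> V"
proof -
  have inj: "inj_on s I" "inj_on t I" and disj: "s ` I \<inter> t ` I = {}"
    and Ob: "(s ` I \<union> t ` I) \<inter> Ob = {}" and V: "s ` I \<union> t ` I \<union> Ob \<subseteq> V"
    using assms(1) by (simp_all add: terminals_def)
  show "s k = s l \<longleftrightarrow> k = l" "t k = t l \<longleftrightarrow> k = l"
    using inj assms(2,3) by (simp_all add: inj_on_eq_iff)
  have "s k \<in> s ` I" "t k \<in> t ` I" "t l \<in> t ` I" using assms(2,3) by simp_all
  then show "s k \<noteq> t l" "t l \<noteq> s k" "s k \<notin> Ob" "t k \<notin> Ob" "s k \<in> V" "t k \<in> V"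
    using disj Ob V by (metis IntI UnCI empty_iff subsetD)+
qed

lemma terminals_subset:
  assumes "terminals V I s t Ob" "J \<subseteq> I" "finite Ob'" "Ob' \<subseteq> V'"
    and "\<And>k. k \<in> J \<Longrightarrow> s k \<in> V' - Ob' \<and> t k \<in> V' - Ob'"
  shows "terminals V' J s t Ob'"
proof -
  have "finite I" "inj_on s I" "inj_on t I" "s ` I \<inter> t ` I = {}"
    using assms(1) by (simp_all add: terminals_def)
  then have "finite J" "inj_on s J" "inj_on t J" "s ` J \<inter> t ` J = {}"
    using assms(2) by (auto intro: finite_subset inj_on_subset)
  then show ?thesis
    unfolding terminals_def using assms(3-5) by blast
qed

text \<open>
  The facet with \<open>i\<close>-th coordinate \<open>h k\<close> hosts the pair \<open>k\<close>. An end of the pair that lies in the other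
  facet crosses along direction \<open>i\<close>, and the vertex that it leaves is forbidden to the pairs that stay there.
\<close>

lemma linkable_by_hosting:
  assumes i: "i \<in> B" and T: "terminals (cube B a) I s t Ob"
    and sides: "\<And>b. linkable adj (cube (B - {i}) (a(i := b))) {k \<in> I. h k = b}
        (\<lambda>k. (s k)(i := b)) (\<lambda>k. (t k)(i := b))
        {x \<in> Ob \<union> s ` {k \<in> I. h k \<noteq> b} \<union> t ` {k \<in> I. h k \<noteq> b}. x i = b}"
  shows "linkable adj (cube B a) I s t Ob"
proof -
  let ?O = "\<lambda>b. {x \<in> Ob \<union> s ` {k \<in> I. h k \<noteq> b} \<union> t ` {k \<in> I. h k \<noteq> b}. x i = b}"
  have "\<forall>b. \<exists>C. (\<forall>k\<in>{k \<in> I. h k = b}. joined adj (C k) ((s k)(i := b)) ((t k)(i := b)) \<and>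
        C k \<subseteq> cube (B - {i}) (a(i := b)) - ?O b) \<and> disjoint_family_on C {k \<in> I. h k = b}"
    using sides unfolding linkable_def by (rule allI)
  from choice[OF this] obtain D where D0: "\<forall>b. (\<forall>k\<in>{k \<in> I. h k = b}.
        joined adj (D b k) ((s k)(i := b)) ((t k)(i := b)) \<and>
        D b k \<subseteq> cube (B - {i}) (a(i := b)) - ?O b) \<and> disjoint_family_on (D b) {k \<in> I. h k = b}"
    by (rule exE)
  have D: "\<And>b k. k \<in> I \<Longrightarrow> h k = b \<Longrightarrow>
        joined adj (D b k) ((s k)(i := b)) ((t k)(i := b)) \<and>
        D b k \<subseteq> cube (B - {i}) (a(i := b)) - ?O b"
      "\<And>b. disjoint_family_on (D b) {k \<in> I. h k = b}"
    using D0 by simp_all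
  define C where "C k = D (h k) k \<union> {s k, t k}" for k
  have T': "s k \<in> cube B a" "t k \<in> cube B a" "s k \<notin> Ob" "t k \<notin> Ob" if "k \<in> I" for k
    using T that unfolding terminals_def by auto
  have neq: "s k \<noteq> s l" "t k \<noteq> t l" "s k \<noteq> t l" if "k \<in> I" "l \<in> I" "k \<noteq> l" for k l
    using terminalsD[OF T that(1,2)] that(3) by simp_all
  have Dk: "D (h k) k \<subseteq> cube (B - {i}) (a(i := h k)) - ?O (h k)" if "k \<in> I" for k
    using D(1)[OF that refl] by blast
  have ends: "(s k)(i := h k) \<in> D (h k) k" "(t k)(i := h k) \<in> D (h k) k" if "k \<in> I" for k
    using D(1)[OF that refl] joined_memD by metis+
  have side: "x i = h k" if "k \<in> I" "x \<in> D (h k) k" for x k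
    using Dk[OF that(1)] that(2) i by (auto simp: cube_side)
  have apart: "w \<notin> D (h k) k"
    if kl: "k \<in> I" "l \<in> I" "k \<noteq> l" and w: "w = s l \<or> w = t l" for k l w
  proof
    assume wD: "w \<in> D (h k) k"
    then have wi: "w i = h k" using side kl by blast
    show False
    proof (cases "h l = h k")
      case True
      have "w(i := h l) = w" using wi True by (simp add: fun_upd_idem)
      then have "w \<in> D (h l) l"
        using w ends[OF kl(2)] by metis
      then show False
        using D(2)[of "h k"] wD kl True unfolding disjoint_family_on_def by fastforce
    next
      case False
      then have "w \<in> ?O (h k)" using wi w kl by auto
      then show False using Dk[OF kl(1)] wD by blast
    qed
  qed
  have "joined adj (C k) (s k) (t k)" if "k \<in> I" for k
    unfolding C_def using D(1)[OF that refl] by (blast intro: cube_joined_upd)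
  moreover have "C k \<subseteq> cube B a - Ob" if "k \<in> I" for k
  proof -
    have "D (h k) k \<subseteq> cube B a - Ob"
      using Dk[OF that] i by (auto simp: cube_side)
    then show ?thesis using T'[OF that] by (auto simp: C_def)
  qed
  moreover have "disjoint_family_on C I"
    unfolding disjoint_family_on_def
  proof (intro ballI impI)
    fix k l assume kl: "k \<in> I" "l \<in> I" "k \<noteq> l"
    have "D (h k) k \<inter> D (h l) l = {}"
    proof (cases "h k = h l")
      case True
      then show ?thesis
        using D(2)[of "h k"] kl unfolding disjoint_family_on_def by simp
    next
      case False
      then show ?thesis using side kl by (metis disjoint_iff)
    qed
    moreover have "s l \<notin> D (h k) k" "t l \<notin> D (h k) k" "s k \<notin> D (h l) l" "t k \<notin> D (h l) l"
      using apart kl by metis+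
    ultimately show "C k \<inter> C l = {}"
      using neq[OF kl] neq[OF kl(2,1)] kl(3) unfolding C_def by auto
  qed
  ultimately show ?thesis unfolding linkable_def by blast
qed

text \<open>
  The statement of the induction over the dimension. The type arguments are explicit because the
  types of coordinates and of pair indices do not occur in the remaining argument.
\<close>

definition cube_links :: "'i itself \<Rightarrow> 'k itself \<Rightarrow> nat \<Rightarrow> bool" where
  "cube_links _ _ n \<longleftrightarrow> (\<forall>(B :: 'i set) a (I :: 'k set) s t Ob. finite B \<longrightarrow> card B = n \<longrightarrow>
     terminals (cube B a) I s t Ob \<longrightarrow> 2 * card I + card Ob \<le> n + 1 \<longrightarrow>
     linkable adj (cube B a) I s t Ob)"

lemma cube_linksD:
  assumes "cube_links TYPE('i) TYPE('k) n" "finite B" "card B = n"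
    "terminals (cube B a) I s t Ob" "2 * card I + card Ob \<le> n + 1"
  shows "linkable adj (cube B a) (I :: 'k set) s t (Ob :: ('i \<Rightarrow> bool) set)"
  using assms unfolding cube_links_def by blast

text \<open>
  Since no two special vertices differ exactly in direction \<open>i\<close>, projection to a facet is injective on
  them. The special vertices of the facet are then the images of those that lie in the facet and of
  those that cross into it, and it suffices to count the latter two kinds before the projection.
\<close>

lemma side_linkable:
  fixes s t :: "'k \<Rightarrow> 'i \<Rightarrow> bool"
  assumes IH: "cube_links TYPE('i) TYPE('k) n" and B: "finite B" "card B = Suc n" "i \<in> B"
    and T: "terminals (cube B a) I s t Ob"
    and free: "i \<notin> edge_dirs (s ` I \<union> t ` I \<union> Ob)"
    and card: "card ({x \<in> s ` I \<union> t ` I \<union> Ob. x i = b} \<union> s ` {k \<in> I. h k = b} \<union> t ` {k \<in> I. h k = b})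
      \<le> Suc n"
  shows "linkable adj (cube (B - {i}) (a(i := b))) {k \<in> I. h k = b}
        (\<lambda>k. (s k)(i := b)) (\<lambda>k. (t k)(i := b))
        {x \<in> Ob \<union> s ` {k \<in> I. h k \<noteq> b} \<union> t ` {k \<in> I. h k \<noteq> b}. x i = b}"
proof (rule cube_linksD[OF IH])
  let ?I = "{k \<in> I. h k = b}"
  let ?O = "{x \<in> Ob \<union> s ` {k \<in> I. h k \<noteq> b} \<union> t ` {k \<in> I. h k \<noteq> b}. x i = b}"
  let ?X = "s ` I \<union> t ` I \<union> Ob"
  show "finite (B - {i})" "card (B - {i}) = n" using B by auto
  have fin: "finite I" "finite Ob" using T unfolding terminals_def by auto
  have neq: "s k = s l \<longleftrightarrow> k = l" "t k = t l \<longleftrightarrow> k = l" "s k \<noteq> t l" "s k \<notin> Ob" "t k \<notin> Ob"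
    "s k \<in> cube B a" "t k \<in> cube B a"
    if "k \<in> I" "l \<in> I" for k l
    using terminalsD[OF T that] by simp_all
  have inj: "x = y" if "x \<in> ?X" "y \<in> ?X" "x(i := b) = y(i := b)" for x y
  proof (rule ccontr)
    assume "x \<noteq> y"
    then have "y = flip i x" using that(3) unfolding flip_def fun_eq_iff by (metis fun_upd_apply)
    then show False using free that(1,2) unfolding edge_dirs_def by blast
  qed
  have st: "(s k)(i := b) = (s l)(i := b) \<longleftrightarrow> k = l" "(t k)(i := b) = (t l)(i := b) \<longleftrightarrow> k = l"
    "(s k)(i := b) \<noteq> (t l)(i := b)" if "k \<in> I" "l \<in> I" for k l
    using neq[OF that] inj[of "s k" "s l"] inj[of "t k" "t l"] inj[of "s k" "t l"] that
    by blast+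
  have avoid: "x(i := b) \<notin> ?O" if k: "k \<in> ?I" and x: "x = s k \<or> x = t k" for x k
  proof
    assume O: "x(i := b) \<in> ?O"
    have y: "x(i := b) \<in> ?X" using O by auto
    have "x(i := b) = x" by (rule inj[OF y]) (use x k in auto)
    then have "x \<in> ?O" using O by simp
    then show False using x k neq neq(3)[symmetric] by auto
  qed
  have TI: "terminals UNIV ?I s t ?O"
    unfolding terminals_def using fin neq neq(3)[symmetric] by (auto simp: inj_on_def)
  have OX: "?O \<subseteq> cube B a" using neq(6,7) T unfolding terminals_def by auto
  show "terminals (cube (B - {i}) (a(i := b))) ?I (\<lambda>k. (s k)(i := b)) (\<lambda>k. (t k)(i := b)) ?O"
    unfolding terminals_def
  proof (intro conjI)
    show "finite ?I" "finite ?O" using fin by auto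
    show "inj_on (\<lambda>k. (s k)(i := b)) ?I" "inj_on (\<lambda>k. (t k)(i := b)) ?I"
      using st by (auto intro!: inj_onI simp del: fun_upd_apply)
    show "(\<lambda>k. (s k)(i := b)) ` ?I \<inter> (\<lambda>k. (t k)(i := b)) ` ?I = {}"
      using st(3) by (auto simp del: fun_upd_apply)
    show "((\<lambda>k. (s k)(i := b)) ` ?I \<union> (\<lambda>k. (t k)(i := b)) ` ?I) \<inter> ?O = {}"
      using avoid by (blast dest: avoid)
    have "?O \<subseteq> cube (B - {i}) (a(i := b))" using OX B(3) by (auto simp: cube_side)
    moreover have "(s k)(i := b) \<in> cube (B - {i}) (a(i := b))"
        "(t k)(i := b) \<in> cube (B - {i}) (a(i := b))" if "k \<in> ?I" for k
      using that neq(6,7) B(3) by (auto intro!: upd_in_side)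
    ultimately show "(\<lambda>k. (s k)(i := b)) ` ?I \<union> (\<lambda>k. (t k)(i := b)) ` ?I \<union> ?O
        \<subseteq> cube (B - {i}) (a(i := b))" by blast
  qed
  have "2 * card ?I + card ?O = card (s ` ?I \<union> t ` ?I \<union> ?O)"
    using card_terminals[OF TI] by simp
  also have "\<dots> \<le> card ({x \<in> ?X. x i = b} \<union> s ` ?I \<union> t ` ?I)"
    by (rule card_mono) (use fin in auto)
  finally show "2 * card ?I + card ?O \<le> n + 1" using card by simp
qed

text \<open>
  If \<open>x\<close> is a terminal, its facet is entirely at the disposal of its pair: it leads \<open>x\<close> to the neighbour
  of the mate \<open>t k\<close>. In the opposite facet the mate is one more forbidden vertex, which
  restores the count.
\<close>

lemma linkable_singleton_side:
  fixes s t :: "'k \<Rightarrow> 'i \<Rightarrow> bool"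
  assumes IH: "cube_links TYPE('i) TYPE('k) n" and B: "finite B" "card B = Suc n" "i \<in> B"
    and T: "terminals (cube B a) I s t Ob" and card: "2 * card I + card Ob \<le> n + 2"
    and x: "x \<in> s ` I \<union> Ob" "\<And>y. y \<in> s ` I \<union> t ` I \<union> Ob - {x} \<Longrightarrow> y i = (\<not> x i)"
  shows "linkable adj (cube B a) I s t Ob"
proof -
  let ?F = "cube (B - {i}) (a(i := \<not> x i))" and ?F' = "cube (B - {i}) (a(i := x i))"
  have F: "?F = {v \<in> cube B a. v i = (\<not> x i)}" "?F' = {v \<in> cube B a. v i = x i}"
    using B(3) by (rule cube_side)+
  have F': "finite (B - {i})" "card (B - {i}) = n" using B by auto
  have fin: "finite I" "finite Ob" and sub: "s ` I \<union> t ` I \<union> Ob \<subseteq> cube B a"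
    using T unfolding terminals_def by auto
  show ?thesis
  proof (cases "x \<in> Ob")
    case True
    have T': "terminals ?F I s t (Ob - {x})"
    proof -
      have "y \<noteq> x" if "y \<in> s ` I \<union> t ` I" for y
        using terminalsD(5,6)[OF T] that True by fast
      then have "s ` I \<union> t ` I \<union> (Ob - {x}) \<subseteq> ?F"
        unfolding F using sub x(2) by auto
      then show ?thesis using T unfolding terminals_def by auto
    qed
    have "card Ob \<ge> 1" using True fin by (auto simp: Suc_le_eq card_gt_0_iff)
    then have "2 * card I + card (Ob - {x}) \<le> n + 1"
      using True fin card by simp
    then have "linkable adj ?F I s t (Ob - {x})"
      using cube_linksD[OF IH F' T'] by blast
    moreover have "?F - (Ob - {x}) \<subseteq> cube B a - Ob" unfolding F by auto
    ultimately show ?thesis unfolding linkable_def by (meson subset_trans)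
  next
    case False
    then obtain k where k: "k \<in> I" "x = s k" using x(1) by auto
    have ne: "y \<noteq> x" if y: "y \<in> s ` (I - {k}) \<union> t ` I \<union> Ob" for y
    proof -
      consider l where "l \<in> I" "l \<noteq> k" "y = s l" | l where "l \<in> I" "y = t l" | "y \<in> Ob"
        using y by blast
      then show ?thesis
      proof cases
        case (1 l)
        then show ?thesis using terminalsD(1)[OF T k(1) 1(1)] k(2) by simp
      next
        case (2 l)
        then show ?thesis using terminalsD(3)[OF T k(1) 2(1)] k(2) by simp
      next
        case 3
        then show ?thesis using terminalsD(5)[OF T k(1) k(1)] k(2) by auto
      qed
    qed
    have T': "terminals ?F (I - {k}) s t (insert (t k) Ob)"
    proof -
      have "s ` (I - {k}) \<union> t ` I \<union> Ob \<subseteq> ?F"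
        unfolding F using sub x(2) ne by auto
      then have "s ` (I - {k}) \<union> t ` (I - {k}) \<union> insert (t k) Ob \<subseteq> ?F" using k by auto
      moreover have "s l \<notin> insert (t k) Ob \<and> t l \<notin> insert (t k) Ob" if "l \<in> I - {k}" for l
        using that terminalsD[OF T _ k(1), of l] by simp
      ultimately show ?thesis
        using fin by (intro terminals_subset[OF T]) auto
    qed
    have "card (I - {k}) = card I - 1" "card I \<ge> 1"
      using k fin by (auto simp: Suc_le_eq card_gt_0_iff)
    moreover have "card (insert (t k) Ob) \<le> Suc (card Ob)" using fin by (simp add: card_insert_if)
    ultimately have "2 * card (I - {k}) + card (insert (t k) Ob) \<le> n + 1"
      using card by linarith
    then have "linkable adj ?F (I - {k}) s t (insert (t k) Ob)"
      using cube_linksD[OF IH F' T'] by blast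
    then obtain C where C: "\<And>l. l \<in> I - {k} \<Longrightarrow> joined adj (C l) (s l) (t l)"
        "\<And>l. l \<in> I - {k} \<Longrightarrow> C l \<subseteq> ?F - insert (t k) Ob" "disjoint_family_on C (I - {k})"
      unfolding linkable_def by metis
    define C' where "C' = C(k := ?F' \<union> {t k})"
    have tk: "t k i = (\<not> x i)" "t k \<in> cube B a"
      using x(2)[of "t k"] ne[of "t k"] k sub by auto
    have "joined adj (?F' \<union> {t k}) (s k) (t k)"
    proof -
      have 1: "s k \<in> ?F'" "flip i (t k) \<in> ?F'"
        unfolding F using k sub tk B(3) by (auto simp: flip_in_cube flip_apply)
      then have "joined adj ?F' (s k) (flip i (t k))"
        using F'(1) by (rule cube_joined[rotated])
      then have "joined adj (?F' \<union> {t k}) (s k) (flip i (t k))"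
        by (rule joined_mono) blast
      then show ?thesis by (rule joined_step) simp_all
    qed
    moreover have "?F' \<union> {t k} \<subseteq> cube B a - Ob"
    proof -
      have "y \<notin> Ob" if "y i = x i" for y
        using x(2)[of y] False that by auto
      moreover have "t k \<notin> Ob" using T k unfolding terminals_def by auto
      ultimately show ?thesis unfolding F using tk by auto
    qed
    moreover have "C l \<inter> (?F' \<union> {t k}) = {}" if "l \<in> I - {k}" for l
      using C(2)[OF that] unfolding F by auto
    moreover have "C l \<subseteq> cube B a - Ob" if "l \<in> I - {k}" for l
      using C(2)[OF that] unfolding F by auto
    ultimately show ?thesis
      unfolding linkable_def
      by (intro exI[of _ C']) (use C(1,3) in \<open>auto simp: C'_def disjoint_family_on_def\<close>)
  qed
qed

text \<open>
  All special vertices lie in one facet \<open>G\<close>. If there are at most \<open>n + 1\<close> terminals, all pairs can cross to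
  the opposite facet, which has no special vertices. Otherwise no vertex of \<open>Ob\<close> is left, and one pair
  has to stay in \<open>G\<close>, where all other terminals are forbidden to it. Such a pair is found by linking in \<open>G\<close>
  all pairs except \<open>p\<close>, with \<open>s p\<close> forbidden: at most one of the resulting paths contains \<open>t p\<close>, and by
  \<open>n \<ge> 4\<close> there are at least two.
\<close>

lemma linkable_facet:
  fixes s t :: "'k \<Rightarrow> 'i \<Rightarrow> bool"
  assumes IH: "cube_links TYPE('i) TYPE('k) n" and "4 \<le> n"
    and B: "finite B" "card B = Suc n" "i \<in> B"
    and T: "terminals (cube B a) I s t Ob" and card: "2 * card I + card Ob \<le> n + 2"
    and const: "\<And>y. y \<in> s ` I \<union> t ` I \<union> Ob \<Longrightarrow> y i = b"
  shows "linkable adj (cube B a) I s t Ob"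
proof -
  have fin: "finite I" "finite Ob" and sub: "s ` I \<union> t ` I \<union> Ob \<subseteq> cube B a"
    using T unfolding terminals_def by auto
  have free: "i \<notin> edge_dirs (s ` I \<union> t ` I \<union> Ob)"
  proof
    assume "i \<in> edge_dirs (s ` I \<union> t ` I \<union> Ob)"
    then obtain x where "x \<in> s ` I \<union> t ` I \<union> Ob" "flip i x \<in> s ` I \<union> t ` I \<union> Ob"
      unfolding edge_dirs_def by blast
    then show False using const[of x] const[of "flip i x"] by (simp add: flip_apply)
  qed
  have stb: "s k i = b" "t k i = b" if "k \<in> I" for k
    using const that by auto
  have F: "cube (B - {i}) (a(i := c)) = {v \<in> cube B a. v i = c}" for c
    using B(3) by (rule cube_side)
  have far: "linkable adj (cube (B - {i}) (a(i := \<not> b))) {k \<in> I. h k = (\<not> b)}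
        (\<lambda>k. (s k)(i := \<not> b)) (\<lambda>k. (t k)(i := \<not> b))
        {x \<in> Ob \<union> s ` {k \<in> I. h k \<noteq> (\<not> b)} \<union> t ` {k \<in> I. h k \<noteq> (\<not> b)}. x i = (\<not> b)}"
    if h: "2 * card {k \<in> I. h k = (\<not> b)} \<le> Suc n" for h
  proof (rule side_linkable[OF IH B T free])
    let ?J = "{k \<in> I. h k = (\<not> b)}"
    have "{x \<in> s ` I \<union> t ` I \<union> Ob. x i = (\<not> b)} = {}"
      using const by blast
    then have "card ({x \<in> s ` I \<union> t ` I \<union> Ob. x i = (\<not> b)} \<union> s ` ?J \<union> t ` ?J) \<le> card (s ` ?J) + card (t ` ?J)"
      using card_Un_le by (metis Un_empty_left)
    also have "\<dots> \<le> card ?J + card ?J" using fin by (intro add_mono card_image_le) auto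
    finally show "card ({x \<in> s ` I \<union> t ` I \<union> Ob. x i = (\<not> b)} \<union> s ` ?J \<union> t ` ?J) \<le> Suc n"
      using h by simp
  qed
  show ?thesis
  proof (cases "2 * card I \<le> Suc n")
    case True
    show ?thesis
    proof (rule linkable_by_hosting[OF B(3) T, where h = "\<lambda>_. \<not> b"])
      fix c
      show "linkable adj (cube (B - {i}) (a(i := c))) {k \<in> I. (\<not> b) = c} (\<lambda>k. (s k)(i := c))
          (\<lambda>k. (t k)(i := c)) {x \<in> Ob \<union> s ` {k \<in> I. (\<not> b) \<noteq> c} \<union> t ` {k \<in> I. (\<not> b) \<noteq> c}. x i = c}"
      proof (cases "c = b")
        case True
        then have "{k \<in> I. (\<not> b) = c} = {}" by auto
        then show ?thesis by (simp only: linkable_empty)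
      next
        case False
        then have "c = (\<not> b)" by simp
        then show ?thesis using far[of "\<lambda>_. \<not> b"] True by simp
      qed
    qed
  next
    case False
    then have "card Ob = 0" and cI: "2 * card I = n + 2" using card by auto
    then have O: "Ob = {}" using fin by simp
    from cI have "card I \<ge> 3" using \<open>4 \<le> n\<close> by simp
    then obtain p where p: "p \<in> I" by fastforce
    let ?G = "cube (B - {i}) (a(i := b))"
    have G: "finite (B - {i})" "card (B - {i}) = n" using B by auto
    have cardp: "card (I - {l}) = card I - 1" if "l \<in> I" for l using that fin by simp
    have T1: "terminals ?G (I - {p}) s t {s p}"
    proof (rule terminals_subset[OF T])
      show "{s p} \<subseteq> ?G" using terminalsD[OF T p p] stb[OF p] by (simp add: F)
      fix k assume "k \<in> I - {p}"
      then have k: "k \<in> I" "k \<noteq> p" by auto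
      then show "s k \<in> ?G - {s p} \<and> t k \<in> ?G - {s p}"
        using terminalsD[OF T k(1) p] terminalsD(3)[OF T p k(1)] stb[OF k(1)] by (simp add: F)
    qed auto
    have "2 * card (I - {p}) + card {s p} \<le> n + 1"
      using cI cardp[OF p] by simp
    then have "linkable adj ?G (I - {p}) s t {s p}"
      using cube_linksD[OF IH G T1] by blast
    then obtain C where C: "\<And>l. l \<in> I - {p} \<Longrightarrow> joined adj (C l) (s l) (t l)"
        "\<And>l. l \<in> I - {p} \<Longrightarrow> C l \<subseteq> ?G - {s p}" "disjoint_family_on C (I - {p})"
      unfolding linkable_def by metis
    have Cmem: "s l \<in> C l" "t l \<in> C l" if "l \<in> I - {p}" for l
      using joined_memD[OF C(1)[OF that]] by auto
    obtain q where q: "q \<in> I - {p}" "t p \<notin> C q"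
    proof -
      have "card (I - {p}) \<ge> 2" using \<open>card I \<ge> 3\<close> cardp[OF p] by simp
      then obtain q q' where "q \<in> I - {p}" "q' \<in> I - {p}" "q \<noteq> q'"
        by (metis card_le_Suc0_iff_eq fin(1) finite_Diff not_less_eq_eq numeral_2_eq_2)
      then show thesis
        using that C(3) unfolding disjoint_family_on_def by (metis disjoint_iff)
    qed
    have upd: "(s q)(i := b) = s q" "(t q)(i := b) = t q"
      using stb[of q] q by (auto simp: fun_eq_iff)
    have avoid: "C q \<inter> (s ` (I - {q}) \<union> t ` (I - {q})) = {}"
    proof -
      have "s l \<notin> C q" "t l \<notin> C q" if "l \<in> I" "l \<noteq> q" for l
      proof -
        have "s l \<notin> C q \<and> t l \<notin> C q"
        proof (cases "l = p")
          case True
          then show ?thesis using q C(2)[of q] by auto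
        next
          case False
          then show ?thesis
            using C(3) Cmem[of l] that q unfolding disjoint_family_on_def by blast
        qed
        then show "s l \<notin> C q" "t l \<notin> C q" by auto
      qed
      then show ?thesis by auto
    qed
    show ?thesis
    proof (rule linkable_by_hosting[OF B(3) T, where h = "\<lambda>l. if l = q then b else \<not> b"])
      fix c
      let ?h = "\<lambda>l. if l = q then b else \<not> b"
      show "linkable adj (cube (B - {i}) (a(i := c))) {k \<in> I. ?h k = c} (\<lambda>k. (s k)(i := c))
          (\<lambda>k. (t k)(i := c)) {x \<in> Ob \<union> s ` {k \<in> I. ?h k \<noteq> c} \<union> t ` {k \<in> I. ?h k \<noteq> c}. x i = c}"
      proof (cases "c = b")
        case True
        then have "{k \<in> I. ?h k = c} = {q}" "{k \<in> I. ?h k \<noteq> c} = I - {q}"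
          using q by auto
        moreover have "joined adj (?G - {x \<in> Ob \<union> s ` (I - {q}) \<union> t ` (I - {q}). x i = c})
            ((s q)(i := b)) ((t q)(i := b))"
          unfolding upd
          by (rule joined_mono[OF C(1)]) (use q(1) C(2)[OF q(1)] avoid O in auto)
        ultimately show ?thesis
          using True by (simp only:) (rule linkable_single)
      next
        case False
        then have c: "c = (\<not> b)" by simp
        have "{k \<in> I. ?h k = (\<not> b)} = I - {q}" by auto
        then have "2 * card {k \<in> I. ?h k = (\<not> b)} \<le> Suc n"
          using cI cardp[of q] q by simp
        from far[OF this] show ?thesis unfolding c .
      qed
    qed
  qed
qed

text \<open>
  A direction in which the special vertices are constant, or in which one of them is alone, is treated by
  the two preceding lemmas. Otherwise \<open>edge_dirs_tree\<close> provides a direction without edges between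
  special vertices, and both facets contain at least two of them. It remains to choose the hosts such that
  each facet has a special vertex that does not cross.
\<close>

lemma cube_links_Suc:
  assumes IH: "cube_links TYPE('i) TYPE('k) n" and n: "4 \<le> n"
  shows "cube_links TYPE('i) TYPE('k) (Suc n)"
  unfolding cube_links_def
proof (intro allI impI)
  fix B a and I :: "'k set" and s t and Ob :: "('i \<Rightarrow> bool) set"
  assume B: "finite B" "card B = Suc n" and T: "terminals (cube B a) I s t Ob"
    and card: "2 * card I + card Ob \<le> Suc n + 1"
  have card': "2 * card I + card Ob \<le> n + 2" using card by simp
  define X where "X = s ` I \<union> t ` I \<union> Ob"
  have fin: "finite I" "finite Ob" using T unfolding terminals_def by auto
  have cX: "card X \<le> n + 2" "finite X"
    unfolding X_def using card_terminals[OF T] card fin by auto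
  have singleton: "linkable adj (cube B a) I s t Ob"
    if i: "i \<in> B" and x: "x \<in> X" "\<And>y. y \<in> X - {x} \<Longrightarrow> y i \<noteq> x i" for i x
  proof (cases "x \<in> s ` I \<union> Ob")
    case True
    show ?thesis
      by (rule linkable_singleton_side[OF IH B i T card' True]) (use x(2) in \<open>auto simp: X_def\<close>)
  next
    case False
    then have "x \<in> t ` I \<union> Ob" using x unfolding X_def by auto
    then have "linkable adj (cube B a) I t s Ob"
      by (rule linkable_singleton_side[OF IH B i terminals_swap[OF T] card'])
         (use x(2) in \<open>auto simp: X_def\<close>)
    then show ?thesis using symp_adj by (rule linkable_swap)
  qed
  show "linkable adj (cube B a) I s t Ob"
  proof (cases "\<exists>i\<in>B. \<exists>b. \<forall>x\<in>X. x i = b")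
    case True
    then obtain i b where ib: "i \<in> B" "\<forall>x\<in>X. x i = b" by metis
    show ?thesis
      by (rule linkable_facet[OF IH n B ib(1) T card', of b])
         (rule bspec[OF ib(2)], simp add: X_def)
  next
    case False
    have split: "\<exists>x\<in>X. x i = b" if "i \<in> B" for i b
    proof (rule ccontr)
      assume "\<not> (\<exists>x\<in>X. x i = b)"
      then have "\<forall>x\<in>X. x i = (\<not> b)" by simp
      then show False using False that by metis
    qed
    show ?thesis
    proof (cases "\<exists>i\<in>B. \<exists>x\<in>X. \<forall>y\<in>X - {x}. y i \<noteq> x i")
      case True
      then obtain i x where "i \<in> B" "x \<in> X" and *: "\<forall>y\<in>X - {x}. y i \<noteq> x i" by metis
      from this(1,2) show ?thesis by (rule singleton) (rule bspec[OF *])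
    next
      case False
      note lone = False
      have "B \<noteq> {}" using B by auto
      then have "X \<noteq> {}" using split by auto
      have "\<exists>i\<in>B. i \<notin> edge_dirs X"
      proof (rule ccontr)
        assume "\<not> ?thesis"
        then have BX: "B \<subseteq> edge_dirs X" by blast
        note tree = edge_dirs_tree[OF cX(2) \<open>X \<noteq> {}\<close>]
        have "Suc n \<le> card (edge_dirs X)" using card_mono[OF _ BX] tree B by simp
        then have tight: "Suc (card (edge_dirs X)) = card X" and "card (edge_dirs X) = card B"
          using tree cX B by auto
        then have "edge_dirs X = B" using BX tree card_subset_eq by metis
        moreover have "2 \<le> card X" using tight \<open>Suc n \<le> card (edge_dirs X)\<close> by simp
        moreover obtain z where "z \<in> X" using \<open>X \<noteq> {}\<close> by blast
        ultimately show False using tree tight lone by metis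
      qed
      then obtain i where i: "i \<in> B" "i \<notin> edge_dirs X" by blast
      obtain x where x: "x \<in> X" "\<not> x i" using split[OF i(1), of False] by auto
      \<comment> \<open>\<open>x\<close> stays, and on the other side some \<open>y\<close> other than the mate of \<open>x\<close> stays: the facet of \<open>x\<close> hosts
         only the pair of \<open>x\<close>\<close>
      define h where "h k \<longleftrightarrow> x \<noteq> s k \<and> x \<noteq> t k" for k
      have mate: "\<exists>m. \<forall>k\<in>I. \<not> h k \<longrightarrow> {s k, t k} \<subseteq> {x, m}"
      proof (cases "\<exists>k\<in>I. \<not> h k")
        case True
        then obtain k where k: "k \<in> I" "x = s k \<or> x = t k" unfolding h_def by blast
        have only: "l = k" if "l \<in> I" "x = s l \<or> x = t l" for l
          using terminalsD[OF T that(1) k(1)] terminalsD(3)[OF T k(1) that(1)] k(2) that(2) by auto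
        have "{s l, t l} \<subseteq> {x, if x = s k then t k else s k}" if "l \<in> I" "\<not> h l" for l
        proof -
          have "l = k" using only[OF that(1)] that(2) by (simp add: h_def)
          then show ?thesis using k(2) by (cases "x = s k") simp_all
        qed
        then show ?thesis by (intro exI ballI impI)
      next
        case False
        then show ?thesis by simp
      qed
      then obtain m where m: "\<And>k. k \<in> I \<Longrightarrow> \<not> h k \<Longrightarrow> {s k, t k} \<subseteq> {x, m}" by metis
      obtain y where y: "y \<in> X" "y i" "y \<noteq> m"
      proof -
        obtain y where y: "y \<in> X" "y i" using split[OF i(1), of True] by auto
        obtain y' where "y' \<in> X - {y}" "y' i"
          using lone i(1) y by metis
        then show thesis using that[of y] that[of y'] y by auto
      qed
      show ?thesis
      proof (rule linkable_by_hosting[OF i(1) T, where h = h],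
             rule side_linkable[OF IH B i(1) T i(2)[unfolded X_def]])
        fix b
        let ?Y = "{x \<in> s ` I \<union> t ` I \<union> Ob. x i = b} \<union> s ` {k \<in> I. h k = b} \<union> t ` {k \<in> I. h k = b}"
        have "?Y \<subset> X"
        proof -
          have "?Y \<subseteq> X" by (auto simp: X_def)
          moreover have "x \<notin> ?Y" if b using that x by (auto simp: h_def)
          moreover have "y \<notin> ?Y" if nb: "\<not> b"
          proof
            assume "y \<in> ?Y"
            then obtain k where k: "k \<in> I" "\<not> h k" "y \<in> {s k, t k}" using nb y(2) by auto
            from m[OF k(1,2)] k(3) have "y \<in> {x, m}" by (rule subsetD)
            then show False using x(2) y(2,3) by auto
          qed
          ultimately show ?thesis using x(1) y(1) by (cases b) auto
        qed
        then have "card ?Y < card X" using cX(2) by (rule psubset_card_mono[rotated])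
        then show "card ?Y \<le> Suc n" using cX(1) by simp
      qed
    qed
  qed
qed

section \<open>Linkages in cubes of dimension at least four\<close>

lemma card_cube:
  assumes "finite B"
  shows "card (cube B a) = 2 ^ card B"
proof -
  have "bij_betw (\<lambda>v. {i. v i \<noteq> a i}) (cube B a) (Pow B)"
    by (rule bij_betwI[where g = "\<lambda>S i. if i \<in> S then \<not> a i else a i"])
       (auto simp: cube_def fun_eq_iff)
  then show ?thesis
    using assms by (simp add: bij_betw_same_card card_Pow)
qed

lemma flip_cancel [simp]: "flip i u = flip i v \<longleftrightarrow> u = v"
  by (metis flip_flip)

text \<open>
  The case of two pairs with named ends, so that the symmetries of the case analysis below are
  rearrangements of variables.
\<close>

definition two_paths where
  "two_paths V u v x y Ob \<longleftrightarrow> (\<exists>C D. joined adj C u v \<and> joined adj D x y \<and>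
     C \<inter> D = {} \<and> C \<subseteq> V - Ob \<and> D \<subseteq> V - Ob)"

lemma two_paths_swap:
  assumes "two_paths V u v x y Ob"
  shows "two_paths V v u x y Ob" "two_paths V x y u v Ob"
proof -
  obtain C D where CD: "joined adj C u v" "joined adj D x y" "C \<inter> D = {}" "C \<subseteq> V - Ob" "D \<subseteq> V - Ob"
    using assms unfolding two_paths_def by metis
  show "two_paths V v u x y Ob"
    unfolding two_paths_def using CD joined_sym[OF CD(1) symp_adj] by metis
  show "two_paths V x y u v Ob"
    unfolding two_paths_def using CD by (metis inf_commute)
qed

text \<open>
  The instance of hosting in which the facet on side \<open>b\<close> of direction \<open>i\<close> hosts \<open>u, v\<close> and the opposite
  facet hosts \<open>x, y\<close>. Both facets are \<open>3\<close>-cubes, which remain connected without two vertices.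
\<close>

lemma two_paths_by_sides:
  assumes B: "finite B" "card B = 4" "i \<in> B" and Ob: "finite Ob"
    and V: "{u, v, x, y} \<subseteq> cube B a - Ob" "u \<noteq> x" "u \<noteq> y" "v \<noteq> x" "v \<noteq> y"
    and b: "card {z \<in> Ob \<union> {x, y}. z i = b} \<le> 2"
      "u(i := b) \<notin> Ob \<union> {x, y}" "v(i := b) \<notin> Ob \<union> {x, y}"
    and b': "card {z \<in> Ob \<union> {u, v}. z i = (\<not> b)} \<le> 2"
      "x(i := \<not> b) \<notin> Ob \<union> {u, v}" "y(i := \<not> b) \<notin> Ob \<union> {u, v}"
  shows "two_paths (cube B a) u v x y Ob"
proof -
  have half: "joined adj ((cube (B - {i}) (a(i := c)) - {z \<in> Ob \<union> {x', y'}. z i = c}) \<union> {u', v'}) u' v'"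
    if "u' \<in> cube B a" "v' \<in> cube B a" "card {z \<in> Ob \<union> {x', y'}. z i = c} \<le> 2"
      "u'(i := c) \<notin> Ob \<union> {x', y'}" "v'(i := c) \<notin> Ob \<union> {x', y'}" for c u' v' x' y'
  proof (rule cube_joined_upd, rule cube_minus_few_joined)
    show "u'(i := c) \<in> cube (B - {i}) (a(i := c)) - {z \<in> Ob \<union> {x', y'}. z i = c}"
      using upd_in_side[OF that(1) B(3), of c] that(4) by blast
    show "v'(i := c) \<in> cube (B - {i}) (a(i := c)) - {z \<in> Ob \<union> {x', y'}. z i = c}"
      using upd_in_side[OF that(2) B(3), of c] that(5) by blast
  qed (use that B Ob in simp_all)
  let ?C = "(cube (B - {i}) (a(i := b)) - {z \<in> Ob \<union> {x, y}. z i = b}) \<union> {u, v}"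
  let ?D = "(cube (B - {i}) (a(i := \<not> b)) - {z \<in> Ob \<union> {u, v}. z i = (\<not> b)}) \<union> {x, y}"
  have "joined adj ?C u v" "joined adj ?D x y"
    by (rule half; (fact b b' | use V in blast))+
  moreover have "?C \<inter> ?D = {}"
    unfolding cube_side[OF B(3)] using V by auto
  moreover have "?C \<subseteq> cube B a - Ob" "?D \<subseteq> cube B a - Ob"
    unfolding cube_side[OF B(3)] using V by auto
  ultimately show ?thesis unfolding two_paths_def by (intro exI conjI)
qed

lemma card_subset_pair: "S \<subseteq> {x, y} \<Longrightarrow> card S \<le> 2"
  by (rule order_trans[OF card_mono]) (auto simp: card_insert_if)

lemma fun_upd_bool: "v i = (\<not> b) \<Longrightarrow> v(i := b) = flip i v" "v i = b \<Longrightarrow> v(i := b) = v"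
  by (auto simp: fun_upd_flip)

locale four_cube =
  fixes B :: "'i set" and a :: "'i \<Rightarrow> bool"
  assumes B: "finite B" "card B = 4"
begin

lemma pairs_apart:
  assumes "i \<in> B" and V: "{u, v, x, y} \<subseteq> cube B a - {w}"
    and "u i = b" "v i = b" "x i = (\<not> b)" "y i = (\<not> b)"
  shows "two_paths (cube B a) u v x y {w}"
proof (rule two_paths_by_sides[OF B assms(1), where b = b])
  have upd: "u(i := b) = u" "v(i := b) = v" "x(i := \<not> b) = x" "y(i := \<not> b) = y"
    using assms by (simp_all add: fun_upd_bool)
  show "u(i := b) \<notin> {w} \<union> {x, y}" "v(i := b) \<notin> {w} \<union> {x, y}"
    "x(i := \<not> b) \<notin> {w} \<union> {u, v}" "y(i := \<not> b) \<notin> {w} \<union> {u, v}"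
    unfolding upd using assms by auto
  show "card {z \<in> {w} \<union> {x, y}. z i = b} \<le> 2"
    by (rule card_subset_pair[of _ w w], use assms in auto)
  show "card {z \<in> {w} \<union> {u, v}. z i = (\<not> b)} \<le> 2"
    by (rule card_subset_pair[of _ w w], use assms in auto)
qed (use assms in auto)

text \<open>
  \<open>x\<close> crosses to the facet of \<open>y\<close>. If \<open>w\<close> occupies the target, \<open>x\<close> first steps aside to a neighbour in its own facet.
\<close>

lemma one_end_apart:
  assumes i: "i \<in> B" and V: "{u, v, x, y} \<subseteq> cube B a - {w}" "w \<in> cube B a" "x \<noteq> u" "x \<noteq> v"
    and b: "u i = b" "v i = b" "x i = b" "y i = (\<not> b)"
  shows "two_paths (cube B a) u v x y {w}"
proof (cases "flip i x = w")
  case False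
  show ?thesis
  proof (rule two_paths_by_sides[OF B assms(1), where b = b])
    have upd: "u(i := b) = u" "v(i := b) = v" "x(i := \<not> b) = flip i x" "y(i := \<not> b) = y"
      using assms by (simp_all add: fun_upd_bool)
    have "flip i x i = (\<not> b)" using b by (simp add: flip_apply)
    then show "u(i := b) \<notin> {w} \<union> {x, y}" "v(i := b) \<notin> {w} \<union> {x, y}"
      "x(i := \<not> b) \<notin> {w} \<union> {u, v}" "y(i := \<not> b) \<notin> {w} \<union> {u, v}"
      unfolding upd using assms False by auto
    show "card {z \<in> {w} \<union> {x, y}. z i = b} \<le> 2"
      by (rule card_subset_pair[of _ w x], use assms in auto)
    show "card {z \<in> {w} \<union> {u, v}. z i = (\<not> b)} \<le> 2"
      by (rule card_subset_pair[of _ w x], use assms in auto)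
  qed (use assms in auto)
next
  case True
  have "\<exists>j\<in>B - {i}. flip j x \<notin> {u, v}"
  proof (rule ccontr)
    assume "\<not> ?thesis"
    then have "(\<lambda>j. flip j x) ` (B - {i}) \<subseteq> {u, v}" by auto
    then have "card ((\<lambda>j. flip j x) ` (B - {i})) \<le> 2" by (rule card_subset_pair)
    then have "card (B - {i}) \<le> 2"
      by (subst (asm) card_image) (auto simp: inj_on_def flip_inj)
    then show False using B i by simp
  qed
  then obtain j where j: "j \<in> B" "j \<noteq> i" "flip j x \<notin> {u, v}" by blast
  define x' where "x' = flip j x"
  have x': "x' \<in> cube B a" "x' \<noteq> x" "x' \<noteq> u" "x' \<noteq> v" "x' i = b" "flip i x' i = (\<not> b)"
    "w i = (\<not> b)" "flip j x' = x" "flip i x' \<noteq> w"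
    using j b V True[symmetric] by (simp_all add: x'_def flip_in_cube flip_apply)
  then have "flip i x' \<noteq> x" using b(3) by auto
  have upd: "u(i := b) = u" "v(i := b) = v" "x'(i := \<not> b) = flip i x'" "y(i := \<not> b) = y"
    using assms x' by (simp_all add: fun_upd_bool)
  have ne: "x' \<noteq> y" "x' \<noteq> w" "y \<noteq> x" "w \<noteq> x" using x' b by auto
  have "two_paths (cube B a) u v x' y {w, x}"
  proof (rule two_paths_by_sides[OF B assms(1), where b = b])
    show "u(i := b) \<notin> {w, x} \<union> {x', y}" "v(i := b) \<notin> {w, x} \<union> {x', y}"
      "x'(i := \<not> b) \<notin> {w, x} \<union> {u, v}" "y(i := \<not> b) \<notin> {w, x} \<union> {u, v}"
      unfolding upd using assms x' \<open>flip i x' \<noteq> x\<close> by auto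
    show "card {z \<in> {w, x} \<union> {x', y}. z i = b} \<le> 2"
      by (rule card_subset_pair[of _ x x'], use assms x' in auto)
    show "card {z \<in> {w, x} \<union> {u, v}. z i = (\<not> b)} \<le> 2"
      by (rule card_subset_pair[of _ w w], use assms x' in auto)
  qed (use assms x' ne in auto)
  then obtain C D where CD: "joined adj C u v" "joined adj D x' y"
      "C \<inter> D = {}" "C \<subseteq> cube B a - {w, x}" "D \<subseteq> cube B a - {w, x}"
    unfolding two_paths_def by metis
  have D: "joined adj (insert x D) x' y" using CD(2) by (rule joined_mono) blast
  have "adj x x'" by (simp add: x'_def)
  then have "joined adj (insert x D) x x'"
    using joined_memD[OF D] by (intro joined_edge) auto
  then have "joined adj (insert x D) x y" using D joined_trans by metis
  moreover have "C \<inter> insert x D = {}" "C \<subseteq> cube B a - {w}" "insert x D \<subseteq> cube B a - {w}"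
    using CD V by auto
  ultimately show ?thesis
    unfolding two_paths_def using CD(1) by metis
qed

text \<open>
  One of the pairs crosses as a whole. The obstacle \<open>w\<close> is the neighbour of at most one terminal in
  direction \<open>i\<close>, so it is in the way of at most one of the pairs.
\<close>

lemma obstacle_apart:
  assumes i: "i \<in> B" and V: "{u, v, x, y} \<subseteq> cube B a - {w}"
      "u \<noteq> x" "u \<noteq> y" "v \<noteq> x" "v \<noteq> y"
    and b: "u i = b" "v i = b" "x i = b" "y i = b" "w i = (\<not> b)"
  shows "two_paths (cube B a) u v x y {w}"
proof -
  have main: "two_paths (cube B a) u v x y {w}"
    if V: "{u, v, x, y} \<subseteq> cube B a - {w}" "u \<noteq> x" "u \<noteq> y" "v \<noteq> x" "v \<noteq> y"
      and b: "u i = b" "v i = b" "x i = b" "y i = b" "w i = (\<not> b)"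
      and fl: "flip i x \<noteq> w" "flip i y \<noteq> w" for u v x y
  proof (rule two_paths_by_sides[OF B i, where b = b])
    have upd: "u(i := b) = u" "v(i := b) = v" "x(i := \<not> b) = flip i x" "y(i := \<not> b) = flip i y"
      using b by (simp_all add: fun_upd_bool)
    have "flip i x i = (\<not> b)" "flip i y i = (\<not> b)" using b by (simp_all add: flip_apply)
    then show "u(i := b) \<notin> {w} \<union> {x, y}" "v(i := b) \<notin> {w} \<union> {x, y}"
      "x(i := \<not> b) \<notin> {w} \<union> {u, v}" "y(i := \<not> b) \<notin> {w} \<union> {u, v}"
      unfolding upd using V b fl by auto
    show "card {z \<in> {w} \<union> {x, y}. z i = b} \<le> 2"
      by (rule card_subset_pair[of _ x y], use b in auto)
    show "card {z \<in> {w} \<union> {u, v}. z i = (\<not> b)} \<le> 2"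
      by (rule card_subset_pair[of _ w w], use b in auto)
  qed (use V in auto)
  show ?thesis
  proof (cases "flip i x \<noteq> w \<and> flip i y \<noteq> w")
    case True
    then show ?thesis using main[OF V b] by blast
  next
    case False
    then have "flip i u \<noteq> w" "flip i v \<noteq> w" using V(2-5) by (auto simp: flip_eq_swap)
    moreover have "{x, y, u, v} \<subseteq> cube B a - {w}" using V by auto
    ultimately have "two_paths (cube B a) x y u v {w}"
      using main[of x y u v] V b by metis
    then show ?thesis by (rule two_paths_swap)
  qed
qed

text \<open>
  If \<open>u, x\<close> are on one side and \<open>v, y, w\<close> on the other, then \<open>v\<close> crosses to \<open>u\<close> and \<open>x\<close> crosses to \<open>y\<close>, or the
  roles of the pairs are exchanged. By \<open>free\<close> only \<open>w\<close> can be in the way, and being the neighbour of at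
  most one terminal in direction \<open>i\<close> it rules out at most one of these choices.
\<close>

lemma pairs_both_split:
  assumes i: "i \<in> B" and V: "{u, v, x, y} \<subseteq> cube B a - {w}"
      "u \<noteq> x" "u \<noteq> y" "v \<noteq> x" "v \<noteq> y"
    and split: "u i \<noteq> v i" "x i \<noteq> y i"
    and free: "flip i x \<notin> {u, v}" "flip i y \<notin> {u, v}"
  shows "two_paths (cube B a) u v x y {w}"
proof -
  have main: "two_paths (cube B a) u v x y {w}"
    if V: "{u, v, x, y} \<subseteq> cube B a - {w}" "u \<noteq> x" "u \<noteq> y" "v \<noteq> x" "v \<noteq> y"
      and b: "u i = b" "x i = b" "v i = (\<not> b)" "y i = (\<not> b)" "w i = (\<not> b)"
      and free: "flip i x \<noteq> v" and fl: "flip i x \<noteq> w" for u v x y b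
  proof (rule two_paths_by_sides[OF B i, where b = b])
    have upd: "u(i := b) = u" "v(i := b) = flip i v" "x(i := \<not> b) = flip i x" "y(i := \<not> b) = y"
      using b by (simp_all add: fun_upd_bool)
    have "flip i x i = (\<not> b)" "flip i v i = b" using b by (simp_all add: flip_apply)
    moreover have "flip i v \<noteq> x" using free by auto
    ultimately show "u(i := b) \<notin> {w} \<union> {x, y}" "v(i := b) \<notin> {w} \<union> {x, y}"
      "x(i := \<not> b) \<notin> {w} \<union> {u, v}" "y(i := \<not> b) \<notin> {w} \<union> {u, v}"
      unfolding upd using V b fl free by auto
    show "card {z \<in> {w} \<union> {x, y}. z i = b} \<le> 2"
      by (rule card_subset_pair[of _ x x], use b in auto)
    show "card {z \<in> {w} \<union> {u, v}. z i = (\<not> b)} \<le> 2"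
      by (rule card_subset_pair[of _ w v], use b in auto)
  qed (use V in auto)
  have main2: "two_paths (cube B a) u v x y {w}"
    if V: "{u, v, x, y} \<subseteq> cube B a - {w}" "u \<noteq> x" "u \<noteq> y" "v \<noteq> x" "v \<noteq> y"
      and b: "u i = b" "x i = b" "v i = (\<not> b)" "y i = (\<not> b)" "w i = (\<not> b)"
      and free: "flip i x \<noteq> v" "flip i y \<noteq> u" for u v x y b
  proof (cases "flip i x = w")
    case False
    then show ?thesis using main[OF V b free(1)] by blast
  next
    case True
    have "flip i u \<noteq> w" "flip i u \<noteq> y" using True V(2) free by (metis flip_flip)+
    moreover have "{x, y, u, v} \<subseteq> cube B a - {w}" using V by auto
    ultimately have "two_paths (cube B a) x y u v {w}"
      using main[of x y u v b] V b by metis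
    then show ?thesis by (rule two_paths_swap)
  qed
  have main3: "two_paths (cube B a) u v x y {w}"
    if V: "{u, v, x, y} \<subseteq> cube B a - {w}" "u \<noteq> x" "u \<noteq> y" "v \<noteq> x" "v \<noteq> y"
      and b: "u i \<noteq> v i" "x i \<noteq> y i" "w i = v i"
      and free: "flip i x \<notin> {u, v}" "flip i y \<notin> {u, v}" for u v x y
  proof (cases "x i = u i")
    case True
    show ?thesis
      by (rule main2[where b = "u i"]) (use V b free True in auto)
  next
    case False
    have "two_paths (cube B a) u v y x {w}"
      by (rule main2[where b = "u i"]) (use V b free False in auto)
    then show ?thesis using two_paths_swap by metis
  qed
  show ?thesis
  proof (cases "w i = v i")
    case True
    then show ?thesis using main3 assms by metis
  next
    case False
    have "two_paths (cube B a) v u x y {w}"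
      by (rule main3) (use V split free False in auto)
    then show ?thesis by (rule two_paths_swap)
  qed
qed

text \<open>
  If no direction succeeds by one of the preceding lemmas, then each direction is constant on all five
  vertices or splits both pairs with a conflict. The five vertices then lie in the subcube of the
  splitting directions, so there are at least three of these, while \<open>x\<close> is adjacent to \<open>u\<close> or \<open>v\<close> in at most two
  directions.
\<close>

lemma two_paths_avoiding:
  assumes V: "{u, v, x, y, w} \<subseteq> cube B a" and dist: "card {u, v, x, y, w} = 5"
  shows "two_paths (cube B a) u v x y {w}"
proof (rule ccontr)
  assume no: "\<not> ?thesis"
  have ne: "u \<noteq> v" "u \<noteq> x" "u \<noteq> y" "u \<noteq> w" "v \<noteq> x" "v \<noteq> y" "v \<noteq> w" "x \<noteq> y" "x \<noteq> w" "y \<noteq> w"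
    using dist by (auto simp: card_insert_if split: if_splits)
  have V': "{u, v, x, y} \<subseteq> cube B a - {w}" "{u, v, y, x} \<subseteq> cube B a - {w}"
      "{x, y, u, v} \<subseteq> cube B a - {w}" "{x, y, v, u} \<subseteq> cube B a - {w}" "w \<in> cube B a"
    using V ne by auto
  have no': "\<not> two_paths (cube B a) u v y x {w}" "\<not> two_paths (cube B a) x y u v {w}"
      "\<not> two_paths (cube B a) x y v u {w}"
    using no two_paths_swap by metis+
  have type: "(v i = u i \<and> x i = u i \<and> y i = u i \<and> w i = u i) \<or> (u i \<noteq> v i \<and> x i \<noteq> y i)"
    if i: "i \<in> B" for i
    using no no' pairs_apart[OF i V'(1), of "u i"] one_end_apart[OF i V'(1,5), of "u i"]
      one_end_apart[OF i V'(2,5), of "u i"] one_end_apart[OF i V'(3,5), of "x i"]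
      one_end_apart[OF i V'(4,5), of "x i"] obstacle_apart[OF i V'(1) ne(2,3,5,6), of "u i"] ne
    by metis
  define D where "D = {i \<in> B. u i \<noteq> v i}"
  have off: "v j = u j" "x j = u j" "y j = u j" "w j = u j" if "j \<notin> D" for j
    using type[of j] that V unfolding D_def cube_def by (cases "j \<in> B"; auto)+
  have on: "v j = (\<not> u j)" "y j = (\<not> x j)" if "j \<in> D" for j
    using type[of j] that unfolding D_def by auto
  have D: "finite D" using B unfolding D_def by simp
  have "{u, v, x, y, w} \<subseteq> cube D u" using off unfolding cube_def by auto
  moreover have "finite (cube D u)"
    using card_cube[OF D, of u] by (metis card.infinite power_eq_0_iff zero_neq_numeral)
  ultimately have "5 \<le> (2::nat) ^ card D" using card_mono dist card_cube[OF D, of u] by metis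
  then have "3 \<le> card D"
  proof -
    assume "5 \<le> (2::nat) ^ card D"
    then have "\<not> card D \<le> 2" using power_increasing[of "card D" 2 "2::nat"] by auto
    then show ?thesis by simp
  qed
  have "\<exists>i\<in>D. flip i x \<notin> {u, v}"
  proof (rule ccontr)
    assume "\<not> ?thesis"
    then have "(\<lambda>j. flip j x) ` D \<subseteq> {u, v}" by auto
    then have "card ((\<lambda>j. flip j x) ` D) \<le> 2" by (rule card_subset_pair)
    then have "card D \<le> 2"
      by (subst (asm) card_image) (auto simp: inj_on_def flip_inj)
    then show False using \<open>3 \<le> card D\<close> by simp
  qed
  then obtain i where i: "i \<in> D" "flip i x \<noteq> u" "flip i x \<noteq> v" by auto
  \<comment> \<open>both pairs are antipodal in \<open>D\<close> and agree elsewhere, so a conflict at \<open>y\<close> implies one at \<open>x\<close>\<close>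
  have opp: "flip i x = z'" if "flip i y = z" and "\<And>j. z' j = (if j \<in> D then \<not> z j else z j)" for z z'
  proof
    fix j
    have "y j = (if j \<in> D then \<not> x j else x j)" using on(2) off by auto
    then show "flip i x j = z' j"
      using that(1)[symmetric] that(2)[of j] by (simp add: flip_apply)
  qed
  have "flip i y \<noteq> u"
  proof
    assume "flip i y = u"
    then have "flip i x = v" by (rule opp) (use on(1) off(1) in simp)
    then show False using i by simp
  qed
  moreover have "flip i y \<noteq> v"
  proof
    assume "flip i y = v"
    then have "flip i x = u" by (rule opp) (use on(1) off(1) in simp)
    then show False using i by simp
  qed
  ultimately have "two_paths (cube B a) u v x y {w}"
    using pairs_both_split[OF _ V'(1) ne(2,3,5,6), of i] on[OF i(1)] i unfolding D_def by auto
  then show False using no by simp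
qed

end

lemma cube_links_4: "cube_links TYPE('i) TYPE('k) 4"
  unfolding cube_links_def
proof (intro allI impI)
  fix B a and I :: "'k set" and s t and Ob :: "('i \<Rightarrow> bool) set"
  assume B: "finite B" "card B = 4" and T: "terminals (cube B a) I s t Ob"
    and card: "2 * card I + card Ob \<le> 4 + 1"
  interpret four_cube B a using B by unfold_locales
  have fin: "finite I" "finite Ob" using T unfolding terminals_def by auto
  consider "card I = 0" | "card I = 1" | "card I = 2" using card by linarith
  then show "linkable adj (cube B a) I s t Ob"
  proof cases
    case 1
    then show ?thesis using fin by (simp add: linkable_empty)
  next
    case 2
    then obtain k where I: "I = {k}" by (auto simp: card_1_singleton_iff)
    have k: "k \<in> I" using I by simp
    have "joined adj (cube B a - Ob) (s k) (t k)"
      by (rule cube_minus_few_joined)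
         (use B fin card 2 terminalsD[OF T k k] in auto)
    then show ?thesis unfolding I by (rule linkable_single)
  next
    case 3
    then obtain p q where I: "I = {p, q}" "p \<noteq> q" by (metis card_2_iff)
    have pq: "p \<in> I" "q \<in> I" using I by auto
    note ne = terminalsD[OF T pq(1) pq(1)] terminalsD[OF T pq(2) pq(2)] terminalsD[OF T pq]
      terminalsD(3)[OF T pq(2,1)]
    let ?X = "{s p, t p, s q, t q}"
    have cX: "card ?X = 4" "?X \<subseteq> cube B a" using ne I(2) by auto
    obtain w where w: "w \<in> cube B a" "w \<notin> ?X" "Ob \<subseteq> {w}"
    proof (cases "Ob = {}")
      case True
      have "card (cube B a) = 16" using card_cube[OF B(1)] B(2) by simp
      then have "\<not> cube B a \<subseteq> ?X" using cX(1) card_mono[of ?X "cube B a"] by auto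
      then show thesis using that True by blast
    next
      case False
      then have "card Ob = 1" using card 3 fin by (simp add: le_Suc_eq)
      then obtain w where "Ob = {w}" by (auto simp: card_1_singleton_iff)
      moreover have "w \<in> cube B a" using T \<open>Ob = {w}\<close> unfolding terminals_def by auto
      ultimately show thesis using that ne by auto
    qed
    have "two_paths (cube B a) (s p) (t p) (s q) (t q) {w}"
      by (rule two_paths_avoiding) (use w ne I(2) cX(2) in auto)
    then obtain C D where CD: "joined adj C (s p) (t p)" "joined adj D (s q) (t q)"
        "C \<inter> D = {}" "C \<subseteq> cube B a - {w}" "D \<subseteq> cube B a - {w}"
      unfolding two_paths_def by metis
    show ?thesis
      unfolding linkable_def I(1)
      by (rule exI[of _ "\<lambda>k. if k = p then C else D"])
         (use CD w I(2) in \<open>auto simp: disjoint_family_on_def\<close>)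
  qed
qed

theorem cube_links_ge_4:
  assumes "4 \<le> n"
  shows "cube_links TYPE('i) TYPE('k) n"
  using assms by (induction n rule: dec_induct) (auto intro: cube_links_4 cube_links_Suc)

section \<open>Menger's theorem\<close>

lemma joined_imp_path:
  assumes "joined E C x y"
  shows "\<exists>p. p \<noteq> [] \<and> hd p = x \<and> last p = y \<and> set p \<subseteq> C \<and> distinct p \<and> successively E p"
  using assms
proof (induction rule: joined.induct)
  case (joined_refl x)
  then show ?case by (intro exI[of _ "[x]"]) simp
next
  case (joined_step x y z)
  then obtain p where p: "p \<noteq> []" "hd p = x" "last p = y" "set p \<subseteq> C" "distinct p" "successively E p"
    by metis
  show ?case
  proof (cases "z \<in> set p")
    case True
    then obtain q r where "p = q @ z # r" by (metis split_list)
    then show ?thesis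
      using p by (intro exI[of _ "q @ [z]"]) (auto simp: successively_append_iff hd_append)
  next
    case False
    then show ?thesis
      using p joined_step(2,3)
      by (intro exI[of _ "p @ [z]"]) (auto simp: successively_append_iff)
  qed
qed

lemma path_imp_joined:
  assumes "p \<noteq> []" "successively E p" "set p \<subseteq> C"
  shows "joined E C (hd p) (last p)"
  using assms
proof (induction p rule: rev_nonempty_induct)
  case (single x)
  then show ?case by (auto intro: joined_refl)
next
  case (snoc x p)
  then show ?case by (auto simp: successively_append_iff intro: joined_step)
qed

text \<open>
  Directed walks make it possible to delete an arc in one direction only.
\<close>

definition dwalk :: "('a \<times> 'a) set \<Rightarrow> 'a set \<Rightarrow> 'a set \<Rightarrow> 'a list \<Rightarrow> bool" where
  "dwalk R A B p \<longleftrightarrow> p \<noteq> [] \<and> hd p \<in> A \<and> last p \<in> B \<and> successively (\<lambda>u v. (u, v) \<in> R) p"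

lemma successively_arcs_mono:
  "successively (\<lambda>u v. (u, v) \<in> R) p \<Longrightarrow> R \<subseteq> R' \<Longrightarrow> successively (\<lambda>u v. (u, v) \<in> R') p"
  by (erule successively_mono) (rule subsetD)

lemma successively_arcs_subset:
  assumes "successively (\<lambda>u v. (u, v) \<in> R) p" "p \<noteq> []" "hd p \<in> V" "R \<subseteq> V \<times> V"
  shows "set p \<subseteq> V"
  using assms(2,1,3)
proof (induction p rule: list_nonempty_induct)
  case (cons u p)
  then have "(u, hd p) \<in> R" "successively (\<lambda>u v. (u, v) \<in> R) p"
    by (simp_all add: successively_Cons)
  then have "set p \<subseteq> V" using cons(2) assms(4) by blast
  then show ?case using cons(4) by simp
qed simp

lemma dwalk_mono: "dwalk R A B p \<Longrightarrow> R \<subseteq> R' \<Longrightarrow> dwalk R' A B p"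
  unfolding dwalk_def using successively_arcs_mono[of R p R'] by simp

text \<open>
  A walk that is stopped at its first vertex in a set containing \<open>x\<close> has not used any arc that leaves \<open>x\<close>.
\<close>

lemma dwalk_first_hit:
  assumes p: "dwalk R A B p" and meets: "set p \<inter> insert x S \<noteq> {}"
  shows "\<exists>q. dwalk (R - {(x, y)}) A (insert x S) q \<and> set q \<subseteq> set p"
proof -
  obtain q z r where z: "p = q @ z # r" "z \<in> insert x S" "\<forall>u\<in>set q. u \<notin> insert x S"
    using split_list_first_prop[of p "\<lambda>u. u \<in> insert x S"] meets by auto
  have "successively (\<lambda>u v. (u, v) \<in> R) (q @ [z])"
    using p z(1) unfolding dwalk_def by (auto simp: successively_append_iff)
  moreover have "\<forall>u\<in>set q. u \<noteq> x" using z(3) by auto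
  ultimately have "successively (\<lambda>u v. (u, v) \<in> R - {(x, y)}) (q @ [z])"
  proof (induction q)
    case (Cons u q)
    then show ?case by (cases q) auto
  qed simp
  moreover have "hd (q @ [z]) \<in> A" using p z(1) unfolding dwalk_def by (cases q) auto
  ultimately show ?thesis
    using z(1,2) by (intro exI[of _ "q @ [z]"]) (auto simp: dwalk_def)
qed

text \<open>
  After its last visit to a set containing \<open>y\<close>, a walk uses no arc that enters \<open>y\<close>.
\<close>

lemma dwalk_last_hit:
  assumes p: "dwalk R A B p" and meets: "set p \<inter> insert y S \<noteq> {}"
  shows "\<exists>q. dwalk (R - {(x, y)}) (insert y S) B q \<and> set q \<subseteq> set p"
proof -
  obtain q z r where z: "p = q @ z # r" "z \<in> insert y S" "\<forall>u\<in>set r. u \<notin> insert y S"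
    using split_list_last_prop[of p "\<lambda>u. u \<in> insert y S"] meets by auto
  have "successively (\<lambda>u v. (u, v) \<in> R) (z # r)"
    using p z(1) unfolding dwalk_def by (auto simp: successively_append_iff)
  moreover have "\<forall>u\<in>set r. u \<noteq> y" using z(3) by auto
  ultimately have "successively (\<lambda>u v. (u, v) \<in> R - {(x, y)}) (z # r)"
  proof (induction r arbitrary: z)
    case (Cons u r)
    then show ?case by auto
  qed simp
  moreover have "last (z # r) \<in> B" using p z(1) unfolding dwalk_def by simp
  ultimately show ?thesis
    using z(1,2) by (intro exI[of _ "z # r"]) (auto simp: dwalk_def)
qed

definition disjoint_paths :: "('a \<times> 'a) set \<Rightarrow> 'a set \<Rightarrow> 'a set \<Rightarrow> 'a list set \<Rightarrow> bool" where
  "disjoint_paths R A B P \<longleftrightarrow> finite P \<and> (\<forall>p\<in>P. dwalk R A B p \<and> distinct p) \<and>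
     (\<forall>p\<in>P. \<forall>q\<in>P. p \<noteq> q \<longrightarrow> set p \<inter> set q = {})"

text \<open>
  Disjoint paths have distinct ends, so as many of them as there are vertices in \<open>B\<close> exhaust \<open>B\<close> with
  their ends, and a second vertex of \<open>B\<close> on a path would be the end of another one.
\<close>

lemma disjoint_paths_onto:
  assumes P: "disjoint_paths R A B P" "card P = card B" "finite B"
  shows "\<exists>f. \<forall>z\<in>B. f z \<in> P \<and> last (f z) = z \<and> set (f z) \<inter> B = {z}"
proof -
  have inj: "inj_on last P"
  proof (rule inj_onI, rule ccontr)
    fix p q assume pq: "p \<in> P" "q \<in> P" "last p = last q" "p \<noteq> q"
    then have "p \<noteq> []" "q \<noteq> []" using P(1) unfolding disjoint_paths_def dwalk_def by auto
    then have "last p \<in> set p \<inter> set q" by (metis IntI last_in_set pq(3))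
    then show False using pq P(1) unfolding disjoint_paths_def by auto
  qed
  have "last ` P \<subseteq> B" using P(1) unfolding disjoint_paths_def dwalk_def by auto
  then have onto: "last ` P = B"
    using P(2,3) card_image[OF inj] by (simp add: card_subset_eq)
  have "\<forall>z\<in>B. \<exists>p. p \<in> P \<and> last p = z \<and> set p \<inter> B = {z}"
  proof
    fix z assume z: "z \<in> B"
    then obtain p where p: "p \<in> P" "last p = z" using onto by auto
    have ne: "q \<noteq> []" if "q \<in> P" for q
      using P(1) that unfolding disjoint_paths_def dwalk_def by auto
    have "w = z" if w: "w \<in> set p" "w \<in> B" for w
    proof -
      obtain q where q: "q \<in> P" "last q = w" using onto w(2) by auto
      then have "w \<in> set q" using ne[of q] last_in_set by auto
      then have "p = q" using P(1) p(1) q(1) w(1) unfolding disjoint_paths_def by auto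
      then show ?thesis using p q by simp
    qed
    moreover have "z \<in> set p" using p ne[of p] last_in_set by auto
    ultimately have "set p \<inter> B = {z}" using z by blast
    then show "\<exists>p. p \<in> P \<and> last p = z \<and> set p \<inter> B = {z}"
      using p by (intro exI[of _ p] conjI)
  qed
  then show ?thesis by (rule bchoice)
qed

lemma dwalk_rev: "dwalk R A B (rev p) \<longleftrightarrow> dwalk (R\<inverse>) B A p"
  by (auto simp: dwalk_def hd_rev last_rev)

lemma disjoint_paths_rev:
  assumes "disjoint_paths R A B P"
  shows "disjoint_paths (R\<inverse>) B A (rev ` P)"
  using assms unfolding disjoint_paths_def
  by (auto simp: dwalk_rev)

lemma disjoint_paths_from:
  assumes P: "disjoint_paths R A B P" "card P = card A" "finite A"
  shows "\<exists>f. \<forall>z\<in>A. f z \<in> P \<and> hd (f z) = z \<and> set (f z) \<inter> A = {z}"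
proof -
  have "card (rev ` P) = card A" using P(2) by (simp add: card_image inj_on_def)
  from disjoint_paths_onto[OF disjoint_paths_rev[OF P(1)] this P(3)]
  obtain f where f: "\<forall>z\<in>A. f z \<in> rev ` P \<and> last (f z) = z \<and> set (f z) \<inter> A = {z}" by (rule exE)
  then show ?thesis
    by (intro exI[of _ "\<lambda>z. rev (f z)"] ballI) (auto simp: hd_rev)
qed

text \<open>
  Goering's proof, by induction on the number of arcs. If fewer than \<open>k\<close> vertices \<open>S\<close> separate \<open>A\<close> from \<open>B\<close>
  after the deletion of an arc \<open>(x, y)\<close>, then \<open>S + x\<close> and \<open>S + y\<close> are separators with \<open>k\<close> vertices. The induction
  gives \<open>k\<close> disjoint paths from \<open>A\<close> to \<open>S + x\<close> and from \<open>S + y\<close> to \<open>B\<close>. They can meet only in \<open>S\<close>, since \<open>S\<close> separates \<open>A\<close> from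
  \<open>B\<close> without the arc, and they are concatenated in the vertices of \<open>S\<close> and along the arc.
\<close>

theorem menger:
  assumes "finite R"
    and "\<And>S. finite S \<Longrightarrow> card S < k \<Longrightarrow> \<exists>p. dwalk R A B p \<and> set p \<inter> S = {}"
  shows "\<exists>P. disjoint_paths R A B P \<and> card P = k"
  using assms
proof (induction "card R" arbitrary: R A B)
  case 0
  then have R: "R = {}" by simp
  have sing: "\<exists>a. p = [a] \<and> a \<in> A \<inter> B" if "dwalk R A B p" for p
    using that unfolding dwalk_def R by (cases p; cases "tl p") auto
  have "\<exists>T\<subseteq>A \<inter> B. finite T \<and> card T = k"
  proof (cases "finite (A \<inter> B) \<and> card (A \<inter> B) < k")
    case True
    then obtain p where p: "dwalk R A B p" "set p \<inter> (A \<inter> B) = {}" using 0(3) by metis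
    from sing[OF p(1)] p(2) show ?thesis by auto
  next
    case False
    then consider "infinite (A \<inter> B)" | "k \<le> card (A \<inter> B)" by linarith
    then show ?thesis
    proof cases
      case 1
      then show ?thesis using infinite_arbitrarily_large[OF 1, of k] by auto
    next
      case 2
      then show ?thesis using obtain_subset_with_card_n[OF 2] by metis
    qed
  qed
  then obtain T where T: "T \<subseteq> A \<inter> B" "finite T" "card T = k" by metis
  have "disjoint_paths R A B ((\<lambda>a. [a]) ` T)"
    using T(1,2) by (auto simp: disjoint_paths_def dwalk_def)
  moreover have "card ((\<lambda>a. [a]) ` T) = k" using T by (simp add: card_image inj_on_def)
  ultimately show ?case by metis
next
  case (Suc n)
  have "R \<noteq> {}" using Suc(2) by auto
  then obtain x y where e: "(x, y) \<in> R" by (metis all_not_in_conv surj_pair)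
  define R' where "R' = R - {(x, y)}"
  have R': "n = card R'" "finite R'" using Suc(2,3) e by (simp_all add: R'_def)
  show ?case
  proof (cases "\<forall>S. finite S \<longrightarrow> card S < k \<longrightarrow> (\<exists>p. dwalk R' A B p \<and> set p \<inter> S = {})")
    case True
    then obtain P where P: "disjoint_paths R' A B P" "card P = k"
      using Suc(1)[OF R', of A B] by metis
    have "dwalk R A B p" if "dwalk R' A B p" for p
      using that by (rule dwalk_mono) (auto simp: R'_def)
    then have "disjoint_paths R A B P" using P(1) unfolding disjoint_paths_def by auto
    then show ?thesis using P(2) by metis
  next
    case False
    then obtain S where S: "finite S" "card S < k"
        "\<And>p. dwalk R' A B p \<Longrightarrow> set p \<inter> S \<noteq> {}" by metis
    \<comment> \<open>a walk that misses \<open>S\<close> uses the deleted arc\<close>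
    have meets: "set p \<inter> S \<noteq> {} \<or> x \<in> set p \<and> y \<in> set p" if p: "dwalk R A B p" for p
    proof (rule ccontr)
      assume no: "\<not> ?thesis"
      have "successively (\<lambda>u v. (u, v) \<in> R) p" using p by (simp add: dwalk_def)
      then have "successively (\<lambda>u v. (u, v) \<in> R') p"
        by (rule successively_mono) (use no in \<open>auto simp: R'_def\<close>)
      then have "dwalk R' A B p" using p by (simp add: dwalk_def)
      from S(3)[OF this] show False using no by simp
    qed
    have cx: "x \<notin> S" "y \<notin> S" "card (insert x S) = k" "card (insert y S) = k"
    proof -
      have "\<not> card (insert x S) < k" "\<not> card (insert y S) < k"
      proof -
        { fix z assume z: "z \<in> {x, y}" "card (insert z S) < k"
          then obtain p where "dwalk R A B p" "set p \<inter> insert z S = {}"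
            using Suc(4)[of "insert z S"] S(1) by auto
          then have False using meets[of p] z(1) by auto }
        then show "\<not> card (insert x S) < k" "\<not> card (insert y S) < k" by auto
      qed
      then show "x \<notin> S" "y \<notin> S" "card (insert x S) = k" "card (insert y S) = k"
        using S(1,2) by (auto simp: card_insert_if split: if_splits)
    qed
    obtain P where P: "disjoint_paths R' A (insert x S) P" "card P = k"
    proof -
      have "\<exists>P. disjoint_paths R' A (insert x S) P \<and> card P = k"
      proof (rule Suc(1)[OF R'])
        fix T :: "'a set" assume "finite T" "card T < k"
        then obtain p where p: "dwalk R A B p" "set p \<inter> T = {}" using Suc(4) by metis
        have "set p \<inter> insert x S \<noteq> {}" using meets[OF p(1)] by auto
        from dwalk_first_hit[OF p(1) this] show "\<exists>p. dwalk R' A (insert x S) p \<and> set p \<inter> T = {}"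
          using p(2) unfolding R'_def by (metis disjoint_iff subsetD)
      qed
      then show thesis using that by metis
    qed
    obtain Q where Q: "disjoint_paths R' (insert y S) B Q" "card Q = k"
    proof -
      have "\<exists>Q. disjoint_paths R' (insert y S) B Q \<and> card Q = k"
      proof (rule Suc(1)[OF R'])
        fix T :: "'a set" assume "finite T" "card T < k"
        then obtain p where p: "dwalk R A B p" "set p \<inter> T = {}" using Suc(4) by metis
        have "set p \<inter> insert y S \<noteq> {}" using meets[OF p(1)] by auto
        from dwalk_last_hit[OF p(1) this] show "\<exists>p. dwalk R' (insert y S) B p \<and> set p \<inter> T = {}"
          using p(2) unfolding R'_def by (metis disjoint_iff subsetD)
      qed
      then show thesis using that by metis
    qed
    have "finite (insert x S)" "finite (insert y S)" "card P = card (insert x S)"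
        "card Q = card (insert y S)" using S(1) cx P(2) Q(2) by simp_all
    note fin = this
    obtain f where f: "\<forall>z\<in>insert x S. f z \<in> P \<and> last (f z) = z \<and> set (f z) \<inter> insert x S = {z}"
      using disjoint_paths_onto[OF P(1) fin(3,1)] by (rule exE)
    obtain g where g: "\<forall>z\<in>insert y S. g z \<in> Q \<and> hd (g z) = z \<and> set (g z) \<inter> insert y S = {z}"
      using disjoint_paths_from[OF Q(1) fin(4,2)] by (rule exE)
    have fw: "dwalk R' A {z} (f z)" "distinct (f z)" "set (f z) \<inter> insert x S = {z}" "f z \<in> P"
        "last (f z) = z" if "z \<in> insert x S" for z
      using f that P(1) unfolding disjoint_paths_def dwalk_def by auto
    have gw: "dwalk R' {z} B (g z)" "distinct (g z)" "set (g z) \<inter> insert y S = {z}" "g z \<in> Q"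
        "hd (g z) = z" if "z \<in> insert y S" for z
      using g that Q(1) unfolding disjoint_paths_def dwalk_def by auto
    have cross: "u = z \<and> u = w \<and> u \<in> S"
      if z: "z \<in> insert x S" and w: "w \<in> insert y S" and u: "u \<in> set (f z)" "u \<in> set (g w)" for z w u
    proof -
      obtain p1 p2 where p: "f z = p1 @ u # p2" using u(1) by (metis split_list)
      obtain q1 q2 where q: "g w = q1 @ u # q2" using u(2) by (metis split_list)
      have "dwalk R' A B (p1 @ u # q2)"
        using fw(1)[OF z] gw(1)[OF w] unfolding p q dwalk_def
        by (auto simp: successively_append_iff hd_append split: if_splits)
      from S(3)[OF this] obtain s where s: "s \<in> S" "s \<in> set (p1 @ u # q2)" by blast
      have zl: "z \<in> set (u # p2)" using fw(5)[OF z] unfolding p by (metis last_appendR last_in_set list.discI)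
      have wh: "w \<in> set (q1 @ [u])" using gw(5)[OF w] unfolding q by (cases q1) auto
      have "s \<notin> set p1"
      proof
        assume "s \<in> set p1"
        then have "s = z" using fw(3)[OF z] s(1) unfolding p by auto
        then show False using \<open>s \<in> set p1\<close> zl fw(2)[OF z] unfolding p by auto
      qed
      moreover have "s \<notin> set q2"
      proof
        assume "s \<in> set q2"
        then have "s = w" using gw(3)[OF w] s(1) unfolding q by auto
        then show False using \<open>s \<in> set q2\<close> wh gw(2)[OF w] unfolding q by auto
      qed
      ultimately have "s = u" using s(2) by auto
      then have "u \<in> S" "u = z" "u = w" using s(1) u fw(3)[OF z] gw(3)[OF w] by auto
      then show ?thesis by simp
    qed
    have fdisj: "set (f z) \<inter> set (f z') = {}" if "z \<in> insert x S" "z' \<in> insert x S" "z \<noteq> z'" for z z'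
    proof -
      have "f z \<noteq> f z'" using fw(5)[OF that(1)] fw(5)[OF that(2)] that(3) by auto
      then show ?thesis using P(1) fw(4) that unfolding disjoint_paths_def by auto
    qed
    have gdisj: "set (g z) \<inter> set (g z') = {}" if "z \<in> insert y S" "z' \<in> insert y S" "z \<noteq> z'" for z z'
    proof -
      have "g z \<noteq> g z'" using gw(5)[OF that(1)] gw(5)[OF that(2)] that(3) by auto
      then show ?thesis using Q(1) gw(4) that unfolding disjoint_paths_def by auto
    qed
    define j where "j z = (if z = x then y else z)" for z
    have j: "j z \<in> insert y S" "z \<in> S \<longleftrightarrow> j z = z \<and> z \<noteq> x" if "z \<in> insert x S" for z
      using that cx(1) by (auto simp: j_def)
    have jinj: "j z \<noteq> j z'" if "z \<in> insert x S" "z' \<in> insert x S" "z \<noteq> z'" for z z'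
      using that cx(1,2) by (auto simp: j_def)
    define h where "h z = f z @ (if z = x then g y else tl (g z))" for z
    have hset: "set (h z) \<subseteq> set (f z) \<union> set (g (j z))" for z
    proof -
      have "set (tl (g z)) \<subseteq> set (g z)" by (cases "g z") auto
      then show ?thesis unfolding h_def j_def by auto
    qed
    have hP: "dwalk R A B (h z) \<and> distinct (h z)" if z: "z \<in> insert x S" for z
    proof -
      have sub: "R' \<subseteq> R" by (auto simp: R'_def)
      have mono: "successively (\<lambda>u v. (u, v) \<in> R) p" if "successively (\<lambda>u v. (u, v) \<in> R') p" for p
        using that by (rule successively_arcs_mono) (auto simp: R'_def)
      note f' = fw[OF z] and g' = gw[OF j(1)[OF z]]
      show ?thesis
      proof (cases "z = x")
        case True
        then have h: "h z = f z @ g (j z)" by (simp add: h_def j_def)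
        have "set (f z) \<inter> set (g (j z)) = {}"
          using cross[OF z j(1)[OF z]] True cx(1) by auto
        moreover have "(z, j z) \<in> R" using True e by (simp add: j_def)
        ultimately show ?thesis
          unfolding h using f' g' by (auto simp: dwalk_def successively_append_iff mono)
      next
        case False
        then have zS: "z \<in> S" "j z = z" using z by (auto simp: j_def)
        obtain r where r: "g z = z # r" using g' zS(2) unfolding dwalk_def by (cases "g z") auto
        have h: "h z = f z @ r" using False r by (simp add: h_def)
        have "set (f z) \<inter> set r = {}"
        proof -
          have "u = z" if "u \<in> set (f z)" "u \<in> set r" for u
            using cross[OF z j(1)[OF z], of u] that r zS(2) by auto
          moreover have "z \<notin> set r" using g'(2) r zS(2) by simp
          ultimately show ?thesis by auto
        qed
        then show ?thesis
          unfolding h using f' g' r zS(2) subsetD[OF sub]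
          by (cases "r = []") (auto simp: dwalk_def successively_append_iff successively_Cons mono)
      qed
    qed
    have hdisj: "set (h z) \<inter> set (h z') = {}" if zz: "z \<in> insert x S" "z' \<in> insert x S" "z \<noteq> z'" for z z'
    proof -
      have "set (f z) \<inter> set (g (j z')) = {}" "set (f z') \<inter> set (g (j z)) = {}"
      proof -
        { fix z z' u assume zz: "z \<in> insert x S" "z' \<in> insert x S" "z \<noteq> z'"
            and u: "u \<in> set (f z)" "u \<in> set (g (j z'))"
          from cross[OF zz(1) j(1)[OF zz(2)] u] have "z = j z'" "z \<in> S" by auto
          then have "j z' = j z" using j(2)[OF zz(1)] by simp
          then have False using jinj[OF zz] by simp }
        then show "set (f z) \<inter> set (g (j z')) = {}" "set (f z') \<inter> set (g (j z)) = {}"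
          using zz by (metis disjoint_iff)+
      qed
      moreover have "set (f z) \<inter> set (f z') = {}" using fdisj[OF zz] .
      moreover have "set (g (j z)) \<inter> set (g (j z')) = {}"
        using gdisj[OF j(1)[OF zz(1)] j(1)[OF zz(2)] jinj[OF zz]] .
      ultimately show ?thesis using hset[of z] hset[of z'] by blast
    qed
    have hne: "set (h z) \<noteq> {}" if "z \<in> insert x S" for z
      using hP[OF that] by (simp add: dwalk_def)
    have "inj_on h (insert x S)"
    proof (rule inj_onI, rule ccontr)
      fix z z' assume "z \<in> insert x S" "z' \<in> insert x S" "h z = h z'" "z \<noteq> z'"
      then show False using hdisj[of z z'] hne[of z] by simp
    qed
    then have "card (h ` insert x S) = k" using cx(3) by (simp only: card_image)
    moreover have "disjoint_paths R A B (h ` insert x S)"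
      unfolding disjoint_paths_def
    proof (intro conjI ballI impI)
      fix p q assume "p \<in> h ` insert x S" "q \<in> h ` insert x S" "p \<noteq> q"
      then show "set p \<inter> set q = {}" using hdisj by (metis (no_types, lifting) imageE)
    next
      fix p assume "p \<in> h ` insert x S"
      then show "dwalk R A B p" "distinct p" using hP by auto
    qed (use S(1) in simp)
    ultimately show ?thesis by metis
  qed
qed

text \<open>
  The paths of Menger's theorem are cut at their first vertex in \<open>Y\<close>. There are as many of them as vertices
  in \<open>X\<close>, so one starts in each vertex of \<open>X\<close>.
\<close>

lemma disjoint_approach:
  assumes fin: "finite V" "finite X"
    and sep: "\<And>S. finite S \<Longrightarrow> card S < card X \<Longrightarrow> \<exists>x\<in>X. \<exists>y\<in>Y. joined E (V - S) x y"
  shows "\<exists>f W. (\<forall>x\<in>X. joined E (W x) x (f x) \<and> W x \<subseteq> V \<and> W x \<inter> Y = {f x}) \<and> disjoint_family_on W X"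
proof -
  define R where "R = {(u, v). u \<in> V \<and> v \<in> V \<and> E u v}"
  have "R \<subseteq> V \<times> V" by (auto simp: R_def)
  then have "finite R" using fin(1) by (meson finite_SigmaI finite_subset)
  have walk: "\<exists>p. dwalk R (X \<inter> V) Y p \<and> set p \<inter> S = {}" if S: "finite S" "card S < card X" for S
  proof -
    obtain x y where xy: "x \<in> X" "y \<in> Y" "joined E (V - S) x y" using sep[OF S] by metis
    obtain p where p: "p \<noteq> []" "hd p = x" "last p = y" "set p \<subseteq> V - S" "successively E p"
      using joined_imp_path[OF xy(3)] by metis
    from p(5) have "successively (\<lambda>u v. (u, v) \<in> R) p"
      by (rule successively_mono) (use p(4) in \<open>auto simp: R_def\<close>)
    moreover have "x \<in> V" using joined_memD[OF xy(3)] by simp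
    ultimately have "dwalk R (X \<inter> V) Y p" using p(1-3) xy(1,2) by (simp add: dwalk_def)
    moreover have "set p \<inter> S = {}" using p(4) by blast
    ultimately show ?thesis by (intro exI conjI)
  qed
  obtain P where P: "disjoint_paths R (X \<inter> V) Y P" "card P = card X"
    using menger[OF \<open>finite R\<close> walk] by metis
  have XV: "X \<subseteq> V"
  proof -
    have "inj_on hd P"
    proof (rule inj_onI, rule ccontr)
      fix p q assume pq: "p \<in> P" "q \<in> P" "hd p = hd q" "p \<noteq> q"
      then have "p \<noteq> []" "q \<noteq> []" using P(1) unfolding disjoint_paths_def dwalk_def by auto
      then have "hd p \<in> set p \<inter> set q" by (metis IntI hd_in_set pq(3))
      then show False using pq P(1) unfolding disjoint_paths_def by auto
    qed
    moreover have "hd ` P \<subseteq> X \<inter> V" using P(1) unfolding disjoint_paths_def dwalk_def by auto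
    ultimately have "card X \<le> card (X \<inter> V)"
      using P(2) fin by (metis card_image card_mono finite_Int)
    then have "X \<inter> V = X" using fin by (metis card_seteq inf_le1)
    then show ?thesis by auto
  qed
  then have XVX: "X \<inter> V = X" by auto
  obtain g where g: "\<forall>x\<in>X. g x \<in> P \<and> hd (g x) = x \<and> set (g x) \<inter> X = {x}"
    using disjoint_paths_from[OF P(1)[unfolded XVX] P(2) fin(2)] by (rule exE)
  have "\<forall>x\<in>X. \<exists>q. q \<noteq> [] \<and> hd q = x \<and> set q \<subseteq> set (g x) \<and> set q \<subseteq> V \<and> successively E q \<and> set q \<inter> Y = {last q}"
  proof
    fix x assume x: "x \<in> X"
    have gx: "g x \<noteq> []" "hd (g x) = x" "last (g x) \<in> Y" "successively (\<lambda>u v. (u, v) \<in> R) (g x)"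
      using g x P(1) unfolding disjoint_paths_def dwalk_def by auto
    then have "\<exists>y\<in>set (g x). y \<in> Y" by (metis last_in_set)
    then obtain q y r where q: "g x = q @ y # r" "y \<in> Y" "\<forall>u\<in>set q. u \<notin> Y"
      using split_list_first_prop[of "g x" "\<lambda>u. u \<in> Y"] by auto
    have suc: "successively (\<lambda>u v. (u, v) \<in> R) (q @ [y])"
      using gx(4) unfolding q(1) by (auto simp: successively_append_iff)
    then have "successively E (q @ [y])"
      by (rule successively_mono) (auto simp: R_def)
    moreover have hd: "hd (q @ [y]) = x" using gx(2) unfolding q(1) by (cases q) auto
    moreover have "set (q @ [y]) \<subseteq> V"
      by (rule successively_arcs_subset[OF suc]) (use hd x XV \<open>R \<subseteq> V \<times> V\<close> in auto)
    moreover have "set (q @ [y]) \<subseteq> set (g x)" unfolding q(1) by auto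
    moreover have "set (q @ [y]) \<inter> Y = {last (q @ [y])}" using q(2,3) by auto
    ultimately show "\<exists>q. q \<noteq> [] \<and> hd q = x \<and> set q \<subseteq> set (g x) \<and> set q \<subseteq> V \<and>
        successively E q \<and> set q \<inter> Y = {last q}"
      by (intro exI[of _ "q @ [y]"]) simp
  qed
  from bchoice[OF this] obtain q where q0: "\<forall>x\<in>X. q x \<noteq> [] \<and> hd (q x) = x \<and> set (q x) \<subseteq> set (g x) \<and>
      set (q x) \<subseteq> V \<and> successively E (q x) \<and> set (q x) \<inter> Y = {last (q x)}" by (rule exE)
  note q = bspec[OF q0]
  have d: "set (g x) \<inter> set (g x') = {}" if "x \<in> X" "x' \<in> X" "x \<noteq> x'" for x x'
  proof -
    have "g x \<noteq> g x'" using g that by metis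
    then show ?thesis using g that P(1) unfolding disjoint_paths_def by metis
  qed
  have "disjoint_family_on (\<lambda>x. set (q x)) X"
    unfolding disjoint_family_on_def
  proof (intro ballI impI)
    fix x x' assume xx: "x \<in> X" "x' \<in> X" "x \<noteq> x'"
    have "set (q x) \<subseteq> set (g x)" "set (q x') \<subseteq> set (g x')" using q xx by simp_all
    then show "set (q x) \<inter> set (q x') = {}" using d[OF xx] by blast
  qed
  moreover have "joined E (set (q x)) x (last (q x))" if "x \<in> X" for x
    using path_imp_joined[of "q x" E "set (q x)"] q[OF that] by auto
  ultimately show ?thesis
    using q by (intro exI[of _ "\<lambda>x. last (q x)"] exI[of _ "\<lambda>x. set (q x)"]) simp
qed

section \<open>The graph of a polytope\<close>

lemma joined_mono_rel:
  assumes "joined E C x y" "\<And>u v. E u v \<Longrightarrow> E' u v" "C \<subseteq> D"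
  shows "joined E' D x y"
  using joined_mono[OF joined_image[OF assms(1), of E' "\<lambda>x. x"] , of D] assms(2,3) by simp

abbreviation vertices :: "'a::euclidean_space set \<Rightarrow> 'a set" where
  "vertices P \<equiv> {v. v extreme_point_of P}"

definition pedge :: "'a::euclidean_space set \<Rightarrow> 'a \<Rightarrow> 'a \<Rightarrow> bool" where
  "pedge P u v \<longleftrightarrow> closed_segment u v edge_of P"

lemma symp_pedge: "symp (pedge P)"
  by (auto simp: symp_def pedge_def closed_segment_commute)

lemma pedge_face: "pedge F u v \<Longrightarrow> F face_of P \<Longrightarrow> pedge P u v"
  by (auto simp: pedge_def edge_of_def intro: face_of_trans)

lemma vertices_face: "F face_of P \<Longrightarrow> vertices F = vertices P \<inter> F"
  by (auto simp: extreme_point_of_face)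

lemma finite_vertices: "polytope P \<Longrightarrow> finite (vertices P)"
  by (simp add: finite_polyhedron_extreme_points polytope_imp_polyhedron)

lemma polytope_eq_hull: "polytope P \<Longrightarrow> P = convex hull (vertices P)"
  by (simp add: Krein_Milman_Minkowski polytope_imp_compact polytope_imp_convex)

lemma vertices_in: "v \<in> vertices P \<Longrightarrow> v \<in> P"
  by (simp add: extreme_point_of_def)

lemma vertices_bound:
  assumes "polytope P" "\<And>v. v \<in> vertices P \<Longrightarrow> c \<bullet> v \<le> \<gamma>" "p \<in> P"
  shows "c \<bullet> p \<le> \<gamma>"
proof -
  have "convex hull (vertices P) \<subseteq> {x. c \<bullet> x \<le> \<gamma>}"
    using assms(2) by (intro hull_minimal convex_halfspace_le) auto
  then show ?thesis using polytope_eq_hull[OF assms(1)] assms(3) by auto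
qed

lemma higher_vertex:
  assumes "polytope P" "p \<in> P" "\<gamma> < c \<bullet> p"
  shows "\<exists>v\<in>vertices P. \<gamma> < c \<bullet> v"
  using vertices_bound[OF assms(1) _ assms(2), of c \<gamma>] assms(3) by force

lemma vertex_exposed:
  assumes "polytope P" "v \<in> vertices P"
  shows "\<exists>e. \<forall>x\<in>P. x \<noteq> v \<longrightarrow> e \<bullet> x < e \<bullet> v"
proof -
  have "{v} face_of P" using assms(2) by (simp add: face_of_singleton)
  then have "{v} exposed_face_of P"
    using assms(1) exposed_face_of_polyhedron polytope_imp_polyhedron by blast
  then obtain e b where e: "P \<subseteq> {x. e \<bullet> x \<le> b}" "{v} = P \<inter> {x. e \<bullet> x = b}"
    unfolding exposed_face_of_def by blast
  have "e \<bullet> x < e \<bullet> v" if "x \<in> P" "x \<noteq> v" for x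
  proof -
    have "e \<bullet> v = b" "e \<bullet> x \<le> b" "e \<bullet> x \<noteq> b" using e that by auto
    then show ?thesis by simp
  qed
  then show ?thesis by blast
qed

text \<open>
  Among the other vertices, \<open>w\<close> maximises the slope \<open>\<sigma>\<close> of \<open>f\<close> against the descent of \<open>e\<close> from \<open>v\<close>, as in the
  shadow vertex rule of linear programming. Hence \<open>f + \<sigma> e\<close> is maximal both at \<open>v\<close> and at \<open>w\<close>.
\<close>

lemma max_ratio:
  assumes P: "polytope P" and v: "v \<in> vertices P" and e: "\<And>x. x \<in> P \<Longrightarrow> x \<noteq> v \<Longrightarrow> e \<bullet> x < e \<bullet> v"
    and u: "u \<in> vertices P" "u \<noteq> v"
  obtains \<sigma> w where "w \<in> vertices P" "w \<noteq> v" "f \<bullet> w - f \<bullet> v = \<sigma> * (e \<bullet> v - e \<bullet> w)"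
    "\<And>x. x \<in> P \<Longrightarrow> f \<bullet> x - f \<bullet> v \<le> \<sigma> * (e \<bullet> v - e \<bullet> x)"
proof -
  define r where "r x = (f \<bullet> x - f \<bullet> v) / (e \<bullet> v - e \<bullet> x)" for x
  let ?V = "vertices P - {v}"
  have fin: "finite (r ` ?V)" "r ` ?V \<noteq> {}" using finite_vertices[OF P] u by auto
  define \<sigma> where "\<sigma> = Max (r ` ?V)"
  have "\<sigma> \<in> r ` ?V" unfolding \<sigma>_def using fin by (rule Max_in)
  then obtain w where w: "w \<in> ?V" "\<sigma> = r w" by blast
  have pos: "e \<bullet> v - e \<bullet> x > 0" if "x \<in> ?V" for x
    using e[of x] that vertices_in[of x P] by auto
  have "f \<bullet> x - f \<bullet> v \<le> \<sigma> * (e \<bullet> v - e \<bullet> x)" if x: "x \<in> vertices P" for x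
  proof (cases "x = v")
    case False
    then have "x \<in> ?V" using x by simp
    then have "r x \<le> \<sigma>" unfolding \<sigma>_def using fin(1) by (intro Max_ge) auto
    then show ?thesis using pos[OF \<open>x \<in> ?V\<close>] by (simp add: r_def divide_simps)
  qed simp
  then have "(f + \<sigma> *\<^sub>R e) \<bullet> x \<le> f \<bullet> v + \<sigma> * (e \<bullet> v)" if "x \<in> vertices P" for x
    using that by (simp add: inner_add_left algebra_simps)
  then have all: "(f + \<sigma> *\<^sub>R e) \<bullet> x \<le> f \<bullet> v + \<sigma> * (e \<bullet> v)" if "x \<in> P" for x
    using vertices_bound[OF P _ that] by blast
  show thesis
  proof (rule that[of w \<sigma>])
    show "w \<in> vertices P" "w \<noteq> v" using w(1) by auto
    show "f \<bullet> w - f \<bullet> v = \<sigma> * (e \<bullet> v - e \<bullet> w)"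
      using pos[OF w(1)] w(2) by (simp add: r_def)
    show "f \<bullet> x - f \<bullet> v \<le> \<sigma> * (e \<bullet> v - e \<bullet> x)" if "x \<in> P" for x
      using all[OF that] by (simp add: inner_add_left algebra_simps)
  qed
qed

lemma max_ratio_face:
  assumes P: "polytope P" and "\<And>x. x \<in> P \<Longrightarrow> f \<bullet> x - f \<bullet> v \<le> \<sigma> * (e \<bullet> v - e \<bullet> x)"
  shows "{x \<in> P. f \<bullet> x - f \<bullet> v = \<sigma> * (e \<bullet> v - e \<bullet> x)} face_of P"
proof -
  let ?g = "f + \<sigma> *\<^sub>R e" and ?b = "f \<bullet> v + \<sigma> * (e \<bullet> v)"
  have "(P \<inter> {x. ?g \<bullet> x = ?b}) face_of P"
    using assms(2) by (intro face_of_Int_supporting_hyperplane_le polytope_imp_convex[OF P])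
       (simp add: inner_add_left algebra_simps)
  moreover have "P \<inter> {x. ?g \<bullet> x = ?b} = {x \<in> P. f \<bullet> x - f \<bullet> v = \<sigma> * (e \<bullet> v - e \<bullet> x)}"
    by (auto simp: inner_add_left algebra_simps)
  ultimately show ?thesis by simp
qed

text \<open>
  The middle one of three points on a line is not extreme.
\<close>

lemma extreme_points_not_collinear:
  assumes "u \<in> vertices P" "v \<in> vertices P" "w \<in> vertices P" "u \<noteq> v" "v \<noteq> w" "u \<noteq> w"
  shows "u - v \<noteq> t *\<^sub>R (w - v)"
proof
  assume "u - v = t *\<^sub>R (w - v)"
  then have u: "u = (1 - t) *\<^sub>R v + t *\<^sub>R w" by (simp add: algebra_simps)
  have ext: "\<not> (\<exists>s. 0 < s \<and> s < 1 \<and> x = (1 - s) *\<^sub>R y + s *\<^sub>R z)"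
    if "x \<in> vertices P" "y \<in> vertices P" "z \<in> vertices P" "y \<noteq> z" for x y z
    using that unfolding extreme_point_of_def by (auto simp: in_segment)
  have t01: "t \<noteq> 0" "t \<noteq> 1" using u assms by auto
  consider "t < 0" | "0 < t" "t < 1" | "1 < t" using t01 by linarith
  then show False
  proof cases
    case 1
    define s where "s = 1 / (1 - t)"
    have "0 < s" "s < 1" "1 - s = - t * s" using 1 by (auto simp: s_def field_simps)
    moreover have "v = (1 - s) *\<^sub>R w + s *\<^sub>R u"
    proof -
      have "(1 - s) *\<^sub>R w + s *\<^sub>R u = (1 - s + s * t) *\<^sub>R w + (s * (1 - t)) *\<^sub>R v"
        unfolding u by (simp add: algebra_simps)
      moreover have "s * (1 - t) = 1" using 1 by (simp add: s_def)
      moreover have "1 - s + s * t = 0" using \<open>1 - s = - t * s\<close> by simp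
      ultimately show ?thesis by simp
    qed
    ultimately show False using ext[of v w u] assms by blast
  next
    case 2
    then show False using ext[of u v w] u assms by blast
  next
    case 3
    define s where "s = 1 / t"
    have "0 < s" "s < 1" using 3 by (auto simp: s_def)
    moreover have "w = (1 - s) *\<^sub>R v + s *\<^sub>R u"
    proof -
      have "(1 - s) *\<^sub>R v + s *\<^sub>R u = (1 - s) *\<^sub>R v + (s - s * t) *\<^sub>R v + (s * t) *\<^sub>R w"
        unfolding u by (simp add: algebra_simps)
      also have "s * t = 1" using 3 by (simp add: s_def)
      finally show ?thesis by (simp add: algebra_simps)
    qed
    ultimately show False using ext[of w v u] assms by blast
  qed
qed

text \<open>
  The face on which \<open>c + \<sigma> e\<close> is maximal contains \<open>v\<close> and a vertex above \<open>v\<close>, but it may be all of \<open>P\<close>. In this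
  case \<open>- c\<close> itself exposes \<open>v\<close>, and the same construction applies to \<open>- c\<close> and to a functional \<open>r\<close> that takes the
  same value at \<open>v\<close> and \<open>w\<close> and a larger one at \<open>u\<close>; the resulting face excludes \<open>w\<close>.
\<close>

lemma proper_face_with_higher_vertex:
  assumes P: "polytope P" and V: "v \<in> vertices P" "w \<in> vertices P" "u \<in> vertices P"
    and ne: "u \<noteq> v" "u \<noteq> w" and cw: "c \<bullet> v < c \<bullet> w"
  shows "\<exists>F. F face_of P \<and> F \<noteq> P \<and> v \<in> F \<and> (\<exists>x\<in>vertices P. x \<in> F \<and> c \<bullet> v < c \<bullet> x)"
proof -
  have vw: "w \<noteq> v" using cw by auto
  have inP: "v \<in> P" "w \<in> P" "u \<in> P" using V vertices_in by blast+
  obtain e where e: "\<And>x. x \<in> P \<Longrightarrow> x \<noteq> v \<Longrightarrow> e \<bullet> x < e \<bullet> v"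
    using vertex_exposed[OF P V(1)] by blast
  obtain \<sigma> w' where w': "w' \<in> vertices P" "w' \<noteq> v" "c \<bullet> w' - c \<bullet> v = \<sigma> * (e \<bullet> v - e \<bullet> w')"
    and \<sigma>: "\<And>x. x \<in> P \<Longrightarrow> c \<bullet> x - c \<bullet> v \<le> \<sigma> * (e \<bullet> v - e \<bullet> x)"
    using max_ratio[OF P V(1) e V(2) vw, of c] by metis
  have epos: "e \<bullet> v - e \<bullet> x > 0" if "x \<in> P" "x \<noteq> v" for x using e[OF that] by simp
  have "0 < \<sigma> * (e \<bullet> v - e \<bullet> w)" using \<sigma>[OF inP(2)] cw by simp
  then have "\<sigma> > 0" using epos[OF inP(2) vw] by (simp add: zero_less_mult_iff)
  define F where "F = {x \<in> P. c \<bullet> x - c \<bullet> v = \<sigma> * (e \<bullet> v - e \<bullet> x)}"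
  have F: "F face_of P" unfolding F_def using P \<sigma> by (rule max_ratio_face)
  have up: "c \<bullet> v < c \<bullet> x" if "x \<in> F" "x \<noteq> v" for x
  proof -
    have "0 < \<sigma> * (e \<bullet> v - e \<bullet> x)" using that epos[of x] \<open>\<sigma> > 0\<close> by (simp add: F_def)
    then show ?thesis using that by (simp add: F_def)
  qed
  have w'F: "w' \<in> F" using w' vertices_in[OF w'(1)] by (simp add: F_def)
  show ?thesis
  proof (cases "F = P")
    case False
    moreover have "v \<in> F" using inP by (simp add: F_def)
    ultimately show ?thesis using F w'(1,2) w'F up by blast
  next
    case True
    have c: "(- c) \<bullet> x < (- c) \<bullet> v" if "x \<in> P" "x \<noteq> v" for x
      using up[of x] that True by simp
    define r where "r = (u - v) - (((u - v) \<bullet> (w - v)) / ((w - v) \<bullet> (w - v))) *\<^sub>R (w - v)"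
    have "(w - v) \<bullet> (w - v) \<noteq> 0" using vw by simp
    then have rw: "r \<bullet> (w - v) = 0" by (simp add: r_def inner_diff_left)
    have "r \<noteq> 0"
      using extreme_points_not_collinear[OF V(3,1,2) ne(1) vw[symmetric] ne(2)]
      by (simp add: r_def)
    moreover have "r \<bullet> (u - v) = r \<bullet> r"
    proof -
      have "u - v = r + (((u - v) \<bullet> (w - v)) / ((w - v) \<bullet> (w - v))) *\<^sub>R (w - v)"
        by (simp add: r_def)
      then have "r \<bullet> (u - v) = r \<bullet> (r + (((u - v) \<bullet> (w - v)) / ((w - v) \<bullet> (w - v))) *\<^sub>R (w - v))"
        by (rule arg_cong)
      then show ?thesis using rw by (simp add: inner_add_right)
    qed
    ultimately have ru: "r \<bullet> u - r \<bullet> v > 0" by (simp add: inner_diff_right[symmetric])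
    obtain \<tau> z where z: "z \<in> vertices P" "z \<noteq> v" "r \<bullet> z - r \<bullet> v = \<tau> * ((- c) \<bullet> v - (- c) \<bullet> z)"
      and \<tau>: "\<And>x. x \<in> P \<Longrightarrow> r \<bullet> x - r \<bullet> v \<le> \<tau> * ((- c) \<bullet> v - (- c) \<bullet> x)"
      using max_ratio[OF P V(1) c V(2) vw, of r] by metis
    have "\<tau> * (c \<bullet> u - c \<bullet> v) > 0" using \<tau>[OF inP(3)] ru by simp
    then have "\<tau> > 0" using up[of u] inP(3) True ne(1) by (simp add: zero_less_mult_iff)
    define G where "G = {x \<in> P. r \<bullet> x - r \<bullet> v = \<tau> * ((- c) \<bullet> v - (- c) \<bullet> x)}"
    have G: "G face_of P" unfolding G_def using P \<tau> by (rule max_ratio_face)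
    have "w \<notin> G" using rw cw \<open>\<tau> > 0\<close> by (simp add: G_def inner_diff_right)
    then have "G \<noteq> P" using inP(2) by blast
    moreover have "v \<in> G" using inP by (simp add: G_def)
    moreover have "z \<in> G" using z vertices_in[OF z(1)] by (simp add: G_def)
    moreover have "c \<bullet> v < c \<bullet> z" using up[of z] z vertices_in[OF z(1)] True by simp
    ultimately show ?thesis using G z(1) by blast
  qed
qed

lemma two_vertex_polytope:
  assumes "polytope P" "vertices P = {v, w}" "v \<noteq> w"
  shows "P = closed_segment v w" "aff_dim P = 1"
proof -
  show "P = closed_segment v w"
    using polytope_eq_hull[OF assms(1)] assms(2) by (simp add: segment_convex_hull)
  then show "aff_dim P = 1"
    using assms(3) by (simp add: segment_convex_hull aff_dim_convex_hull aff_dim_2)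
qed

text \<open>
  Proper faces through \<open>v\<close> with a higher vertex are taken until only two vertices are left, which then
  span an edge.
\<close>

lemma ascending_edge:
  assumes "polytope P" "v \<in> vertices P" "w \<in> vertices P" "c \<bullet> v < c \<bullet> w"
  shows "\<exists>x. pedge P v x \<and> x \<in> vertices P \<and> c \<bullet> v < c \<bullet> x"
  using assms
proof (induction "card (vertices P)" arbitrary: P w rule: less_induct)
  case less
  have vw: "v \<noteq> w" using less(5) by auto
  show ?case
  proof (cases "vertices P = {v, w}")
    case True
    have "pedge P v w"
      using two_vertex_polytope[OF less(2) True vw] polytope_imp_convex[OF less(2)]
      by (simp add: pedge_def edge_of_def face_of_refl)
    then show ?thesis using less(4,5) by blast
  next
    case False
    then obtain u where u: "u \<in> vertices P" "u \<noteq> v" "u \<noteq> w" using less(3,4) by blast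
    obtain F x where F: "F face_of P" "F \<noteq> P" "v \<in> F" "x \<in> vertices P" "x \<in> F" "c \<bullet> v < c \<bullet> x"
      using proper_face_with_higher_vertex[OF less(2-4) u less(5)] by metis
    have poly: "polytope F" using F(1) less(2) by (rule face_of_polytope_polytope[rotated])
    have VF: "vertices F = vertices P \<inter> F" using F(1) by (rule vertices_face)
    have "vertices F \<noteq> vertices P"
      using polytope_eq_hull[OF poly] polytope_eq_hull[OF less(2)] F(2) by metis
    then have "card (vertices F) < card (vertices P)"
      using VF finite_vertices[OF less(2)] by (intro psubset_card_mono) auto
    moreover have "v \<in> vertices F" "x \<in> vertices F" using VF F less(3) by auto
    ultimately obtain y where "pedge F v y" "y \<in> vertices F" "c \<bullet> v < c \<bullet> y"
      using less(1)[of F x] poly F(6) by metis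
    then show ?thesis using pedge_face[OF _ F(1)] VF by blast
  qed
qed

text \<open>
  Ascending edges strictly decrease the number of vertices above the current one.
\<close>

lemma joined_to_top:
  assumes "polytope P" "v \<in> vertices P"
  shows "\<exists>z\<in>vertices P. (\<forall>p\<in>P. c \<bullet> p \<le> c \<bullet> z) \<and>
    joined (pedge P) (insert v {x \<in> vertices P. c \<bullet> v < c \<bullet> x}) v z"
  using assms(2)
proof (induction "card {x \<in> vertices P. c \<bullet> v < c \<bullet> x}" arbitrary: v rule: less_induct)
  case less
  show ?case
  proof (cases "\<forall>p\<in>P. c \<bullet> p \<le> c \<bullet> v")
    case True
    then show ?thesis using less(2) joined_refl[of v] by blast
  next
    case False
    then obtain p where "p \<in> P" "c \<bullet> v < c \<bullet> p" by force
    then obtain w where "w \<in> vertices P" "c \<bullet> v < c \<bullet> w" using higher_vertex[OF assms(1)] by blast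
    then obtain x where x: "pedge P v x" "x \<in> vertices P" "c \<bullet> v < c \<bullet> x"
      using ascending_edge[OF assms(1) less(2)] by blast
    have sub: "insert x {y \<in> vertices P. c \<bullet> x < c \<bullet> y} \<subseteq> {y \<in> vertices P. c \<bullet> v < c \<bullet> y}"
      using x by auto
    have "{y \<in> vertices P. c \<bullet> x < c \<bullet> y} \<subset> {y \<in> vertices P. c \<bullet> v < c \<bullet> y}"
      using x by auto
    then have "card {y \<in> vertices P. c \<bullet> x < c \<bullet> y} < card {y \<in> vertices P. c \<bullet> v < c \<bullet> y}"
      using finite_vertices[OF assms(1)] by (intro psubset_card_mono) auto
    from less(1)[OF this x(2)] obtain z where z: "z \<in> vertices P" "\<forall>p\<in>P. c \<bullet> p \<le> c \<bullet> z"
        "joined (pedge P) (insert x {y \<in> vertices P. c \<bullet> x < c \<bullet> y}) x z" by blast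
    have "joined (pedge P) (insert v {y \<in> vertices P. c \<bullet> v < c \<bullet> y}) x z"
      using z(3) by (rule joined_mono) (use sub in blast)
    moreover have "joined (pedge P) (insert v {y \<in> vertices P. c \<bullet> v < c \<bullet> y}) v x"
      using x by (intro joined_edge) auto
    ultimately have "joined (pedge P) (insert v {y \<in> vertices P. c \<bullet> v < c \<bullet> y}) v z"
      by (rule joined_trans)
    then show ?thesis using z(1,2) by (intro bexI[of _ z] conjI)
  qed
qed

text \<open>
  Every monotone path for a functional that exposes \<open>u\<close> ends in \<open>u\<close>.
\<close>

lemma polytope_graph_joined:
  assumes P: "polytope P" and "u \<in> vertices P" "w \<in> vertices P"
  shows "joined (pedge P) (vertices P) u w"
proof -
  obtain e where e: "\<And>x. x \<in> P \<Longrightarrow> x \<noteq> u \<Longrightarrow> e \<bullet> x < e \<bullet> u"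
    using vertex_exposed[OF P assms(2)] by blast
  obtain z where z: "z \<in> vertices P" "\<forall>p\<in>P. e \<bullet> p \<le> e \<bullet> z"
      "joined (pedge P) (insert w {x \<in> vertices P. e \<bullet> w < e \<bullet> x}) w z"
    using joined_to_top[OF P assms(3), of e] by blast
  have zu: "z = u" using e[of z] z(1,2) vertices_in[OF z(1)] vertices_in[OF assms(2)] by force
  from z(3)[unfolded zu] have "joined (pedge P) (vertices P) w u"
    by (rule joined_mono) (use assms(3) in auto)
  then show ?thesis using symp_pedge by (rule joined_sym)
qed

text \<open>
  Both vertices ascend to the face on which \<open>c\<close> is maximal, and the graph of this face is connected. Apart
  from its two ends the path stays strictly above the hyperplane; this is what keeps paths on
  different sides of a hyperplane disjoint.
\<close>

lemma joined_above:
  assumes P: "polytope P" and uw: "u \<in> vertices P" "w \<in> vertices P" "\<gamma> \<le> c \<bullet> u" "\<gamma> \<le> c \<bullet> w"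
    and p: "p \<in> P" "\<gamma> < c \<bullet> p"
  shows "joined (pedge P) ({x \<in> vertices P. \<gamma> < c \<bullet> x} \<union> {u, w}) u w"
proof -
  let ?C = "{x \<in> vertices P. \<gamma> < c \<bullet> x} \<union> {u, w}"
  have up: "\<exists>z\<in>vertices P. (\<forall>p\<in>P. c \<bullet> p \<le> c \<bullet> z) \<and> joined (pedge P) ?C v z"
    if v: "v \<in> {u, w}" for v
  proof -
    have "v \<in> vertices P" using v uw by auto
    then obtain z where z: "z \<in> vertices P" "\<forall>p\<in>P. c \<bullet> p \<le> c \<bullet> z"
        "joined (pedge P) (insert v {x \<in> vertices P. c \<bullet> v < c \<bullet> x}) v z"
      using joined_to_top[OF P, of v c] by blast
    have "insert v {x \<in> vertices P. c \<bullet> v < c \<bullet> x} \<subseteq> ?C" using v uw by auto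
    then show ?thesis using joined_mono[OF z(3)] z(1,2) by blast
  qed
  obtain z where z: "z \<in> vertices P" "\<forall>p\<in>P. c \<bullet> p \<le> c \<bullet> z" "joined (pedge P) ?C u z"
    using up[of u] by blast
  obtain z' where z': "z' \<in> vertices P" "\<forall>p\<in>P. c \<bullet> p \<le> c \<bullet> z'" "joined (pedge P) ?C w z'"
    using up[of w] by blast
  define F where "F = P \<inter> {x. c \<bullet> x = c \<bullet> z}"
  have F: "F face_of P"
    unfolding F_def using z(2) by (intro face_of_Int_supporting_hyperplane_le polytope_imp_convex[OF P]) auto
  have "polytope F" using F P by (rule face_of_polytope_polytope[rotated])
  moreover have "c \<bullet> z' = c \<bullet> z" using z z' vertices_in[OF z(1)] vertices_in[OF z'(1)] by force
  then have "z \<in> vertices F" "z' \<in> vertices F"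
    unfolding vertices_face[OF F] using z z' vertices_in[OF z(1)] vertices_in[OF z'(1)] by (auto simp: F_def)
  ultimately have j: "joined (pedge F) (vertices F) z z'" by (rule polytope_graph_joined)
  have "\<gamma> < c \<bullet> z" using p z(2) by force
  then have "vertices F \<subseteq> ?C"
    unfolding vertices_face[OF F] by (auto simp: F_def)
  with j pedge_face[OF _ F] have "joined (pedge P) ?C z z'"
    by (rule joined_mono_rel)
  from joined_trans[OF joined_trans[OF joined_sym[OF z'(3) symp_pedge] this] z(3)]
  show ?thesis .
qed

text \<open>
  By dimension some \<open>p\<close> in \<open>P\<close> lies off the affine hull of \<open>S\<close>. The functional is the component of \<open>p - s\<close>
  orthogonal to the directions of this hull.
\<close>

lemma functional_constant_on_few:
  assumes S: "S \<subseteq> P" "finite S" "S \<noteq> {}" "int (card S) \<le> aff_dim P"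
  obtains c \<gamma> p where "\<And>x. x \<in> S \<Longrightarrow> c \<bullet> x = \<gamma>" "p \<in> P" "c \<bullet> p \<noteq> \<gamma>"
proof -
  obtain s where s: "s \<in> S" using S(3) by blast
  have "aff_dim S \<le> int (card S) - 1" using S(2) by (rule aff_dim_le_card)
  then have "aff_dim (affine hull S) < aff_dim P" using S(4) by (simp add: aff_dim_affine_hull)
  then have "\<not> P \<subseteq> affine hull S" using aff_dim_subset by (metis not_le)
  then obtain p where p: "p \<in> P" "p \<notin> affine hull S" by blast
  let ?U = "span ((\<lambda>x. - s + x) ` (S - {s}))"
  obtain y z where yz: "y \<in> ?U" "\<And>w. w \<in> ?U \<Longrightarrow> orthogonal z w" "p - s = y + z"
    using orthogonal_subspace_decomp_exists[of "(\<lambda>x. - s + x) ` (S - {s})" "p - s"] by metis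
  have "z \<noteq> 0"
  proof
    assume "z = 0"
    then have "p = s + y" using yz(3) by (simp add: algebra_simps)
    then have "p \<in> (+) s ` ?U" using yz(1) by blast
    then show False using p(2) affine_hull_span2[OF s] by (auto simp: image_def)
  qed
  have "z \<bullet> x = z \<bullet> s" if "x \<in> S" for x
  proof (cases "x = s")
    case False
    then have "- s + x \<in> ?U" using that by (intro span_base) auto
    then have "orthogonal z (- s + x)" using yz(2) by blast
    then show ?thesis by (simp add: orthogonal_def inner_diff_right)
  qed simp
  moreover have "z \<bullet> p \<noteq> z \<bullet> s"
  proof -
    have "z \<bullet> (p - s) = z \<bullet> z"
      using yz(1) yz(2)[OF yz(1)] yz(3) by (simp add: orthogonal_def inner_add_right)
    then show ?thesis using \<open>z \<noteq> 0\<close> by (auto simp: inner_diff_right)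
  qed
  ultimately show thesis using that p(1) by blast
qed

lemma joined_below:
  assumes P: "polytope P" and uw: "u \<in> vertices P" "w \<in> vertices P" "c \<bullet> u \<le> \<gamma>" "c \<bullet> w \<le> \<gamma>"
    and p: "p \<in> P" "c \<bullet> p < \<gamma>"
  shows "joined (pedge P) ({x \<in> vertices P. c \<bullet> x < \<gamma>} \<union> {u, w}) u w"
  using joined_above[OF P uw(1,2), of "- \<gamma>" "- c" p] uw(3,4) p by simp

text \<open>
  Fewer than \<open>dim P\<close> vertices together with \<open>u\<close> lie on a hyperplane that does not contain \<open>P\<close>. From \<open>u\<close> one can
  go to either side that \<open>P\<close> has points on, and \<open>w\<close> is on the hyperplane or on one of these sides.
\<close>

theorem balinski:
  assumes P: "polytope P" and S: "S \<subseteq> vertices P" "int (card S) < aff_dim P"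
    and uw: "u \<in> vertices P - S" "w \<in> vertices P - S"
  shows "joined (pedge P) (vertices P - S) u w"
proof -
  have fin: "finite S" using S(1) finite_vertices[OF P] finite_subset by blast
  have "insert u S \<subseteq> P" using S(1) uw(1) vertices_in by blast
  moreover have "int (card (insert u S)) \<le> aff_dim P" using S(2) uw(1) fin by simp
  ultimately obtain c \<gamma> p where c: "\<And>x. x \<in> insert u S \<Longrightarrow> c \<bullet> x = \<gamma>" and p: "p \<in> P" "c \<bullet> p \<noteq> \<gamma>"
    using functional_constant_on_few[of "insert u S" P] fin by blast
  have cS: "c \<bullet> x = \<gamma>" if "x \<in> S" for x using c that by simp
  have u: "c \<bullet> u = \<gamma>" using c by simp
  have uwV: "u \<in> vertices P" "w \<in> vertices P" "w \<in> P" using uw vertices_in by blast+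
  have above: ?thesis if "\<gamma> \<le> c \<bullet> w" "q \<in> P" "\<gamma> < c \<bullet> q" for q
  proof -
    have "joined (pedge P) ({x \<in> vertices P. \<gamma> < c \<bullet> x} \<union> {u, w}) u w"
      by (rule joined_above[OF P uwV(1,2) _ that]) (simp add: u)
    then show ?thesis by (rule joined_mono) (use uw cS in auto)
  qed
  have below: ?thesis if "c \<bullet> w \<le> \<gamma>" "q \<in> P" "c \<bullet> q < \<gamma>" for q
  proof -
    have "joined (pedge P) ({x \<in> vertices P. c \<bullet> x < \<gamma>} \<union> {u, w}) u w"
      by (rule joined_below[OF P uwV(1,2) _ that]) (simp add: u)
    then show ?thesis by (rule joined_mono) (use uw cS in auto)
  qed
  consider "\<gamma> < c \<bullet> w" | "c \<bullet> w < \<gamma>" | "c \<bullet> w = \<gamma>" "\<gamma> < c \<bullet> p" | "c \<bullet> w = \<gamma>" "c \<bullet> p < \<gamma>"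
    using p(2) by linarith
  then show ?thesis
    by cases (use above below uwV(3) p(1) in \<open>auto intro: less_imp_le\<close>)
qed

text \<open>
  Otherwise some nonconstant functional is constant on \<open>v\<close> and its neighbours, and \<open>v\<close> has no ascending
  edge for this functional or its negative.
\<close>

lemma degree_ge_dim:
  assumes P: "polytope P" and v: "v \<in> vertices P"
  shows "aff_dim P \<le> int (card {w \<in> vertices P. pedge P v w})"
proof (rule ccontr)
  let ?N = "{w \<in> vertices P. pedge P v w}"
  assume less: "\<not> ?thesis"
  have fin: "finite ?N" using finite_vertices[OF P] by simp
  have "insert v ?N \<subseteq> P" using v vertices_in by blast
  moreover have "int (card (insert v ?N)) \<le> aff_dim P"
    using less fin by (simp add: card_insert_if)
  ultimately obtain c \<gamma> p where c: "\<And>x. x \<in> insert v ?N \<Longrightarrow> c \<bullet> x = \<gamma>" and p: "p \<in> P" "c \<bullet> p \<noteq> \<gamma>"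
    using functional_constant_on_few[of "insert v ?N" P] fin by blast
  have no: False if p': "p \<in> P" "d \<bullet> v < d \<bullet> p" and d: "\<And>x. x \<in> insert v ?N \<Longrightarrow> d \<bullet> x = d \<bullet> v" for d
  proof -
    obtain w where "w \<in> vertices P" "d \<bullet> v < d \<bullet> w" using higher_vertex[OF P p'] by blast
    then obtain x where "x \<in> ?N" "d \<bullet> v < d \<bullet> x" using ascending_edge[OF P v] by blast
    then show False using d[of x] by simp
  qed
  show False
  proof (cases "c \<bullet> v < c \<bullet> p")
    case True
    show False by (rule no[OF p(1) True]) (use c in simp)
  next
    case False
    then have "(- c) \<bullet> v < (- c) \<bullet> p" using p(2) c[of v] by simp
    from p(1) this show False by (rule no) (use c in simp)
  qed
qed

text \<open>
  The four terminals lie on a hyperplane that does not contain \<open>P\<close>. If \<open>P\<close> has points on both sides, one pair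
  is joined above it and the other below it. Otherwise the terminals lie in a facet \<open>F\<close>. Being a
  \<open>3\<close>-polytope, \<open>F\<close> remains connected without \<open>x\<close> and \<open>y\<close>, so \<open>u\<close> and \<open>v\<close> are joined inside \<open>F\<close>, and \<open>x\<close> and \<open>y\<close> are joined
  below \<open>F\<close>.
\<close>

theorem polytope_4_two_linked:
  assumes P: "polytope P" "aff_dim P = 4"
    and V: "{u, v, x, y} \<subseteq> vertices P" and ne: "u \<noteq> v" "u \<noteq> x" "u \<noteq> y" "v \<noteq> x" "v \<noteq> y" "x \<noteq> y"
  shows "\<exists>C D. joined (pedge P) C u v \<and> joined (pedge P) D x y \<and> C \<inter> D = {} \<and>
    C \<subseteq> vertices P \<and> D \<subseteq> vertices P"
proof -
  let ?X = "{u, v, x, y}"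
  have "?X \<subseteq> P" using V vertices_in by blast
  moreover have "int (card ?X) \<le> aff_dim P" using P(2) by (simp add: card_insert_if)
  ultimately obtain c0 \<gamma>0 p0 where c0: "\<And>z. z \<in> ?X \<Longrightarrow> c0 \<bullet> z = \<gamma>0" and p0: "p0 \<in> P" "c0 \<bullet> p0 \<noteq> \<gamma>0"
    using functional_constant_on_few[of ?X P] by blast
  define c \<gamma> where "c = (if c0 \<bullet> p0 < \<gamma>0 then c0 else - c0)" and "\<gamma> = (if c0 \<bullet> p0 < \<gamma>0 then \<gamma>0 else - \<gamma>0)"
  have c: "c \<bullet> z = \<gamma>" if "z \<in> ?X" for z using c0[OF that] by (simp add: c_def \<gamma>_def)
  have p0: "p0 \<in> P" "c \<bullet> p0 < \<gamma>" using p0 by (auto simp: c_def \<gamma>_def)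
  have V': "u \<in> vertices P" "v \<in> vertices P" "x \<in> vertices P" "y \<in> vertices P" using V by auto
  have cX: "c \<bullet> u = \<gamma>" "c \<bullet> v = \<gamma>" "c \<bullet> x = \<gamma>" "c \<bullet> y = \<gamma>" using c by simp_all
  show ?thesis
  proof (cases "\<exists>q\<in>P. \<gamma> < c \<bullet> q")
    case True
    then obtain q where q: "q \<in> P" "\<gamma> < c \<bullet> q" by blast
    let ?C = "{z \<in> vertices P. \<gamma> < c \<bullet> z} \<union> {u, v}" and ?D = "{z \<in> vertices P. c \<bullet> z < \<gamma>} \<union> {x, y}"
    have "joined (pedge P) ?C u v" using joined_above[OF P(1) V'(1,2) _ _ q] cX by simp
    moreover have "joined (pedge P) ?D x y" using joined_below[OF P(1) V'(3,4) _ _ p0] cX by simp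
    moreover have "?C \<inter> ?D = {}" using ne cX by auto
    moreover have "?C \<subseteq> vertices P" "?D \<subseteq> vertices P" using V by auto
    ultimately show ?thesis by blast
  next
    case False
    define G where "G = P \<inter> {z. c \<bullet> z = \<gamma>}"
    have G: "G face_of P"
      unfolding G_def using False
      by (intro face_of_Int_supporting_hyperplane_le polytope_imp_convex[OF P(1)]) force
    have XG: "?X \<subseteq> G" using c \<open>?X \<subseteq> P\<close> by (auto simp: G_def)
    have "G \<noteq> P" using p0 by (auto simp: G_def)
    then obtain F where F: "F facet_of P" "G \<subseteq> F"
      using face_of_polyhedron_subset_facet[OF polytope_imp_polyhedron[OF P(1)] G] XG by blast
    have FP: "F face_of P" "aff_dim F = 3" using F(1) P(2) by (auto simp: facet_of_def)
    have polyF: "polytope F" using FP(1) P(1) by (rule face_of_polytope_polytope[rotated])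
    have VF: "vertices F = vertices P \<inter> F" using FP(1) by (rule vertices_face)
    have XF: "u \<in> vertices F" "v \<in> vertices F" "x \<in> vertices F" "y \<in> vertices F"
      unfolding VF using V XG F(2) by auto
    have "joined (pedge F) (vertices F - {x, y}) u v"
    proof (rule balinski[OF polyF])
      show "int (card {x, y}) < aff_dim F" using FP(2) by (simp add: card_insert_if)
    qed (use XF ne in auto)
    then have uv: "joined (pedge P) (vertices F - {x, y}) u v"
      by (rule joined_mono_rel) (use pedge_face[OF _ FP(1)] in auto)
    have "F exposed_face_of P"
      using FP(1) exposed_face_of_polyhedron[OF polytope_imp_polyhedron[OF P(1)]] by blast
    then obtain d b where d: "P \<subseteq> {z. d \<bullet> z \<le> b}" "F = P \<inter> {z. d \<bullet> z = b}"
      unfolding exposed_face_of_def by blast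
    have "F \<noteq> P" using FP(2) P(2) by auto
    then obtain q where q: "q \<in> P" "q \<notin> F" using face_of_imp_subset[OF FP(1)] by blast
    have "d \<bullet> q < b" using d q by force
    moreover have dX: "d \<bullet> x = b" "d \<bullet> y = b" using XF vertices_in[of _ F] d(2) by blast+
    ultimately have "joined (pedge P) ({z \<in> vertices P. d \<bullet> z < b} \<union> {x, y}) x y"
      using joined_below[OF P(1) V'(3,4) _ _ q(1)] by simp
    moreover have "(vertices F - {x, y}) \<inter> ({z \<in> vertices P. d \<bullet> z < b} \<union> {x, y}) = {}"
      using d(2) VF by auto
    moreover have "vertices F - {x, y} \<subseteq> vertices P" "{z \<in> vertices P. d \<bullet> z < b} \<union> {x, y} \<subseteq> vertices P"
      using VF V by auto
    ultimately show ?thesis using uv by blast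
  qed
qed

section \<open>The graph of a combinatorial cube\<close>

lemma has_vertex:
  assumes "polytope P" "P \<noteq> {}"
  shows "vertices P \<noteq> {}"
  using polytope_eq_hull[OF assms(1)] assms(2) by auto

lemma vertices_edge:
  assumes "pedge P u v"
  shows "u \<noteq> v" "vertices P \<inter> closed_segment u v = {u, v}" "closed_segment u v face_of P"
proof -
  show "u \<noteq> v" using assms by (auto simp: pedge_def edge_of_def)
  show F: "closed_segment u v face_of P" using assms by (simp add: pedge_def edge_of_def)
  have "vertices (closed_segment u v) = {u, v}" by (auto simp: extreme_point_of_segment)
  then show "vertices P \<inter> closed_segment u v = {u, v}"
    using vertices_face[OF F] by simp
qed

lemma edge_from_vertices:
  assumes "polytope P" "E face_of P" "vertices P \<inter> E = {u, v}" "u \<noteq> v"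
  shows "pedge P u v" "E = closed_segment u v"
proof -
  have "polytope E" using assms(1,2) by (rule face_of_polytope_polytope)
  moreover have "vertices E = {u, v}" using vertices_face[OF assms(2)] assms(3) by simp
  ultimately have "E = closed_segment u v" "aff_dim E = 1"
    using assms(4) by (rule two_vertex_polytope)+
  then show "pedge P u v" "E = closed_segment u v"
    using assms(2) by (auto simp: pedge_def edge_of_def)
qed

text \<open>
  Vertices are the minimal nonempty faces, and edges are the faces with exactly two vertices. Both notions
  depend only on the order of the face lattice.
\<close>

lemma combinatorially_equivalent_graph_iso:
  fixes P :: "'a::euclidean_space set" and Q :: "'b::euclidean_space set"
  assumes P: "polytope P" and Q: "polytope Q" and eq: "combinatorially_equivalent P Q"
  obtains g where "bij_betw g (vertices P) (vertices Q)"
    "\<And>u v. u \<in> vertices P \<Longrightarrow> v \<in> vertices P \<Longrightarrow> pedge P u v \<longleftrightarrow> pedge Q (g u) (g v)"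
proof -
  obtain \<phi> where bij: "bij_betw \<phi> {F. F face_of P} {G. G face_of Q}"
    and ord: "\<And>F F'. F face_of P \<Longrightarrow> F' face_of P \<Longrightarrow> F \<subseteq> F' \<longleftrightarrow> \<phi> F \<subseteq> \<phi> F'"
    using eq unfolding combinatorially_equivalent_def by blast
  have face: "\<phi> F face_of Q" if "F face_of P" for F
    using bij_betwE[OF bij] that by blast
  have surj: "\<exists>F. F face_of P \<and> \<phi> F = G" if "G face_of Q" for G
  proof -
    have "G \<in> \<phi> ` {F. F face_of P}" using bij that by (simp add: bij_betw_def)
    then show ?thesis by blast
  qed
  have inj: "F = F'" if "F face_of P" "F' face_of P" "\<phi> F = \<phi> F'" for F F'
    using ord[OF that(1,2)] ord[OF that(2,1)] that(3) by simp
  have empty: "{} face_of P" "\<phi> {} = {}"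
  proof -
    show 1: "{} face_of P" by simp
    obtain F where "F face_of P" "\<phi> F = {}" using surj[of "{}"] by auto
    then show "\<phi> {} = {}" using ord[OF 1, of F] by auto
  qed
  have vface: "{v} face_of P" if "v \<in> vertices P" for v
    using that by (simp add: face_of_singleton)
  have "\<exists>w. \<phi> {v} = {w} \<and> w \<in> vertices Q" if v: "v \<in> vertices P" for v
  proof -
    note F = vface[OF v]
    have "\<phi> {v} \<noteq> {}" using inj[OF F empty(1)] empty(2) by auto
    moreover have "polytope (\<phi> {v})" using Q face[OF F] by (rule face_of_polytope_polytope)
    ultimately obtain w where w: "w \<in> vertices (\<phi> {v})" using has_vertex by blast
    then have wQ: "w \<in> vertices Q" "w \<in> \<phi> {v}" using vertices_face[OF face[OF F]] by auto
    then have "{w} face_of Q" by (simp add: face_of_singleton)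
    then obtain E where E: "E face_of P" "\<phi> E = {w}" using surj by blast
    then have "E \<subseteq> {v}" using ord[OF E(1) F] wQ(2) by simp
    moreover have "E \<noteq> {}" using E(2) empty(2) by auto
    ultimately have "E = {v}" by auto
    then show ?thesis using E(2) wQ(1) by blast
  qed
  then obtain g where g: "\<And>v. v \<in> vertices P \<Longrightarrow> \<phi> {v} = {g v}" "\<And>v. v \<in> vertices P \<Longrightarrow> g v \<in> vertices Q"
    by metis
  have mem: "v \<in> E \<longleftrightarrow> g v \<in> \<phi> E" if "v \<in> vertices P" "E face_of P" for v E
    using ord[OF vface[OF that(1)] that(2)] g(1)[OF that(1)] by simp
  have ginj: "inj_on g (vertices P)"
  proof (rule inj_onI)
    fix u v assume uv: "u \<in> vertices P" "v \<in> vertices P" "g u = g v"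
    then have "{u} = {v}" using g(1) by (intro inj vface) simp_all
    then show "u = v" by simp
  qed
  have gsurj: "\<exists>v\<in>vertices P. g v = w" if w: "w \<in> vertices Q" for w
  proof -
    have "{w} face_of Q" using w by (simp add: face_of_singleton)
    then obtain E where E: "E face_of P" "\<phi> E = {w}" using surj by blast
    have "E \<noteq> {}" using E(2) empty(2) by auto
    moreover have "polytope E" using P E(1) by (rule face_of_polytope_polytope)
    ultimately obtain v where "v \<in> vertices E" using has_vertex by blast
    then have v: "v \<in> vertices P" "v \<in> E" using vertices_face[OF E(1)] by auto
    then show ?thesis using mem[OF v(1) E(1)] E(2) by auto
  qed
  have bijg: "bij_betw g (vertices P) (vertices Q)"
    using ginj gsurj g(2) unfolding bij_betw_def by blast
  have im: "vertices Q \<inter> \<phi> E = g ` (vertices P \<inter> E)" if E: "E face_of P" for E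
  proof (intro equalityI subsetI)
    fix w assume w: "w \<in> vertices Q \<inter> \<phi> E"
    then obtain v where v: "v \<in> vertices P" "g v = w" using gsurj by blast
    then have "v \<in> E" using mem[OF v(1) E] w by simp
    then show "w \<in> g ` (vertices P \<inter> E)" using v by auto
  next
    fix w assume "w \<in> g ` (vertices P \<inter> E)"
    then obtain v where v: "v \<in> vertices P" "v \<in> E" "w = g v" by blast
    then show "w \<in> vertices Q \<inter> \<phi> E" using g(2)[OF v(1)] mem[OF v(1) E] by simp
  qed
  show thesis
  proof (rule that[OF bijg])
    fix u v assume uv: "u \<in> vertices P" "v \<in> vertices P"
    show "pedge P u v \<longleftrightarrow> pedge Q (g u) (g v)"
    proof
      assume e: "pedge P u v"
      note E = vertices_edge[OF e]
      have "vertices Q \<inter> \<phi> (closed_segment u v) = {g u, g v}" using im[OF E(3)] E(2) by simp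
      moreover have "g u \<noteq> g v" using E(1) uv ginj by (simp add: inj_on_eq_iff)
      ultimately show "pedge Q (g u) (g v)"
        using edge_from_vertices(1)[OF Q face[OF E(3)]] by blast
    next
      assume e: "pedge Q (g u) (g v)"
      note E' = vertices_edge[OF e]
      obtain E where E: "E face_of P" "\<phi> E = closed_segment (g u) (g v)" using surj[OF E'(3)] by blast
      have "g ` (vertices P \<inter> E) = g ` {u, v}" using im[OF E(1)] E(2) E'(2) by simp
      then have "vertices P \<inter> E = {u, v}"
        using ginj uv by (subst (asm) inj_on_image_eq_iff[OF ginj]) auto
      moreover have "u \<noteq> v" using E'(1) by auto
      ultimately show "pedge P u v" using edge_from_vertices(1)[OF P E(1)] by blast
    qed
  qed
qed

definition sgn_of :: "bool \<Rightarrow> real" where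
  "sgn_of b = (if b then 1 else - 1)"

definition cube_vertex :: "'a::euclidean_space set \<Rightarrow> ('a \<Rightarrow> bool) \<Rightarrow> 'a" where
  "cube_vertex B f = (\<Sum>b\<in>B. sgn_of (f b) *\<^sub>R b)"

context
  fixes B :: "'a::euclidean_space set"
  assumes B: "B \<subseteq> Basis"
begin

lemma finite_B: "finite B"
  using B finite_Basis finite_subset by blast

lemma inner_comb: "(\<Sum>b\<in>B. r b *\<^sub>R b) \<bullet> c = r c" if "c \<in> B"
proof -
  have "(\<Sum>b\<in>B. r b *\<^sub>R b) \<bullet> c = (\<Sum>b\<in>B. if b = c then r b else 0)"
    unfolding inner_sum_left
  proof (intro sum.cong refl)
    fix b assume "b \<in> B"
    then have "b \<in> Basis" "c \<in> Basis" using that B by auto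
    then show "(r b *\<^sub>R b) \<bullet> c = (if b = c then r b else 0)" by (simp add: inner_Basis)
  qed
  then show ?thesis using that finite_B by simp
qed

lemma inner_cube_vertex: "c \<in> B \<Longrightarrow> cube_vertex B f \<bullet> c = sgn_of (f c)"
  unfolding cube_vertex_def by (rule inner_comb)

lemma sgn_of_eq: "sgn_of x = sgn_of y \<longleftrightarrow> x = y"
  by (auto simp: sgn_of_def)

lemma cube_vertex_inj: "inj_on (cube_vertex B) (cube B a)"
proof (rule inj_onI)
  fix f g assume fg: "f \<in> cube B a" "g \<in> cube B a" "cube_vertex B f = cube_vertex B g"
  have "f b = g b" for b
  proof (cases "b \<in> B")
    case True
    then show ?thesis
      using inner_cube_vertex[OF True, of f] inner_cube_vertex[OF True, of g] fg(3) sgn_of_eq by metis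
  next
    case False
    then show ?thesis using fg(1,2) by (simp add: cube_def)
  qed
  then show "f = g" by blast
qed

lemma standard_cube_hull: "standard_cube B = convex hull (cube_vertex B ` cube B a)"
proof -
  have "{\<Sum>b\<in>B. \<epsilon> b *\<^sub>R b | \<epsilon>. \<forall>b\<in>B. \<epsilon> b \<in> {- 1, 1}} = cube_vertex B ` cube B a"
  proof (intro equalityI subsetI)
    fix x assume "x \<in> {\<Sum>b\<in>B. \<epsilon> b *\<^sub>R b | \<epsilon>. \<forall>b\<in>B. \<epsilon> b \<in> {- 1, 1}}"
    then obtain \<epsilon> where e: "x = (\<Sum>b\<in>B. \<epsilon> b *\<^sub>R b)" "\<forall>b\<in>B. \<epsilon> b \<in> {- 1, 1::real}" by blast
    define f where "f b = (if b \<in> B then \<epsilon> b = 1 else a b)" for b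
    have "x = cube_vertex B f"
      unfolding e(1) cube_vertex_def
    proof (intro sum.cong)
      fix b assume "b \<in> B"
      then show "\<epsilon> b *\<^sub>R b = sgn_of (f b) *\<^sub>R b" using e(2) by (auto simp: f_def sgn_of_def)
    qed simp
    moreover have "f \<in> cube B a" by (simp add: cube_def f_def)
    ultimately show "x \<in> cube_vertex B ` cube B a" by blast
  next
    fix x assume "x \<in> cube_vertex B ` cube B a"
    then obtain f where "x = (\<Sum>b\<in>B. sgn_of (f b) *\<^sub>R b)" unfolding cube_vertex_def by blast
    moreover have "\<forall>b\<in>B. sgn_of (f b) \<in> {- 1, 1}" by (simp add: sgn_of_def)
    ultimately show "x \<in> {\<Sum>b\<in>B. \<epsilon> b *\<^sub>R b | \<epsilon>. \<forall>b\<in>B. \<epsilon> b \<in> {- 1, 1}}"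
      by (intro CollectI exI[of _ "\<lambda>b. sgn_of (f b)"] conjI)
  qed
  then show ?thesis by (simp add: standard_cube_def)
qed

lemma polytope_standard_cube: "polytope (standard_cube B)"
  using is_cube_standard_cube[OF B] by (simp add: is_cube_def)

lemma standard_cube_bounds:
  assumes "x \<in> standard_cube B"
  shows "x = (\<Sum>b\<in>B. (x \<bullet> b) *\<^sub>R b)" "\<And>b. b \<in> B \<Longrightarrow> x \<bullet> b \<le> 1" "\<And>b. b \<in> B \<Longrightarrow> - 1 \<le> x \<bullet> b"
proof -
  let ?K = "{x. x = (\<Sum>b\<in>B. (x \<bullet> b) *\<^sub>R b)} \<inter> (\<Inter>b\<in>B. {x. b \<bullet> x \<le> 1} \<inter> {x. - 1 \<le> b \<bullet> x})"
  have "convex {x. x = (\<Sum>b\<in>B. (x \<bullet> b) *\<^sub>R b)}"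
  proof -
    have "subspace {x. x = (\<Sum>b\<in>B. (x \<bullet> b) *\<^sub>R b)}"
    proof (rule subspaceI)
      fix x y :: 'a and c :: real
      assume x: "x \<in> {x. x = (\<Sum>b\<in>B. (x \<bullet> b) *\<^sub>R b)}"
      have "c *\<^sub>R x = c *\<^sub>R (\<Sum>b\<in>B. (x \<bullet> b) *\<^sub>R b)" by (rule arg_cong[OF CollectD[OF x]])
      also have "\<dots> = (\<Sum>b\<in>B. ((c *\<^sub>R x) \<bullet> b) *\<^sub>R b)" by (simp add: scaleR_sum_right)
      finally show "c *\<^sub>R x \<in> {x. x = (\<Sum>b\<in>B. (x \<bullet> b) *\<^sub>R b)}" by (rule CollectI)
      assume y: "y \<in> {x. x = (\<Sum>b\<in>B. (x \<bullet> b) *\<^sub>R b)}"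
      have "x + y = (\<Sum>b\<in>B. (x \<bullet> b) *\<^sub>R b) + (\<Sum>b\<in>B. (y \<bullet> b) *\<^sub>R b)"
        by (rule arg_cong2[OF CollectD[OF x] CollectD[OF y]])
      also have "\<dots> = (\<Sum>b\<in>B. ((x + y) \<bullet> b) *\<^sub>R b)"
        by (simp add: inner_add_left scaleR_add_left sum.distrib)
      finally show "x + y \<in> {x. x = (\<Sum>b\<in>B. (x \<bullet> b) *\<^sub>R b)}" by (rule CollectI)
    qed simp
    then show ?thesis by (rule subspace_imp_convex)
  qed
  then have "convex ?K"
    by (intro convex_Int convex_INT convex_halfspace_le) (auto simp: convex_halfspace_ge)
  moreover have "cube_vertex B ` cube B (\<lambda>_. False) \<subseteq> ?K"
  proof
    fix y assume "y \<in> cube_vertex B ` cube B (\<lambda>_. False)"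
    then obtain f where y: "y = cube_vertex B f" by blast
    have "y = (\<Sum>b\<in>B. (y \<bullet> b) *\<^sub>R b)"
      unfolding y by (subst (1) cube_vertex_def) (simp add: inner_cube_vertex)
    moreover have "b \<bullet> y \<le> 1 \<and> - 1 \<le> b \<bullet> y" if "b \<in> B" for b
      using inner_cube_vertex[OF that, of f] unfolding y by (simp add: inner_commute sgn_of_def)
    ultimately show "y \<in> ?K" by blast
  qed
  ultimately have "standard_cube B \<subseteq> ?K"
    unfolding standard_cube_hull[of "\<lambda>_. False"] by (rule hull_minimal[rotated])
  then have xK: "x \<in> ?K" using assms by blast
  then show "x = (\<Sum>b\<in>B. (x \<bullet> b) *\<^sub>R b)" by blast
  show "x \<bullet> b \<le> 1" "- 1 \<le> x \<bullet> b" if "b \<in> B" for b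
    using xK that by (auto simp: inner_commute)
qed

lemma cube_vertex_in: "cube_vertex B f \<in> standard_cube B"
proof -
  have "f \<in> cube B f" by (simp add: cube_def)
  then show ?thesis
    unfolding standard_cube_hull[of f] by (rule hull_inc[OF imageI])
qed

text \<open>
  Fixing a coordinate at an extreme value cuts out a face, and faces are closed under intersection.
\<close>

lemma standard_cube_face:
  assumes "S \<subseteq> B"
  shows "{x \<in> standard_cube B. \<forall>b\<in>S. x \<bullet> b = sgn_of (f b)} face_of standard_cube B"
proof -
  have conv: "convex (standard_cube B)" using polytope_standard_cube by (rule polytope_imp_convex)
  have "finite S" using assms finite_B finite_subset by blast
  then show ?thesis using assms
  proof (induction S rule: finite_induct)
    case empty
    then show ?case using conv by (simp add: face_of_refl)
  next
    case (insert c S)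
    have "(standard_cube B \<inter> {x. c \<bullet> x = sgn_of (f c)}) face_of standard_cube B"
    proof (cases "f c")
      case True
      then show ?thesis
        using standard_cube_bounds(2)[of _ c] insert(4) conv
        by (intro face_of_Int_supporting_hyperplane_le) (auto simp: sgn_of_def inner_commute)
    next
      case False
      then show ?thesis
        using standard_cube_bounds(3)[of _ c] insert(4) conv
        by (intro face_of_Int_supporting_hyperplane_ge) (auto simp: sgn_of_def inner_commute)
    qed
    moreover have "{x \<in> standard_cube B. \<forall>b\<in>S. x \<bullet> b = sgn_of (f b)} face_of standard_cube B"
      using insert by blast
    ultimately have "(standard_cube B \<inter> {x. c \<bullet> x = sgn_of (f c)}) \<inter>
        {x \<in> standard_cube B. \<forall>b\<in>S. x \<bullet> b = sgn_of (f b)} face_of standard_cube B"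
      by (rule face_of_Int)
    moreover have "(standard_cube B \<inter> {x. c \<bullet> x = sgn_of (f c)}) \<inter>
        {x \<in> standard_cube B. \<forall>b\<in>S. x \<bullet> b = sgn_of (f b)} =
        {x \<in> standard_cube B. \<forall>b\<in>insert c S. x \<bullet> b = sgn_of (f b)}"
      by (auto simp: inner_commute)
    ultimately show ?case by simp
  qed
qed

lemma vertices_standard_cube: "vertices (standard_cube B) = cube_vertex B ` cube B a"
proof (intro equalityI subsetI)
  fix x assume "x \<in> vertices (standard_cube B)"
  then show "x \<in> cube_vertex B ` cube B a"
    unfolding standard_cube_hull[of a] using extreme_point_of_convex_hull by blast
next
  fix x assume "x \<in> cube_vertex B ` cube B a"
  then obtain f where x: "x = cube_vertex B f" by blast
  have "{y \<in> standard_cube B. \<forall>b\<in>B. y \<bullet> b = sgn_of (f b)} = {x}"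
  proof (intro equalityI subsetI)
    fix y assume y: "y \<in> {y \<in> standard_cube B. \<forall>b\<in>B. y \<bullet> b = sgn_of (f b)}"
    then have "y = (\<Sum>b\<in>B. (y \<bullet> b) *\<^sub>R b)" using standard_cube_bounds(1) by blast
    also have "\<dots> = x" unfolding x cube_vertex_def using y by (intro sum.cong) auto
    finally show "y \<in> {x}" by simp
  next
    fix y assume "y \<in> {x}"
    then show "y \<in> {y \<in> standard_cube B. \<forall>b\<in>B. y \<bullet> b = sgn_of (f b)}"
      using cube_vertex_in[of f] inner_cube_vertex[of _ f] by (simp add: x)
  qed
  then have "{x} face_of standard_cube B" using standard_cube_face[of B f] by simp
  then show "x \<in> vertices (standard_cube B)" by (simp add: face_of_singleton)
qed

lemma standard_cube_edge:
  assumes f: "f \<in> cube B a" and i: "i \<in> B"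
  shows "pedge (standard_cube B) (cube_vertex B f) (cube_vertex B (flip i f))"
proof (rule edge_from_vertices(1)[OF polytope_standard_cube])
  let ?E = "{x \<in> standard_cube B. \<forall>b\<in>B - {i}. x \<bullet> b = sgn_of (f b)}"
  show "?E face_of standard_cube B" by (rule standard_cube_face) blast
  show "vertices (standard_cube B) \<inter> ?E = {cube_vertex B f, cube_vertex B (flip i f)}"
  proof (intro equalityI subsetI)
    fix x assume x: "x \<in> vertices (standard_cube B) \<inter> ?E"
    then obtain g where g: "x = cube_vertex B g" "g \<in> cube B a"
      unfolding vertices_standard_cube[of a] by blast
    have gb: "g b = f b" if "b \<noteq> i" for b
    proof (cases "b \<in> B")
      case True
      then have "x \<bullet> b = sgn_of (f b)" using x that by blast
      then show ?thesis using inner_cube_vertex[OF True, of g] g(1) sgn_of_eq by simp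
    next
      case False
      then show ?thesis using f g(2) by (simp add: cube_def)
    qed
    have "g = f \<or> g = flip i f"
    proof (cases "g i = f i")
      case True
      have "g b = f b" for b using True gb by (cases "b = i") simp_all
      then show ?thesis by blast
    next
      case False
      have "g b = flip i f b" for b using False gb by (cases "b = i") (simp_all add: flip_apply)
      then show ?thesis by blast
    qed
    then show "x \<in> {cube_vertex B f, cube_vertex B (flip i f)}" using g(1) by auto
  next
    fix x assume "x \<in> {cube_vertex B f, cube_vertex B (flip i f)}"
    then obtain g where g: "x = cube_vertex B g" "g = f \<or> g = flip i f" by auto
    then have "g \<in> cube B a" using f flip_in_cube[OF f i] by (elim disjE) simp_all
    moreover have "x \<bullet> b = sgn_of (f b)" if "b \<in> B - {i}" for b
      using that g inner_cube_vertex[of b g] by (auto simp: flip_apply)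
    ultimately have "x \<in> vertices (standard_cube B)" "x \<in> ?E"
      unfolding vertices_standard_cube[of a] using cube_vertex_in[of g] by (simp_all add: g(1))
    then show "x \<in> vertices (standard_cube B) \<inter> ?E" by (rule IntI)
  qed
  show "cube_vertex B f \<noteq> cube_vertex B (flip i f)"
    using cube_vertex_inj[of a] f flip_in_cube[OF f i] by (simp add: inj_on_eq_iff)
qed

text \<open>
  If the ends differed in a further coordinate, reflecting the segment in coordinate \<open>i\<close> would give another
  segment with the same midpoint, whose ends would then lie on the edge as well.
\<close>

lemma standard_cube_edge_imp:
  assumes fg: "f \<in> cube B a" "g \<in> cube B a"
    and e: "pedge (standard_cube B) (cube_vertex B f) (cube_vertex B g)"
  shows "adj f g"
proof -
  note E = vertices_edge[OF e]
  have "f \<noteq> g" using E(1) by auto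
  then obtain i where i: "f i \<noteq> g i" by blast
  then have iB: "i \<in> B" using fg by (auto simp: cube_def)
  have "g = flip i f"
  proof (rule ccontr)
    assume no: "g \<noteq> flip i f"
    define f' g' where "f' = flip i f" and "g' = flip i g"
    have cub: "f' \<in> cube B a" "g' \<in> cube B a"
      using fg iB by (simp_all add: f'_def g'_def flip_in_cube)
    have "f' \<noteq> g'" using \<open>f \<noteq> g\<close> by (simp add: f'_def g'_def)
    then have ne: "cube_vertex B f' \<noteq> cube_vertex B g'"
      using cube_vertex_inj[of a] cub by (simp add: inj_on_eq_iff)
    have sgns: "sgn_of (f' b) + sgn_of (g' b) = sgn_of (f b) + sgn_of (g b)" for b
      using i by (cases "b = i") (auto simp: f'_def g'_def flip_apply sgn_of_def)
    have add: "cube_vertex B k + cube_vertex B l = (\<Sum>b\<in>B. (sgn_of (k b) + sgn_of (l b)) *\<^sub>R b)" for k l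
      by (simp add: cube_vertex_def sum.distrib scaleR_add_left)
    have "cube_vertex B f' + cube_vertex B g' = cube_vertex B f + cube_vertex B g"
      unfolding add sgns by (rule refl)
    then have "midpoint (cube_vertex B f') (cube_vertex B g') = midpoint (cube_vertex B f) (cube_vertex B g)"
      by (simp add: midpoint_def)
    moreover have "midpoint (cube_vertex B f') (cube_vertex B g')
        \<in> open_segment (cube_vertex B f') (cube_vertex B g')"
      using ne by simp
    ultimately have "midpoint (cube_vertex B f) (cube_vertex B g)
        \<in> open_segment (cube_vertex B f') (cube_vertex B g')" by simp
    moreover have "midpoint (cube_vertex B f) (cube_vertex B g)
        \<in> closed_segment (cube_vertex B f) (cube_vertex B g)" by simp
    ultimately have "cube_vertex B f' \<in> closed_segment (cube_vertex B f) (cube_vertex B g)"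
      using E(3) cube_vertex_in[of f'] cube_vertex_in[of g'] unfolding face_of_def by blast
    moreover have "cube_vertex B f' \<in> vertices (standard_cube B)"
      unfolding vertices_standard_cube[of a] using cub by blast
    ultimately have "cube_vertex B f' = cube_vertex B f \<or> cube_vertex B f' = cube_vertex B g"
      using E(2) by blast
    then have "f' = f \<or> f' = g"
      using inj_on_eq_iff[OF cube_vertex_inj cub(1) fg(1)] inj_on_eq_iff[OF cube_vertex_inj cub(1) fg(2)]
      by simp
    then show False using no by (simp add: f'_def)
  qed
  then show ?thesis by simp
qed

end

text \<open>
  The coordinates are indexed by the basis vectors themselves, and \<open>True\<close> stands for the entry \<open>1\<close> of a
  vertex of the standard cube.
\<close>

lemma is_cube_graph:
  fixes F :: "'a::euclidean_space set"
  assumes "is_cube F"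
  obtains B :: "'a set" and h :: "('a \<Rightarrow> bool) \<Rightarrow> 'a" where
    "finite B" "bij_betw h (cube B (\<lambda>_. False)) (vertices F)"
    "\<And>f g. f \<in> cube B (\<lambda>_. False) \<Longrightarrow> g \<in> cube B (\<lambda>_. False) \<Longrightarrow> pedge F (h f) (h g) \<longleftrightarrow> adj f g"
proof -
  let ?a = "\<lambda>_::'a. False"
  obtain B :: "'a set" where B: "B \<subseteq> Basis" "combinatorially_equivalent F (standard_cube B)"
    and F: "polytope F"
    using assms unfolding is_cube_def by blast
  note Q = polytope_standard_cube[OF B(1)]
  obtain g where g: "bij_betw g (vertices F) (vertices (standard_cube B))"
    "\<And>u v. u \<in> vertices F \<Longrightarrow> v \<in> vertices F \<Longrightarrow> pedge F u v \<longleftrightarrow> pedge (standard_cube B) (g u) (g v)"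
    using combinatorially_equivalent_graph_iso[OF F Q B(2)] by metis
  define g' where "g' = the_inv_into (vertices F) g"
  have g': "bij_betw g' (vertices (standard_cube B)) (vertices F)"
    unfolding g'_def using g(1) by (rule bij_betw_the_inv_into)
  have gg': "g (g' w) = w" if "w \<in> vertices (standard_cube B)" for w
    unfolding g'_def using g(1) that by (simp add: bij_betw_def f_the_inv_into_f)
  have cv: "bij_betw (cube_vertex B) (cube B ?a) (vertices (standard_cube B))"
    using cube_vertex_inj[OF B(1)] vertices_standard_cube[OF B(1), of ?a]
    by (simp add: bij_betw_def)
  show thesis
  proof (rule that[of B "g' \<circ> cube_vertex B"])
    show "finite B" using finite_B[OF B(1)] .
    show "bij_betw (g' \<circ> cube_vertex B) (cube B ?a) (vertices F)"
      using cv g' by (rule bij_betw_trans)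
    fix f k assume fk: "f \<in> cube B ?a" "k \<in> cube B ?a"
    have V: "cube_vertex B f \<in> vertices (standard_cube B)" "cube_vertex B k \<in> vertices (standard_cube B)"
      using cv fk by (auto simp: bij_betw_def)
    then have "g' (cube_vertex B f) \<in> vertices F" "g' (cube_vertex B k) \<in> vertices F"
      using bij_betwE[OF g'] by blast+
    then have "pedge F (g' (cube_vertex B f)) (g' (cube_vertex B k))
        \<longleftrightarrow> pedge (standard_cube B) (cube_vertex B f) (cube_vertex B k)"
      using g(2) gg' V by simp
    also have "\<dots> \<longleftrightarrow> adj f k"
    proof
      assume "adj f k"
      then obtain i where i: "k = flip i f" unfolding adj_def by blast
      have "i \<in> B"
      proof (rule ccontr)
        assume "i \<notin> B"
        then have "\<not> f i" "\<not> k i" using fk by (simp_all add: cube_def)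
        then show False using i by (simp add: flip_apply)
      qed
      then show "pedge (standard_cube B) (cube_vertex B f) (cube_vertex B k)"
        unfolding i using fk(1) by (intro standard_cube_edge[OF B(1)])
    qed (rule standard_cube_edge_imp[OF B(1) fk])
    finally show "pedge F ((g' \<circ> cube_vertex B) f) ((g' \<circ> cube_vertex B) k) \<longleftrightarrow> adj f k" by simp
  qed
qed

section \<open>Linkedness of cubical polytopes\<close>

lemma card_vertices_ge:
  assumes "polytope P"
  shows "aff_dim P + 1 \<le> int (card (vertices P))"
proof -
  have "aff_dim P = aff_dim (vertices P)"
    using polytope_eq_hull[OF assms] by (metis aff_dim_convex_hull)
  then show ?thesis using aff_dim_le_card[OF finite_vertices[OF assms]] by simp
qed

lemma k_linkedI:
  fixes P :: "'a::euclidean_space set"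
  assumes card: "2 * k \<le> card (vertices P)"
    and link: "\<And>(M :: 'a set set) s t. terminals (vertices P) M s t {} \<Longrightarrow> card M = k \<Longrightarrow>
      linkable (pedge P) (vertices P) M s t {}"
  shows "k_linked k (polytope_graph P)"
  unfolding k_linked_def
proof (intro conjI allI impI)
  show "2 * k \<le> card (pverts (polytope_graph P))" using card by (simp add: polytope_graph_def)
  fix X M
  assume "X \<subseteq> pverts (polytope_graph P) \<and> finite X \<and> card X = 2 * k \<and> partition_on X M \<and>
    card M = k \<and> (\<forall>e\<in>M. card e = 2)"
  then have X: "X \<subseteq> vertices P" "finite X" "partition_on X M" "card M = k"
    and M: "\<And>e. e \<in> M \<Longrightarrow> card e = 2" by (auto simp: polytope_graph_def)
  have "\<forall>e\<in>M. \<exists>p. e = {fst p, snd p} \<and> fst p \<noteq> snd p"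
    using M by (metis card_2_iff fst_conv snd_conv)
  from bchoice[OF this] obtain q where q: "\<forall>e\<in>M. e = {fst (q e), snd (q e)} \<and> fst (q e) \<noteq> snd (q e)"
    by (rule exE)
  define s t where "s e = fst (q e)" and "t e = snd (q e)" for e
  have st: "e = {s e, t e}" "s e \<noteq> t e" if "e \<in> M" for e
    using bspec[OF q that] unfolding s_def t_def by blast+
  have disj: "e \<inter> e' = {}" if "e \<in> M" "e' \<in> M" "e \<noteq> e'" for e e'
    using X(3) that unfolding partition_on_def disjoint_def by blast
  have MX: "e \<subseteq> X" if "e \<in> M" for e using X(3) that unfolding partition_on_def by blast
  have mem: "s e \<in> e" "t e \<in> e" if "e \<in> M" for e using st(1)[OF that] by blast+
  have same: "e = e'" if "e \<in> M" "e' \<in> M" "x \<in> e" "x \<in> e'" for e e' x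
    using disj[OF that(1,2)] that(3,4) by blast
  have T: "terminals (vertices P) M s t {}"
    unfolding terminals_def
  proof (intro conjI)
    show "finite M" using X(2,3) finite_elements by blast
    show "inj_on s M" by (rule inj_onI) (metis mem(1) same)
    show "inj_on t M" by (rule inj_onI) (metis mem(2) same)
    have "s e \<noteq> t e'" if "e \<in> M" "e' \<in> M" for e e'
      using same[OF that mem(1)[OF that(1)]] mem(2)[OF that(2)] st(2)[OF that(1)] by metis
    then show "s ` M \<inter> t ` M = {}" by blast
    show "s ` M \<union> t ` M \<union> {} \<subseteq> vertices P" using mem MX X(1) by blast
  qed auto
  then have "linkable (pedge P) (vertices P) M s t {}" using X(4) by (rule link)
  then obtain C where C: "\<And>e. e \<in> M \<Longrightarrow> joined (pedge P) (C e) (s e) (t e)"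
      "\<And>e. e \<in> M \<Longrightarrow> C e \<subseteq> vertices P" "disjoint_family_on C M"
    unfolding linkable_def by auto
  have "\<forall>e\<in>M. \<exists>p. p \<noteq> [] \<and> hd p = s e \<and> last p = t e \<and> set p \<subseteq> C e \<and> distinct p \<and> successively (pedge P) p"
    using joined_imp_path[OF C(1)] by blast
  from bchoice[OF this] obtain L where L: "\<forall>e\<in>M. L e \<noteq> [] \<and> hd (L e) = s e \<and> last (L e) = t e \<and>
      set (L e) \<subseteq> C e \<and> distinct (L e) \<and> successively (pedge P) (L e)" by (rule exE)
  have arcs: "set (vwalk_arcs p) \<subseteq> {(u, v). pedge P u v}" if "successively (pedge P) p" for p
    using that by (induction p rule: vwalk_arcs.induct) auto
  show "\<exists>L. (\<forall>e\<in>M. vpath (L e) (with_proj (polytope_graph P)) \<and> {hd (L e), last (L e)} = e) \<and>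
      (\<forall>e\<in>M. \<forall>e'\<in>M. e \<noteq> e' \<longrightarrow> set (L e) \<inter> set (L e') = {})"
  proof (intro exI[of _ L] conjI ballI impI)
    fix e assume e: "e \<in> M"
    note Le = bspec[OF L e]
    have "set (L e) \<subseteq> C e" using Le by simp
    then have "set (L e) \<subseteq> vertices P" using C(2)[OF e] by (rule subset_trans)
    then show "vpath (L e) (with_proj (polytope_graph P))"
      using Le arcs[of "L e"] by (simp add: vpath_def vwalk_def polytope_graph_def pedge_def)
    show "{hd (L e), last (L e)} = e" using Le st(1)[OF e] by simp
  next
    fix e e' assume e: "e \<in> M" "e' \<in> M" "e \<noteq> e'"
    have "C e \<inter> C e' = {}" using C(3) e by (rule disjoint_family_onD)
    moreover have "set (L e) \<subseteq> C e" "set (L e') \<subseteq> C e'"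
      using bspec[OF L e(1)] bspec[OF L e(2)] by simp_all
    ultimately show "set (L e) \<inter> set (L e') = {}" by (meson disjoint_iff subsetD)
  qed
qed

lemma polytope_disjoint_approach:
  assumes P: "polytope P" and F: "F face_of P"
    and X: "X \<subseteq> vertices P" "int (card X) \<le> aff_dim P" "card X \<le> card (vertices F)"
  obtains f W where "\<And>x. x \<in> X \<Longrightarrow> joined (pedge P) (W x) x (f x)" "\<And>x. x \<in> X \<Longrightarrow> W x \<subseteq> vertices P"
    "\<And>x. x \<in> X \<Longrightarrow> W x \<inter> vertices F = {f x}" "disjoint_family_on W X"
proof -
  have fin: "finite (vertices P)" "finite X"
    using finite_vertices[OF P] X(1) finite_subset by blast+
  have VF: "vertices F \<subseteq> vertices P" using vertices_face[OF F] by blast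
  have "\<exists>x\<in>X. \<exists>y\<in>vertices F. joined (pedge P) (vertices P - S) x y" if S: "finite S" "card S < card X" for S
  proof -
    have "\<not> X \<subseteq> S" using card_mono[OF S(1), of X] S(2) by linarith
    then obtain x where x: "x \<in> X" "x \<notin> S" by blast
    have "\<not> vertices F \<subseteq> S" using card_mono[OF S(1), of "vertices F"] S(2) X(3) by linarith
    then obtain y where y: "y \<in> vertices F" "y \<notin> S" by blast
    have "card (S \<inter> vertices P) \<le> card S" using S(1) by (simp add: card_mono)
    then have "int (card (S \<inter> vertices P)) < aff_dim P" using S(2) X(2) by linarith
    from balinski[OF P inf_le2 this]
    have "joined (pedge P) (vertices P - S \<inter> vertices P) x y"
      using x y VF X(1) by auto
    moreover have "vertices P - S \<inter> vertices P = vertices P - S" by blast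
    ultimately show ?thesis using x(1) y(1) by auto
  qed
  from disjoint_approach[OF fin this] show thesis using that by metis
qed

text \<open>
  The terminals approach \<open>F\<close> along disjoint paths that meet \<open>F\<close> only in their last vertices, and these are
  linked inside \<open>F\<close>.
\<close>

lemma linkable_through_cube_face:
  fixes M :: "'k set"
  assumes P: "polytope P" and F: "F face_of P" "is_cube F" "4 \<le> aff_dim F"
    and T: "terminals (vertices P) M s t {}"
    and card: "2 * int (card M) \<le> aff_dim F + 1" "2 * int (card M) \<le> aff_dim P"
  shows "linkable (pedge P) (vertices P) M s t {}"
proof -
  let ?a = "\<lambda>_::'a. False"
  have polyF: "polytope F" using P F(1) by (rule face_of_polytope_polytope)
  have VF: "vertices F \<subseteq> vertices P" using vertices_face[OF F(1)] by blast
  obtain B h where B: "finite B" and h: "bij_betw h (cube B ?a) (vertices F)"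
    and hE: "\<And>f g. f \<in> cube B ?a \<Longrightarrow> g \<in> cube B ?a \<Longrightarrow> pedge F (h f) (h g) \<longleftrightarrow> adj f g"
    using is_cube_graph[OF F(2)] by metis
  have hinj: "inj_on h (cube B ?a)" and hV: "h ` cube B ?a = vertices F"
    using h by (simp_all add: bij_betw_def)
  \<comment> \<open>a vertex has at most \<open>card B\<close> neighbours in the cube and at least \<open>dim F\<close> in \<open>F\<close>\<close>
  have dim: "aff_dim F \<le> int (card B)"
  proof -
    have a: "?a \<in> cube B ?a" by (simp add: cube_def)
    have "{w \<in> vertices F. pedge F (h ?a) w} \<subseteq> (\<lambda>i. h (flip i ?a)) ` B"
    proof
      fix w assume w: "w \<in> {w \<in> vertices F. pedge F (h ?a) w}"
      then obtain g where g: "g \<in> cube B ?a" "w = h g" using hV by blast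
      then have "adj ?a g" using w hE[OF a g(1)] by simp
      then obtain i where i: "g = flip i ?a" unfolding adj_def by blast
      then have "i \<in> B" using g(1) by (auto simp: cube_def flip_apply)
      then show "w \<in> (\<lambda>i. h (flip i ?a)) ` B" using i g(2) by blast
    qed
    then have "card {w \<in> vertices F. pedge F (h ?a) w} \<le> card B"
      using B by (meson card_image_le card_mono finite_imageI le_trans)
    moreover have "h ?a \<in> vertices F" using a hV by blast
    ultimately show ?thesis using degree_ge_dim[OF polyF, of "h ?a"] by simp
  qed
  define X where "X = s ` M \<union> t ` M"
  have finM: "finite M" using T by (simp add: terminals_def)
  have XV: "X \<subseteq> vertices P" using T by (simp add: terminals_def X_def)
  have cX: "card X = 2 * card M" using card_terminals[OF T] by (simp add: X_def)
  have "int (card X) \<le> aff_dim P" "card X \<le> card (vertices F)"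
    using card cX card_vertices_ge[OF polyF] by linarith+
  from polytope_disjoint_approach[OF P F(1) XV this]
  obtain f W where W: "\<And>x. x \<in> X \<Longrightarrow> joined (pedge P) (W x) x (f x)" "\<And>x. x \<in> X \<Longrightarrow> W x \<subseteq> vertices P"
    "\<And>x. x \<in> X \<Longrightarrow> W x \<inter> vertices F = {f x}" "disjoint_family_on W X" by metis
  have Wdisj: "W x \<inter> W y = {}" if "x \<in> X" "y \<in> X" "x \<noteq> y" for x y
    using W(4) that by (rule disjoint_family_onD)
  have fW: "f x \<in> W x" "f x \<in> vertices F" if "x \<in> X" for x using W(3)[OF that] by blast+
  define r where "r x = the_inv_into (cube B ?a) h (f x)" for x
  have r: "r x \<in> cube B ?a" "h (r x) = f x" if "x \<in> X" for x
    using the_inv_into_into[OF hinj _ subset_refl, of "f x"] f_the_inv_into_f[OF hinj, of "f x"]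
      fW(2)[OF that] hV unfolding r_def by simp_all
  have rinj: "r x \<noteq> r y" if "x \<in> X" "y \<in> X" "x \<noteq> y" for x y
    using Wdisj[OF that] fW(1)[OF that(1)] fW(1)[OF that(2)] r(2)[OF that(1)] r(2)[OF that(2)] by auto
  have stX: "s k \<in> X" "t k \<in> X" if "k \<in> M" for k using that by (auto simp: X_def)
  have T': "terminals (cube B ?a) M (\<lambda>k. r (s k)) (\<lambda>k. r (t k)) {}"
    unfolding terminals_def
  proof (intro conjI)
    show "inj_on (\<lambda>k. r (s k)) M"
    proof (rule inj_onI)
      fix k l assume kl: "k \<in> M" "l \<in> M" "r (s k) = r (s l)"
      then have "s k = s l" using rinj[OF stX(1)[OF kl(1)] stX(1)[OF kl(2)]] by blast
      then show "k = l" using terminalsD(1)[OF T kl(1,2)] by simp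
    qed
    show "inj_on (\<lambda>k. r (t k)) M"
    proof (rule inj_onI)
      fix k l assume kl: "k \<in> M" "l \<in> M" "r (t k) = r (t l)"
      then have "t k = t l" using rinj[OF stX(2)[OF kl(1)] stX(2)[OF kl(2)]] by blast
      then show "k = l" using terminalsD(2)[OF T kl(1,2)] by simp
    qed
    have "r (s k) \<noteq> r (t l)" if "k \<in> M" "l \<in> M" for k l
      using rinj[OF stX(1)[OF that(1)] stX(2)[OF that(2)]] terminalsD(3)[OF T that] by blast
    then show "(\<lambda>k. r (s k)) ` M \<inter> (\<lambda>k. r (t k)) ` M = {}" by blast
    show "(\<lambda>k. r (s k)) ` M \<union> (\<lambda>k. r (t k)) ` M \<union> {} \<subseteq> cube B ?a"
      using r(1) stX by blast
  qed (use finM in auto)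
  have n: "4 \<le> card B" "2 * card M + card ({} :: ('a \<Rightarrow> bool) set) \<le> card B + 1"
    using dim F(3) card(1) by simp_all
  from cube_linksD[OF cube_links_ge_4[OF n(1)] B refl T' n(2)]
  obtain C where C: "\<And>k. k \<in> M \<Longrightarrow> joined adj (C k) (r (s k)) (r (t k))"
      "\<And>k. k \<in> M \<Longrightarrow> C k \<subseteq> cube B ?a" "disjoint_family_on C M"
    unfolding linkable_def by auto
  define D where "D k = h ` C k \<union> (W (s k) \<union> W (t k))" for k
  have hC: "h ` C k \<subseteq> vertices F" if "k \<in> M" for k using C(2)[OF that] hV by blast
  have "joined (pedge P) (D k) (s k) (t k)" if k: "k \<in> M" for k
  proof -
    have "joined (pedge F) (h ` C k) (h (r (s k))) (h (r (t k)))"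
      using C(1)[OF k] by (rule joined_image) (use hE C(2)[OF k] in blast)
    then have "joined (pedge P) (D k) (f (s k)) (f (t k))"
      unfolding r(2)[OF stX(1)[OF k]] r(2)[OF stX(2)[OF k]]
      by (rule joined_mono_rel) (use pedge_face[OF _ F(1)] in \<open>auto simp: D_def\<close>)
    moreover have "joined (pedge P) (D k) (s k) (f (s k))"
      using W(1)[OF stX(1)[OF k]] by (rule joined_mono) (auto simp: D_def)
    ultimately have "joined (pedge P) (D k) (s k) (f (t k))"
      by (rule joined_trans)
    moreover have "joined (pedge P) (D k) (t k) (f (t k))"
      using W(1)[OF stX(2)[OF k]] by (rule joined_mono) (auto simp: D_def)
    then have "joined (pedge P) (D k) (f (t k)) (t k)"
      using symp_pedge by (rule joined_sym)
    ultimately show ?thesis by (rule joined_trans[rotated])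
  qed
  moreover have "D k \<subseteq> vertices P - {}" if k: "k \<in> M" for k
    using hC[OF k] VF W(2) stX[OF k] unfolding D_def by blast
  moreover have "disjoint_family_on D M"
    unfolding disjoint_family_on_def
  proof (intro ballI impI)
    fix k l assume kl: "k \<in> M" "l \<in> M" "k \<noteq> l"
    have far: "h ` C k \<inter> W x = {}" if k: "k \<in> M" and l: "l \<in> M" "k \<noteq> l" and x: "x = s l \<or> x = t l" for k l x
    proof -
      have xX: "x \<in> X" using x stX[OF l(1)] by blast
      have "r x \<in> C l" using joined_memD[OF C(1)[OF l(1)]] x by blast
      moreover have "C k \<inter> C l = {}" using C(3) k l by (rule disjoint_family_onD)
      ultimately have "r x \<notin> C k" by blast
      then have "h (r x) \<notin> h ` C k"
        using inj_on_image_mem_iff[OF hinj r(1)[OF xX] C(2)[OF k]] by simp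
      then have "f x \<notin> h ` C k" using r(2)[OF xX] by simp
      moreover have "h ` C k \<inter> W x \<subseteq> {f x}"
        using W(3)[OF xX] hC[OF k] by auto
      moreover have "A \<inter> A' = {}" if "z \<notin> A" "A \<inter> A' \<subseteq> {z}" for A A' and z :: 'a
        using that by blast
      ultimately show ?thesis by metis
    qed
    have "s k \<noteq> s l" "t k \<noteq> t l" "s k \<noteq> t l" "t k \<noteq> s l"
      using terminalsD(1-4)[OF T kl(1,2)] terminalsD(3)[OF T kl(2,1)] kl(3) by auto
    then have "W (s k) \<inter> W (s l) = {}" "W (t k) \<inter> W (t l) = {}" "W (s k) \<inter> W (t l) = {}" "W (t k) \<inter> W (s l) = {}"
      using Wdisj stX kl by simp_all
    moreover have "h ` C k \<inter> h ` C l = {}"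
    proof -
      have "C k \<inter> C l = {}" using C(3) kl by (rule disjoint_family_onD)
      then show ?thesis
        using inj_on_image_Int[OF hinj C(2)[OF kl(1)] C(2)[OF kl(2)]] by simp
    qed
    moreover have "h ` C k \<inter> W (s l) = {}" "h ` C k \<inter> W (t l) = {}"
        "h ` C l \<inter> W (s k) = {}" "h ` C l \<inter> W (t k) = {}"
      using far[OF kl] far[OF kl(2,1) kl(3)[symmetric]] by simp_all
    ultimately show "D k \<inter> D l = {}"
      unfolding D_def by (simp add: Int_Un_distrib Int_Un_distrib2 Int_commute)
  qed
  ultimately show ?thesis unfolding linkable_def by (intro exI[of _ D] conjI ballI)
qed

theorem theorem24:
  fixes P :: "'a::euclidean_space set" and d :: nat
  assumes "d \<ge> 1"
    and "cubical_polytope d P"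
  shows "k_linked (d div 2) (polytope_graph P)"
proof (rule k_linkedI)
  have P: "polytope P" "aff_dim P = int d" and facets: "\<And>F. F facet_of P \<Longrightarrow> is_cube F"
    using assms(2) by (auto simp: cubical_polytope_def)
  show "2 * (d div 2) \<le> card (vertices P)"
    using card_vertices_ge[OF P(1)] P(2) by linarith
  fix M :: "'a set set" and s t
  assume T: "terminals (vertices P) M s t {}" and card: "card M = d div 2"
  have fin: "finite M" using T by (simp add: terminals_def)
  consider "d div 2 = 0" | "d div 2 = 1" | "d = 4" | "5 \<le> d" by linarith
  then show "linkable (pedge P) (vertices P) M s t {}"
  proof cases
    case 1
    then show ?thesis using card fin by (simp add: linkable_empty)
  next
    case 2
    then obtain k where M: "M = {k}" using card by (auto simp: card_1_singleton_iff)
    have "joined (pedge P) (vertices P - {}) (s k) (t k)"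
      using polytope_graph_joined[OF P(1)] terminalsD(7,8)[OF T, of k k] M by simp
    then show ?thesis unfolding M by (rule linkable_single)
  next
    case 3
    then have "card M = 2" using card by simp
    then obtain p q where M: "M = {p, q}" "p \<noteq> q" by (metis card_2_iff)
    have pq: "p \<in> M" "q \<in> M" using M by auto
    note ne = terminalsD[OF T pq(1) pq(1)] terminalsD[OF T pq(2) pq(2)] terminalsD[OF T pq]
      terminalsD(3)[OF T pq(2,1)]
    have "\<exists>C D. joined (pedge P) C (s p) (t p) \<and> joined (pedge P) D (s q) (t q) \<and> C \<inter> D = {} \<and>
        C \<subseteq> vertices P \<and> D \<subseteq> vertices P"
      by (rule polytope_4_two_linked[OF P(1)]) (use P(2) 3 ne M(2) in auto)
    then obtain C D where CD: "joined (pedge P) C (s p) (t p)" "joined (pedge P) D (s q) (t q)"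
        "C \<inter> D = {}" "C \<subseteq> vertices P" "D \<subseteq> vertices P" by blast
    show ?thesis
      unfolding linkable_def M(1)
      by (rule exI[of _ "\<lambda>k. if k = p then C else D"])
         (use CD M(2) in \<open>auto simp: disjoint_family_on_def\<close>)
  next
    case 4
    obtain F where F: "F facet_of P"
      using polytope_facet_exists[OF P(1)] P(2) 4 by auto
    then have "F face_of P" "aff_dim F = int d - 1" using P(2) by (auto simp: facet_of_def)
    then show ?thesis
      using card P(2) 4
      by (intro linkable_through_cube_face[OF P(1) _ facets[OF F] _ T]) linarith+
  qed
qed

end
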